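(* Let $\alpha=(\alpha_1,\ldots,\alpha_k)$ be a composition of $m\le n$ of length $k$. Then $$G_n^{\alpha}(\mathbf{x},t+k)=\sum_{r=0}^{n-m}\binom{t}{r}\binom{n+k-1}{n-m-r}\sum_{\lambda\vdash n,\ \ell(\lambda)\le n-k-r+1}\frac{n\,(n-\ell(\lambda))!\,(n-k-r)!}{(n-k-r-\ell(\lambda)+1)!}\,m_\lambda(\mathbf{x}).$$ Moreover, for every partition $\lambda$ of $n$, $\#\mathcal S_\lambda^\alpha=[p_\lambda(\mathbf{x})]\,G_n^\alpha(\mathbf{x},1)$ and $$\sigma_\lambda^\alpha=\frac{\#\mathcal S_\lambda^\alpha}{\binom{n}{\alpha_1,\alpha_2,\ldots,\alpha_k,n-m}\,\#\mathcal C_\lambda}.$$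
   Context: Permutations are composed as functions: $(\pi\circ\rho)(i)=\pi(\rho(i))$; $[n]=\{1,\ldots,n\}$. $\ell(\lambda)$ is the number of parts of $\lambda$. For a composition $\alpha=(\alpha_1,\ldots,\alpha_k)$ of $m\le n$, $\mathcal{A}_n^{\alpha}$ is the set of tuples $A=(A_1,\ldots,A_k)$ of pairwise disjoint subsets of $[n]$ with $\#A_i=\alpha_i$. A permutation is $A$-separated if no cycle of it contains elements of more than one of the sets $A_i$. For $\lambda\vdash n$, $\mathcal C_\lambda$ is the set of permutations of $[n]$ of cycle type $\lambda$, and $\mathcal{S}_{\lambda}^{\alpha}$ is the set of pairs $(\pi,A)$ with $\pi\in\mathcal C_\lambda$, $A\in\mathcal A_n^\alpha$, such that $\pi\circ(1,2,\ldots,n)$ is $A$-separated; $\mathrm{uc}(\pi,A)$ is the number of cycles of $\pi\circ(1,2,\ldots,n)$ containing no element of $A_1\cup\cdots\cup A_k$. $G_n^{\alpha}(\mathbf{x},t)=\sum_{\lambda\vdash n}p_\lambda(\mathbf{x})\sum_{(\pi,A)\in\mathcal S_\lambda^\alpha}t^{\mathrm{uc}(\pi,A)}$, with $p_\lambda$ the power-sum and $m_\lambda$ the monomial symmetric functions in $\mathbf{x}=\{x_1,x_2,\ldots\}$; $[p_\lambda(\mathbf{x})]f$ denotes the coefficient of $p_\lambda$ in the expansion of the symmetric function $f$ in the power-sum basis. $\binom{t}{r}=t(t-1)\cdots(t-r+1)/r!$. The separation probability $\sigma_\lambda^\alpha$ is the probability that the product of a uniformly random permutation of cycle type $\lambda$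 with a uniformly random $n$-cycle is $A$-separated, for a fixed $A\in\mathcal A_n^\alpha$. *)

theory Defs
  imports
    "HOL-Probability.Probability_Mass_Function"
    "HOL-Library.Multiset"
    "HOL-Library.Poly_Mapping"
    "HOL-Combinatorics.Permutations"
    "HOL-Combinatorics.Cycles"
    "HOL-Combinatorics.Orbits"
begin

section \<open>Formal power series in countably many variables\<close>

text \<open>
  Symmetric functions are power series in infinitely many variables. A monomial is its
  finitely supported exponent function; the variables are indexed by all naturals, 0 included.
\<close>

typedef 'a mvps = "UNIV :: ((nat \<Rightarrow>\<^sub>0 nat) \<Rightarrow> 'a) set"
  morphisms mvps_coeff Abs_mvps ..

setup_lifting type_definition_mvps

lemma mvps_eqI: "(\<And>\<mu>. mvps_coeff f \<mu> = mvps_coeff g \<mu>) \<Longrightarrow> f = g"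
  by transfer auto

definition splits :: "(nat \<Rightarrow>\<^sub>0 nat) \<Rightarrow> ((nat \<Rightarrow>\<^sub>0 nat) \<times> (nat \<Rightarrow>\<^sub>0 nat)) set" where
  "splits \<mu> = {(a, b). a + b = \<mu>}"

lemma finite_splits [simp]: "finite (splits \<mu>)"
proof -
  let ?B = "{..Max (insert 0 (Poly_Mapping.lookup \<mu> ` Poly_Mapping.keys \<mu>))}"
  let ?F = "{f. \<forall>x. (x \<in> Poly_Mapping.keys \<mu> \<longrightarrow> f x \<in> ?B) \<and> (x \<notin> Poly_Mapping.keys \<mu> \<longrightarrow> f x = (0::nat))}"
  let ?S = "{a. Poly_Mapping.lookup a \<in> ?F}"
  have "finite ?F"
    by (rule finite_set_of_finite_funs) auto
  moreover have "inj_on Poly_Mapping.lookup ?S"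
    by (auto intro: inj_onI)
  moreover have "Poly_Mapping.lookup ` ?S \<subseteq> ?F"
    by auto
  ultimately have fin: "finite ?S"
    by (meson finite_imageD finite_subset)
  have sub: "a \<in> ?S" if "a + b = \<mu>" for a b
  proof -
    have eq: "Poly_Mapping.lookup a x + Poly_Mapping.lookup b x = Poly_Mapping.lookup \<mu> x" for x
      unfolding that[symmetric] by (simp add: lookup_add)
    have "Poly_Mapping.lookup a x \<in> ?B" if "x \<in> Poly_Mapping.keys \<mu>" for x
    proof -
      have "Poly_Mapping.lookup a x \<le> Poly_Mapping.lookup \<mu> x"
        using eq[of x] by simp
      also have "\<dots> \<le> Max (insert 0 (Poly_Mapping.lookup \<mu> ` Poly_Mapping.keys \<mu>))"
        using that by (intro Max_ge) auto
      finally show ?thesis by simp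
    qed
    moreover have "Poly_Mapping.lookup a x = 0" if "x \<notin> Poly_Mapping.keys \<mu>" for x
      using eq[of x] that by (simp add: in_keys_iff)
    ultimately show ?thesis by auto
  qed
  have "splits \<mu> \<subseteq> ?S \<times> ?S"
  proof
    fix p assume "p \<in> splits \<mu>"
    then obtain a b where p: "p = (a, b)" and ab: "a + b = \<mu>"
      by (auto simp: splits_def)
    have "b + a = \<mu>" using ab by (simp add: add.commute)
    from sub[OF ab] sub[OF this] show "p \<in> ?S \<times> ?S"
      unfolding p by (rule SigmaI)
  qed
  thus ?thesis
    by (rule finite_subset) (intro finite_cartesian_product fin)
qed

instantiation mvps :: (comm_ring_1) comm_ring_1
begin

lift_definition zero_mvps :: "'a mvps" is "\<lambda>_. 0" .
lift_definition one_mvps :: "'a mvps" is "\<lambda>\<mu>. if \<mu> = 0 then 1 else 0" .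
lift_definition plus_mvps :: "'a mvps \<Rightarrow> 'a mvps \<Rightarrow> 'a mvps" is "\<lambda>f g \<mu>. f \<mu> + g \<mu>" .
lift_definition minus_mvps :: "'a mvps \<Rightarrow> 'a mvps \<Rightarrow> 'a mvps" is "\<lambda>f g \<mu>. f \<mu> - g \<mu>" .
lift_definition uminus_mvps :: "'a mvps \<Rightarrow> 'a mvps" is "\<lambda>f \<mu>. - f \<mu>" .
lift_definition times_mvps :: "'a mvps \<Rightarrow> 'a mvps \<Rightarrow> 'a mvps"
  is "\<lambda>f g \<mu>. \<Sum>(a, b)\<in>splits \<mu>. f a * g b" .

instance
proof
  fix f g h :: "'a mvps"
  show "f + g + h = f + (g + h)" by transfer (simp add: add.assoc)
  show "f + g = g + f" by transfer (simp add: add.commute)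
  show "0 + f = f" by transfer simp
  show "- f + f = 0" by transfer simp
  show "f - g = f + - g" by transfer simp
  show "(0 :: 'a mvps) \<noteq> 1" by transfer (metis zero_neq_one)
  show "(f + g) * h = f * h + g * h"
    by transfer (simp add: distrib_right sum.distrib case_prod_unfold)
  show "f * g = g * f"
  proof (transfer, rule ext)
    fix f g :: "(nat \<Rightarrow>\<^sub>0 nat) \<Rightarrow> 'a" and \<mu>
    show "(\<Sum>(a, b)\<in>splits \<mu>. f a * g b) = (\<Sum>(a, b)\<in>splits \<mu>. g a * f b)"
      by (rule sum.reindex_bij_witness[of _ prod.swap prod.swap])
        (auto simp: splits_def add.commute mult.commute)
  qed
  show "1 * f = f"
  proof (transfer, rule ext)
    fix f :: "(nat \<Rightarrow>\<^sub>0 nat) \<Rightarrow> 'a" and \<mu>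
    have "(\<Sum>(a, b)\<in>splits \<mu>. (if a = 0 then 1 else 0) * f b)
        = (\<Sum>(a, b)\<in>{(0 :: nat \<Rightarrow>\<^sub>0 nat, \<mu>)}. (if a = 0 then 1 else 0) * f b)"
      by (rule sum.mono_neutral_right[OF finite_splits]) (auto simp: splits_def split: if_splits)
    thus "(\<Sum>(a, b)\<in>splits \<mu>. (if a = 0 then 1 else 0) * f b) = f \<mu>" by simp
  qed
  show "f * g * h = f * (g * h)"
  proof (transfer, rule ext)
    fix f g h :: "(nat \<Rightarrow>\<^sub>0 nat) \<Rightarrow> 'a" and \<mu>
    have "(\<Sum>(x, c)\<in>splits \<mu>. (\<Sum>(a, b)\<in>splits x. f a * g b) * h c)
        = (\<Sum>p\<in>splits \<mu>. \<Sum>q\<in>splits (fst p). f (fst q) * g (snd q) * h (snd p))"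
      by (simp add: case_prod_unfold sum_distrib_right)
    also have "\<dots> = (\<Sum>(p, q)\<in>Sigma (splits \<mu>) (\<lambda>p. splits (fst p)).
                       f (fst q) * g (snd q) * h (snd p))"
      by (subst sum.Sigma) auto
    also have "\<dots> = (\<Sum>(p, q)\<in>Sigma (splits \<mu>) (\<lambda>p. splits (snd p)).
                       f (fst p) * (g (fst q) * h (snd q)))"
      by (rule sum.reindex_bij_witness[of _
            "\<lambda>((a, y), (b, c)). ((a + b, c), (a, b))" "\<lambda>((x, c), (a, b)). ((a, b + c), (b, c))"])
        (auto simp: splits_def add.assoc mult.assoc)
    also have "\<dots> = (\<Sum>p\<in>splits \<mu>. \<Sum>q\<in>splits (snd p). f (fst p) * (g (fst q) * h (snd q)))"
      by (subst sum.Sigma) auto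
    also have "\<dots> = (\<Sum>(a, y)\<in>splits \<mu>. f a * (\<Sum>(b, c)\<in>splits y. g b * h c))"
      by (simp add: case_prod_unfold sum_distrib_left)
    finally show "(\<Sum>(x, c)\<in>splits \<mu>. (\<Sum>(a, b)\<in>splits x. f a * g b) * h c)
        = (\<Sum>(a, y)\<in>splits \<mu>. f a * (\<Sum>(b, c)\<in>splits y. g b * h c))" .
  qed
qed

end

lift_definition mvps_scale :: "'a::comm_ring_1 \<Rightarrow> 'a mvps \<Rightarrow> 'a mvps"
  is "\<lambda>c f \<mu>. c * f \<mu>" .

global_interpretation mvps: vector_space "mvps_scale :: 'a::field \<Rightarrow> 'a mvps \<Rightarrow> 'a mvps"
  by unfold_locales (transfer; simp add: algebra_simps)+


section \<open>Partitions and symmetric functions\<close>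

text \<open>Integer partitions are multisets of positive parts, so \<open>\<ell>(\<lambda>)\<close> is \<open>size \<lambda>\<close>.\<close>

definition partitions_of :: "nat \<Rightarrow> nat multiset set" where
  "partitions_of n = {lam. 0 \<notin># lam \<and> \<Sum>\<^sub># lam = n}"

lift_definition power_sum_var :: "nat \<Rightarrow> 'a::comm_ring_1 mvps"
  is "\<lambda>d \<mu>. if \<exists>i. \<mu> = Poly_Mapping.single i d then 1 else 0" .

definition power_sum :: "nat multiset \<Rightarrow> 'a::comm_ring_1 mvps" where
  "power_sum lam = (\<Prod>d\<in>#lam. power_sum_var d)"

definition monomial_sym :: "nat multiset \<Rightarrow> 'a::comm_ring_1 mvps" where
  "monomial_sym lam =
     Abs_mvps (\<lambda>\<mu>. if image_mset (Poly_Mapping.lookup \<mu>) (mset_set (Poly_Mapping.keys \<mu>)) = lam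
                    then 1 else 0)"

text \<open>
  The coefficient of \<open>p\<^sub>\<lambda>\<close> in the power-sum expansion of \<open>f\<close>.
  The library's \<open>representation\<close> is 0 by convention when the given family is not independent
  or \<open>f\<close> is not in its span; over a field of characteristic 0 the power sums indexed by
  all partitions are a basis of the symmetric functions.
\<close>

definition power_sum_coeff :: "nat multiset \<Rightarrow> 'a::field_char_0 mvps \<Rightarrow> 'a" where
  "power_sum_coeff lam f =
     mvps.representation (power_sum ` {mu. 0 \<notin># mu}) f (power_sum lam)"


section \<open>Permutations and separation\<close>

text \<open>A composition is a list of positive integers; the empty list is the composition of 0.\<close>

definition is_composition :: "nat list \<Rightarrow> nat \<Rightarrow> bool" where
  "is_composition \<alpha> m \<longleftrightarrow> (\<forall>a\<in>set \<alpha>. 0 < a) \<and> sum_list \<alpha> = m"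

definition cycles_on :: "nat \<Rightarrow> (nat \<Rightarrow> nat) \<Rightarrow> nat set set" where
  "cycles_on n \<pi> = orbit \<pi> ` {1..n}"

definition cycle_type :: "nat \<Rightarrow> (nat \<Rightarrow> nat) \<Rightarrow> nat multiset" where
  "cycle_type n \<pi> = image_mset card (mset_set (cycles_on n \<pi>))"

definition perms_of_type :: "nat \<Rightarrow> nat multiset \<Rightarrow> (nat \<Rightarrow> nat) set" where
  "perms_of_type n lam = {\<pi>. \<pi> permutes {1..n} \<and> cycle_type n \<pi> = lam}"

definition long_cycle :: "nat \<Rightarrow> nat \<Rightarrow> nat" where
  "long_cycle n = cycle_of_list [1..<Suc n]"

definition disjoint_tuples :: "nat \<Rightarrow> nat list \<Rightarrow> nat set list set" where
  "disjoint_tuples n \<alpha> = {A. length A = length \<alpha> \<and>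
     (\<forall>i<length \<alpha>. A ! i \<subseteq> {1..n} \<and> card (A ! i) = \<alpha> ! i) \<and>
     (\<forall>i<length \<alpha>. \<forall>j<length \<alpha>. i \<noteq> j \<longrightarrow> A ! i \<inter> A ! j = {})}"

definition separated :: "nat \<Rightarrow> nat set list \<Rightarrow> (nat \<Rightarrow> nat) \<Rightarrow> bool" where
  "separated n A \<pi> \<longleftrightarrow> (\<forall>C\<in>cycles_on n \<pi>. \<forall>i<length A. \<forall>j<length A.
     C \<inter> A ! i \<noteq> {} \<and> C \<inter> A ! j \<noteq> {} \<longrightarrow> i = j)"

definition separated_pairs ::
    "nat \<Rightarrow> nat multiset \<Rightarrow> nat list \<Rightarrow> ((nat \<Rightarrow> nat) \<times> nat set list) set" where
  "separated_pairs n lam \<alpha> = {(\<pi>, A). \<pi> \<in> perms_of_type n lam \<and> A \<in> disjoint_tuples n \<alpha> \<and>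
     separated n A (\<pi> \<circ> long_cycle n)}"

definition uc :: "nat \<Rightarrow> (nat \<Rightarrow> nat) \<Rightarrow> nat set list \<Rightarrow> nat" where
  "uc n \<pi> A = card {C \<in> cycles_on n (\<pi> \<circ> long_cycle n). C \<inter> \<Union>(set A) = {}}"

text \<open>
  The variable \<open>t\<close> ranges over all elements of an arbitrary field of characteristic 0;
  an indeterminate is the special case of a field of rational functions.
\<close>

definition sep_gf :: "nat \<Rightarrow> nat list \<Rightarrow> 'a::field_char_0 \<Rightarrow> 'a mvps" where
  "sep_gf n \<alpha> t = (\<Sum>lam\<in>partitions_of n.
     mvps_scale (\<Sum>(\<pi>, A)\<in>separated_pairs n lam \<alpha>. t ^ uc n \<pi> A) (power_sum lam))"

text \<open>
  The separation probability for a given tuple of sets \<open>A\<close>; that it depends only on the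
  cardinalities \<open>\<alpha>\<close> is not built in. The \<open>n\<close>-cycles are the permutations
  of cycle type \<open>{#n#}\<close>.
\<close>

definition sep_prob :: "nat \<Rightarrow> nat multiset \<Rightarrow> nat set list \<Rightarrow> real" where
  "sep_prob n lam A =
     measure_pmf.prob
       (pair_pmf (pmf_of_set (perms_of_type n lam)) (pmf_of_set (perms_of_type n {#n#})))
       {(\<pi>, \<zeta>). separated n A (\<pi> \<circ> \<zeta>)}"

definition multinomial_coeff :: "nat list \<Rightarrow> real" where
  "multinomial_coeff as = fact (sum_list as) / prod_list (map fact as)"

end

theory Submission
  imports Defs "HOL-Computational_Algebra.Formal_Power_Series"
begin

text \<open>
  For \<open>t = q\<close> a natural number, expand \<open>p\<^sub>\<lambda>\<close> as a sum over colourings \<open>f\<close> of the cycles of \<open>\<pi>\<close>, and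
  \<open>(q + k) ^ uc\<close> as a sum over colourings \<open>g\<close> of the cycles of \<open>\<pi> \<circ> (1, \<dots>, n)\<close> by \<open>q + k\<close> colours such
  that the elements of \<open>A\<^sub>i\<close> have colour \<open>i\<close>. Summing over \<open>A\<close> leaves binomial coefficients in the class
  sizes of \<open>g\<close>, and the formula follows from the theorem of Morales and Vassilieva: for class sizes
  \<open>\<gamma>\<close> of \<open>f\<close> and \<open>\<delta>\<close> of \<open>g\<close>, with \<open>a\<close> and \<open>b\<close> nonempty classes, the number of triples \<open>(\<pi>, f, g)\<close> is
  \<open>n (n - a)! (n - b)! / (n + 1 - a - b)!\<close>, and \<open>0\<close> if \<open>a + b > n + 1\<close>.
  Both sides being polynomials in \<open>t\<close>, they then agree for all \<open>t\<close>.

  The colours seen in the order \<open>g 0, f 1, g 1, f 2, \<dots>\<close> form a closed walk on the colours of \<open>f\<close> and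
  \<open>g\<close>, and \<open>\<pi>\<close> pairs each of its steps with a reverse step. With labelled steps this is a closed
  Eulerian trail in a digraph given by a permutation \<open>\<phi>\<close> (the pairing of the labels), so by the BEST
  theorem it is enough to count the \<open>\<phi>\<close> for which prescribed last exits form a tree. That number
  factorises by an elementary count of rooted injections.

  The power sums are independent by triangularity with respect to the monomials. The separation
  probability is obtained by averaging, since conjugation is transitive both on the tuples \<open>A\<close> and
  on the \<open>n\<close>-cycles.
\<close>

section \<open>Functional graphs leading to a root\<close>

text \<open>For a single \<open>\<phi>\<close> the number of exit trees depends on the digraph, and
  for fixed \<open>f\<close> and \<open>g\<close> the number of \<open>\<pi>\<close> depends on how
  the classes meet. Both difficulties vanish after summation: all triples have the same number of
  labellings, and for fixed last exits the number of \<open>\<phi>\<close> depends only on n, a, b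
  and the size of the starting class. The formula reflects this. A tree on a + b colours has a + b -
  1 last exits, no two reverse to each other; prescribing their reverse steps fixes
  \<open>\<phi>\<close> at a + b - 1 places and leaves (n + 1 - a - b)! completions, and it is
  impossible for a + b > n + 1. The factor n is the sum of the class sizes of the possible starting
  colours. The shift from t to t + k reserves a colour for each A_i. The parts of \<alpha> being
  positive, these k colours are always used, and r counts the used ones among the q others, whence
  the binomial of t over r. The other binomial is the coefficient of X^n in X^(m+r) / (1-X)^(m+k+r),
  so \<alpha> enters only through m and k.\<close>

inductive reaches :: "'v set \<Rightarrow> ('v \<Rightarrow> 'v) \<Rightarrow> 'v \<Rightarrow> 'v \<Rightarrow> bool" for U h r where
  base: "reaches U h r r"
| step: "u \<in> U \<Longrightarrow> reaches U h r (h u) \<Longrightarrow> reaches U h r u"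

text \<open>For \<open>r\<close> outside \<open>U\<close> this says that \<open>h\<close> is the
  parent function of a tree on \<open>insert r U\<close> with root \<open>r\<close>: being
  inductive, \<open>reaches\<close> admits only finite paths, so it excludes cycles as well as exits
  to other vertices.\<close>

definition rooted :: "'v set \<Rightarrow> ('v \<Rightarrow> 'v) \<Rightarrow> 'v \<Rightarrow> bool" where
  "rooted U h r \<longleftrightarrow> (\<forall>u\<in>U. reaches U h r u)"

lemma reaches_mono_cong:
  assumes "reaches U h r u" "\<And>u. u \<in> U \<Longrightarrow> h u = h' u"
  shows "reaches U h' r u"
  using assms(1) by induction (auto intro: reaches.intros simp: assms(2))

lemma rooted_cong:
  assumes "\<And>u. u \<in> U \<Longrightarrow> h u = h' u"
  shows "rooted U h r \<longleftrightarrow> rooted U h' r"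
  unfolding rooted_def using reaches_mono_cong[of U h r _ h'] reaches_mono_cong[of U h' r _ h] assms
  by metis

text \<open>A path that enters \<open>a\<close> must continue to \<open>h a\<close>, so
  \<open>a\<close> can be cut out by redirecting its predecessors to \<open>h a\<close>; it remains
  to exclude that \<open>a\<close> is a fixed point or leaves the vertex set. The count of rooted
  injections and the leaf case of the BEST theorem both rest on this contraction.\<close>

lemma rooted_insert_contract:
  assumes "r \<notin> A" "a \<notin> A" "a \<noteq> r"
  shows "rooted (insert a A) h r \<longleftrightarrow>
    h a \<noteq> a \<and> h a \<in> insert r A \<and> rooted A (\<lambda>u. if h u = a then h a else h u) r"
proof
  let ?h' = "\<lambda>u. if h u = a then h a else h u"
  assume R: "rooted (insert a A) h r"
  have nofix: "h a \<noteq> a"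
  proof
    assume fx: "h a = a"
    have "u \<noteq> a" if "reaches (insert a A) h r u" for u
      using that by induction (use assms fx in auto)
    thus False using R by (auto simp: rooted_def)
  qed
  have "reaches (insert a A) h r a" using R by (auto simp: rooted_def)
  hence "reaches (insert a A) h r (h a)"
    by (cases rule: reaches.cases) (use assms in auto)
  hence ha: "h a \<in> insert r A"
    by (cases rule: reaches.cases) (use nofix in auto)
  have cut: "reaches A ?h' r (if u = a then h a else u)" if "reaches (insert a A) h r u" for u
    using that
  proof induction
    case base
    show ?case using assms by (auto intro: reaches.base)
  next
    case (step u)
    show ?case
    proof (cases "u = a")
      case True
      thus ?thesis using step nofix by auto
    next
      case False
      hence "u \<in> A" using step by auto
      thus ?thesis using False step.IH by (auto intro: reaches.step)
    qed
  qed
  have "rooted A ?h' r"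
    unfolding rooted_def
  proof
    fix u assume u: "u \<in> A"
    hence "u \<noteq> a" using assms by auto
    moreover have "reaches (insert a A) h r u" using R u by (simp add: rooted_def)
    ultimately show "reaches A ?h' r u" using cut[of u] by simp
  qed
  thus "h a \<noteq> a \<and> h a \<in> insert r A \<and> rooted A ?h' r" using nofix ha by blast
next
  let ?h' = "\<lambda>u. if h u = a then h a else h u"
  assume *: "h a \<noteq> a \<and> h a \<in> insert r A \<and> rooted A ?h' r"
  have R: "reaches (insert a A) h r u" if "reaches A ?h' r u" for u
    using that
  proof induction
    case base
    show ?case by (rule reaches.base)
  next
    case (step u)
    show ?case
    proof (cases "h u = a")
      case True
      have "reaches (insert a A) h r a"
        using step True by (intro reaches.step[of a]) auto
      thus ?thesis using step True by (intro reaches.step[of u]) auto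
    next
      case False
      thus ?thesis using step by (intro reaches.step[of u]) auto
    qed
  qed
  have "reaches (insert a A) h r (h a)"
    using * R by (auto simp: rooted_def intro: reaches.base)
  hence "reaches (insert a A) h r a" by (auto intro: reaches.step)
  thus "rooted (insert a A) h r" using * R by (auto simp: rooted_def)
qed

text \<open>The value at the new point is chosen first, and the condition on the remaining values
  may depend on it. All inductions over finite domains below have this form.\<close>

lemma card_PiE_insert_split:
  assumes "x \<notin> A" "finite A" "finite (B x)" "\<And>i. i \<in> A \<Longrightarrow> finite (B i)"
  shows "card {f \<in> PiE (insert x A) B. P f} = (\<Sum>y\<in>B x. card {g \<in> PiE A B. P (g(x := y))})"
proof -
  have "bij_betw (\<lambda>(y, g). g(x := y)) (SIGMA y:B x. {g \<in> PiE A B. P (g(x := y))})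
     {f \<in> PiE (insert x A) B. P f}"
  proof (rule bij_betwI')
    fix p q assume pq: "p \<in> (SIGMA y:B x. {g \<in> PiE A B. P (g(x := y))})"
      "q \<in> (SIGMA y:B x. {g \<in> PiE A B. P (g(x := y))})"
    have "inj_on (\<lambda>(y, g). g(x := y)) (B x \<times> PiE A B)"
      using inj_combinator[OF assms(1)] .
    thus "((case p of (y, g) \<Rightarrow> g(x := y)) = (case q of (y, g) \<Rightarrow> g(x := y))) = (p = q)"
      using pq by (auto simp: inj_on_def)
  next
    fix p assume "p \<in> (SIGMA y:B x. {g \<in> PiE A B. P (g(x := y))})"
    thus "(case p of (y, g) \<Rightarrow> g(x := y)) \<in> {f \<in> PiE (insert x A) B. P f}"
      by (auto simp: PiE_insert_eq)
  next
    fix f assume "f \<in> {f \<in> PiE (insert x A) B. P f}"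
    thus "\<exists>p\<in>(SIGMA y:B x. {g \<in> PiE A B. P (g(x := y))}). f = (case p of (y, g) \<Rightarrow> g(x := y))"
      by (force simp: PiE_insert_eq)
  qed
  hence "card {f \<in> PiE (insert x A) B. P f} = card (SIGMA y:B x. {g \<in> PiE A B. P (g(x := y))})"
    by (simp add: bij_betw_same_card)
  also have "\<dots> = (\<Sum>y\<in>B x. card {g \<in> PiE A B. P (g(x := y))})"
    using assms by (subst card_SigmaI) (auto intro!: finite_subset[OF _ finite_PiE[of A B]])
  finally show ?thesis .
qed

text \<open>
  Induction by contraction: once one vertex \<open>a\<close> is sent to \<open>s\<close>, the slots leading to \<open>a\<close> lead to \<open>h s\<close>.
\<close>

lemma card_rooted_injections:
  assumes "finite A" "A \<noteq> {}" "finite S" "h ` S \<subseteq> insert r A" "r \<notin> A" "card A \<le> card S"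
  shows "card {\<psi> \<in> A \<rightarrow>\<^sub>E S. inj_on \<psi> A \<and> rooted A (h \<circ> \<psi>) r} * fact (card S - card A) =
    card {s \<in> S. h s = r} * fact (card S - 1)"
  using assms
proof (induction A arbitrary: S h rule: finite_ne_induct)
  case (singleton a)
  have r: "rooted {a} k r \<longleftrightarrow> k a = r" for k
    using rooted_insert_contract[of r "{}" a k] singleton by (auto simp: rooted_def)
  have "card {\<psi> \<in> {a} \<rightarrow>\<^sub>E S. h (\<psi> a) = r} = (\<Sum>y\<in>S. card {g \<in> {} \<rightarrow>\<^sub>E S. h ((g(a := y)) a) = r})"
    by (rule card_PiE_insert_split[where B = "\<lambda>_. S" and P = "\<lambda>\<psi>. h (\<psi> a) = r"])
      (use singleton in auto)
  also have "\<dots> = (\<Sum>y\<in>S. if h y = r then 1 else 0)"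
    by (rule sum.cong) auto
  also have "\<dots> = card {s \<in> S. h s = r}"
    using singleton by (simp add: sum.If_cases Int_def)
  finally show ?case by (simp add: r)
next
  case (insert a A)
  define h' where "h' = (\<lambda>s u. if h u = a then h s else h u)"
  define F where "F s = {\<psi> \<in> A \<rightarrow>\<^sub>E S - {s}. inj_on \<psi> A \<and> rooted A (h' s \<circ> \<psi>) r}" for s
  have "card A > 0" using insert.hyps insert.prems by (simp add: card_gt_0_iff)
  moreover have "card (insert a A) = Suc (card A)" using insert.hyps insert.prems by simp
  ultimately have cS: "card S > 1" using insert.prems by linarith
  have ra: "a \<noteq> r" "r \<notin> A" using insert.hyps insert.prems by auto
  have split: "card {\<psi> \<in> insert a A \<rightarrow>\<^sub>E S. inj_on \<psi> (insert a A) \<and> rooted (insert a A) (h \<circ> \<psi>) r}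
     = (\<Sum>s\<in>S. if h s = a then 0 else card (F s))"
  proof (rule trans[OF card_PiE_insert_split[where x = a and A = A and B = "\<lambda>_. S" and
        P = "\<lambda>\<psi>. inj_on \<psi> (insert a A) \<and> rooted (insert a A) (h \<circ> \<psi>) r"]])
    show "(\<Sum>y\<in>S. card {g \<in> A \<rightarrow>\<^sub>E S. inj_on (g(a := y)) (insert a A) \<and> rooted (insert a A) (h \<circ> g(a := y)) r})
      = (\<Sum>s\<in>S. if h s = a then 0 else card (F s))"
    proof (rule sum.cong[OF refl])
      fix s assume s: "s \<in> S"
      have inj: "inj_on (g(a := s)) (insert a A) \<longleftrightarrow> inj_on g A \<and> s \<notin> g ` A" for g
      proof -
        have "inj_on (g(a := s)) A \<longleftrightarrow> inj_on g A"
          by (rule inj_on_cong) (use \<open>a \<notin> A\<close> in auto)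
        moreover have "(g(a := s)) ` (A - {a}) = g ` A"
          using \<open>a \<notin> A\<close> by auto
        ultimately show ?thesis unfolding inj_on_insert by simp
      qed
      have eq: "rooted A (\<lambda>u. if (h \<circ> g(a := s)) u = a then (h \<circ> g(a := s)) a else (h \<circ> g(a := s)) u) r
         = rooted A (h' s \<circ> g) r" for g
        by (rule rooted_cong) (use insert.hyps in \<open>auto simp: h'_def\<close>)
      have hs: "h s \<in> insert r A" if "h s \<noteq> a" using insert.prems s that by blast
      have roo: "rooted (insert a A) (h \<circ> g(a := s)) r \<longleftrightarrow> h s \<noteq> a \<and> rooted A (h' s \<circ> g) r" for g
        using rooted_insert_contract[OF ra(2) \<open>a \<notin> A\<close> ra(1), of "h \<circ> g(a := s)", unfolded eq] hs
        by (simp del: insert_iff) blast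
      have "{g \<in> A \<rightarrow>\<^sub>E S. inj_on (g(a := s)) (insert a A) \<and> rooted (insert a A) (h \<circ> g(a := s)) r}
        = (if h s = a then {} else F s)"
        unfolding inj roo F_def by (auto simp: PiE_iff)
      thus "card {g \<in> A \<rightarrow>\<^sub>E S. inj_on (g(a := s)) (insert a A) \<and> rooted (insert a A) (h \<circ> g(a := s)) r}
        = (if h s = a then 0 else card (F s))" by simp
    qed
  qed (use insert.hyps insert.prems in auto)
  define w where "w = card {s \<in> S. h s = r}"
  define wa where "wa = card {s \<in> S. h s = a}"
  \<comment> \<open>A slot over the root turns the slots over \<open>a\<close> into slots over the
    root and is itself used up, which leaves \<open>w + wa - 1\<close> of them. Any other slot
    leaves their number \<open>w\<close> unchanged.\<close>
  have F: "card (F s) * fact (card S - card (insert a A)) =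
      (if h s = r then w + wa - 1 else w) * fact (card S - 2)" if s: "s \<in> S" "h s \<noteq> a" for s
  proof -
    have "card (F s) * fact (card (S - {s}) - card A) =
      card {u \<in> S - {s}. h' s u = r} * fact (card (S - {s}) - 1)"
      unfolding F_def
      by (rule insert.IH) (use insert.hyps insert.prems s in \<open>auto simp: h'_def\<close>)
    moreover have "card {u \<in> S - {s}. h' s u = r} = (if h s = r then w + wa - 1 else w)"
    proof (cases "h s = r")
      case True
      have "{u \<in> S - {s}. h' s u = r} = ({s \<in> S. h s = r} \<union> {s \<in> S. h s = a}) - {s}"
        using True s by (auto simp: h'_def)
      moreover have "card (({s \<in> S. h s = r} \<union> {s \<in> S. h s = a}) - {s}) = w + wa - 1"
        unfolding w_def wa_def
        by (subst card_Diff_singleton) (use True s ra insert.prems in \<open>auto simp: card_Un_disjoint disjoint_iff\<close>)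
      ultimately show ?thesis using True by simp
    next
      case False
      have "{u \<in> S - {s}. h' s u = r} = {s \<in> S. h s = r}"
        using False s ra by (auto simp: h'_def)
      thus ?thesis using False by (simp add: w_def)
    qed
    moreover have "card (S - {s}) - card A = card S - card (insert a A)"
      "card (S - {s}) - 1 = card S - 2" using insert.hyps insert.prems s by auto
    ultimately show ?thesis by simp
  qed
  have "(\<Sum>s\<in>S. if h s = a then 0 else card (F s)) * fact (card S - card (insert a A)) =
    (\<Sum>s\<in>S. (if h s = a then 0 else if h s = r then w + wa - 1 else w) * fact (card S - 2))"
    unfolding sum_distrib_right by (rule sum.cong) (use F in auto)
  also have "\<dots> = (\<Sum>s\<in>S. if h s = a then 0 else if h s = r then w + wa - 1 else w) * fact (card S - 2)"
    by (simp add: sum_distrib_right)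
  also have "(\<Sum>s\<in>S. if h s = a then 0 else if h s = r then w + wa - 1 else w) =
     w * (w + wa - 1) + (card S - w - wa) * w"
  proof -
    have "(\<Sum>s\<in>S. if h s = a then 0 else if h s = r then w + wa - 1 else w) =
      (\<Sum>s\<in>{s \<in> S. h s = r} \<union> (S - {s \<in> S. h s = r} - {s \<in> S. h s = a}).
          if h s = a then 0 else if h s = r then w + wa - 1 else w)"
      by (rule sum.mono_neutral_right) (use insert.prems in auto)
    also have "\<dots> = (\<Sum>s\<in>{s \<in> S. h s = r}. w + wa - 1) +
       (\<Sum>s\<in>S - {s \<in> S. h s = r} - {s \<in> S. h s = a}. w)"
      by (subst sum.union_disjoint) (use insert.prems ra in \<open>auto intro!: sum.cong arg_cong2[of _ _ _ _ "(+)"]\<close>)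
    also have "\<dots> = w * (w + wa - 1) + (card S - w - wa) * w"
    proof -
      have "card (S - {s \<in> S. h s = r} - {s \<in> S. h s = a}) = card (S - {s \<in> S. h s = r}) - wa"
        unfolding wa_def by (rule card_Diff_subset) (use insert.prems ra in auto)
      moreover have "card (S - {s \<in> S. h s = r}) = card S - w"
        unfolding w_def by (rule card_Diff_subset) (use insert.prems ra in auto)
      ultimately show ?thesis by (simp add: w_def[symmetric])
    qed
    finally show ?thesis .
  qed
  \<comment> \<open>The number \<open>wa\<close> cancels, which lets the induction close: the rooted
    injections make up the fraction w / card S of all injections. The subtractions are truncated,
    hence the bound \<open>w + wa \<le> card S\<close>.\<close>
  also have "w * (w + wa - 1) + (card S - w - wa) * w = w * (card S - 1)"
  proof (cases "w = 0")
    case False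
    have "card ({s \<in> S. h s = r} \<union> {s \<in> S. h s = a}) \<le> card S"
      by (rule card_mono) (use insert.prems in auto)
    moreover have "card ({s \<in> S. h s = r} \<union> {s \<in> S. h s = a}) = w + wa"
      unfolding w_def wa_def by (rule card_Un_disjoint) (use insert.prems ra in auto)
    ultimately have le: "w + wa \<le> card S" by simp
    then obtain z where z: "card S = w + wa + z" using le_Suc_ex by blast
    obtain w' where w': "w = Suc w'" using False not0_implies_Suc by blast
    show ?thesis by (simp add: z w' algebra_simps)
  qed simp
  also have "w * (card S - 1) * fact (card S - 2) = w * fact (card S - 1)"
    using cS fact_reduce[of "card S - 1", where ?'a=nat] by (simp add: mult.assoc numeral_2_eq_2)
  finally show ?case unfolding split w_def by simp
qed

section \<open>Eulerian trails and last-exit trees\<close>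

fun walk :: "('e \<Rightarrow> 'v) \<Rightarrow> ('e \<Rightarrow> 'v) \<Rightarrow> 'v \<Rightarrow> 'e list \<Rightarrow> 'v \<Rightarrow> bool" where
  "walk src tgt v [] r \<longleftrightarrow> v = r"
| "walk src tgt v (e # xs) r \<longleftrightarrow> src e = v \<and> walk src tgt (tgt e) xs r"

definition trails :: "('e \<Rightarrow> 'v) \<Rightarrow> ('e \<Rightarrow> 'v) \<Rightarrow> 'v \<Rightarrow> 'v \<Rightarrow> 'e set \<Rightarrow> 'e list set" where
  "trails src tgt r v E = {xs. distinct xs \<and> set xs = E \<and> walk src tgt v xs r}"

text \<open>The same function serves for out-degrees (\<open>s\<close> the source map), for
  in-degrees (\<open>s\<close> the target map) and, later, for the class sizes of a colouring
  \<open>s\<close>.\<close>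

definition deg :: "('e \<Rightarrow> 'v) \<Rightarrow> 'e set \<Rightarrow> 'v \<Rightarrow> nat" where
  "deg s E u = card {e \<in> E. s e = u}"

text \<open>\<open>L u\<close> stands for the edge by which a trail leaves the vertex \<open>u\<close> for the last time.\<close>

definition exit_trees :: "('e \<Rightarrow> 'v) \<Rightarrow> ('e \<Rightarrow> 'v) \<Rightarrow> 'v \<Rightarrow> 'e set \<Rightarrow> ('v \<Rightarrow> 'e) set" where
  "exit_trees src tgt r E =
     {L \<in> (\<Pi>\<^sub>E u\<in>src ` E - {r}. {e \<in> E. src e = u}). rooted (src ` E - {r}) (tgt \<circ> L) r}"

lemma finite_trails [simp]: "finite E \<Longrightarrow> finite (trails src tgt r v E)"
  by (rule finite_subset[OF _ finite_lists_length_eq[of E "card E"]])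
    (auto simp: trails_def distinct_card)

lemma finite_exit_trees [simp]: "finite E \<Longrightarrow> finite (exit_trees src tgt r E)"
  unfolding exit_trees_def
  by (rule finite_subset[OF _ finite_PiE[of "src ` E - {r}" "\<lambda>u. {e \<in> E. src e = u}"]]) auto

lemma deg_remove:
  assumes "finite E" "e \<in> E"
  shows "deg s E u = deg s (E - {e}) u + of_bool (u = s e)"
proof (cases "u = s e")
  case True
  have "{e' \<in> E. s e' = u} = insert e {e' \<in> E - {e}. s e' = u}" using True assms by auto
  thus ?thesis using True assms by (simp add: deg_def)
next
  case False
  hence "{e' \<in> E. s e' = u} = {e' \<in> E - {e}. s e' = u}" by auto
  thus ?thesis using False by (simp add: deg_def)
qed

lemma deg_pos_iff: "finite E \<Longrightarrow> deg s E u > 0 \<longleftrightarrow> u \<in> s ` E"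
  by (auto simp: deg_def card_gt_0_iff)

lemma card_trails_step:
  assumes "finite E" "E \<noteq> {}"
  shows "card (trails src tgt r v E) =
    (\<Sum>e | e \<in> E \<and> src e = v. card (trails src tgt r (tgt e) (E - {e})))"
proof -
  have eq: "trails src tgt r v E =
      (\<Union>e\<in>{e \<in> E. src e = v}. (#) e ` trails src tgt r (tgt e) (E - {e}))" (is "_ = ?R")
  proof
    show "trails src tgt r v E \<subseteq> ?R"
    proof
      fix xs assume xs: "xs \<in> trails src tgt r v E"
      then obtain e ys where "xs = e # ys" using assms by (cases xs) (auto simp: trails_def)
      thus "xs \<in> ?R" using xs by (auto simp: trails_def)
    qed
    show "?R \<subseteq> trails src tgt r v E"
    proof
      fix xs assume "xs \<in> ?R"
      then obtain e ys where e: "e \<in> E" "src e = v" and xs: "xs = e # ys"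
        and ys: "ys \<in> trails src tgt r (tgt e) (E - {e})" by blast
      thus "xs \<in> trails src tgt r v E"
        unfolding trails_def xs by (simp add: insert_absorb)
    qed
  qed
  have "card (trails src tgt r v E) =
      (\<Sum>e\<in>{e \<in> E. src e = v}. card ((#) e ` trails src tgt r (tgt e) (E - {e})))"
    unfolding eq by (rule card_UN_disjoint) (use assms(1) in auto)
  also have "\<dots> = (\<Sum>e\<in>{e \<in> E. src e = v}. card (trails src tgt r (tgt e) (E - {e})))"
    by (rule sum.cong) (auto intro: card_image)
  finally show ?thesis .
qed

text \<open>Each \<open>x\<close> is counted once for every \<open>y\<close> other than
  \<open>f x\<close>. It will be applied to the exit trees \<open>L\<close> and the candidates
  \<open>y\<close> for the first edge at \<open>v\<close>: a first edge that is not the only one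
  must differ from the last exit \<open>L v\<close>.\<close>

lemma sum_card_diff_eq:
  assumes "finite X" "finite Y" "\<And>x. x \<in> X \<Longrightarrow> f x \<in> Y"
  shows "(\<Sum>y\<in>Y. card {x \<in> X. f x \<noteq> y}) = card X * (card Y - 1)"
proof -
  have "(\<Sum>y\<in>Y. card {x \<in> X. f x \<noteq> y}) = (\<Sum>y\<in>Y. \<Sum>x\<in>X. of_bool (f x \<noteq> y))"
    using assms(1) by (simp add: Int_def)
  also have "\<dots> = (\<Sum>x\<in>X. \<Sum>y\<in>Y. of_bool (f x \<noteq> y))" by (rule sum.swap)
  also have "\<dots> = (\<Sum>x\<in>X. card Y - 1)"
  proof (rule sum.cong[OF refl])
    fix x assume x: "x \<in> X"
    have "{y \<in> Y. f x \<noteq> y} = Y - {f x}" by auto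
    thus "(\<Sum>y\<in>Y. of_bool (f x \<noteq> y)) = card Y - 1"
      using assms(2) assms(3)[OF x] by (simp add: Int_def)
  qed
  finally show ?thesis by simp
qed

text \<open>The BEST theorem, by removing the first edge of the trail.\<close>

theorem card_trails:
  assumes "finite E"
    and "\<And>u. deg src E u + of_bool (u = r) = deg tgt E u + of_bool (u = v)"
  shows "card (trails src tgt r v E) = card (exit_trees src tgt r E) *
     (\<Prod>u\<in>src ` E - {r}. fact (deg src E u - 1)) * fact (deg src E r)"
  using assms
\<comment> \<open>Open trails from \<open>v\<close> to \<open>r\<close> are needed because removing
  the first edge moves the start. The Boolean terms keep the degree condition invariant under this
  removal.\<close>
proof (induction "card E" arbitrary: E v rule: less_induct)
  case less
  note fin = \<open>finite E\<close> and bal = less.prems(2)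
  show ?case
  proof (cases "E = {}")
    case True
    have "v = r" using bal[of r] True by (cases "v = r") (auto simp: deg_def)
    hence "trails src tgt r v E = {[]}" by (auto simp: trails_def True)
    moreover have "exit_trees src tgt r E = {\<lambda>_. undefined}"
      by (auto simp: exit_trees_def True rooted_def)
    ultimately show ?thesis by (simp add: True deg_def)
  next
    case False
    define U where "U = src ` E - {r}"
    define Ev where "Ev = {e \<in> E. src e = v}"
    have finU: "finite U" "finite Ev" "r \<notin> U" using fin by (auto simp: U_def Ev_def)
    have cEv: "card Ev = deg src E v" by (simp add: Ev_def deg_def)
    have step: "card (trails src tgt r v E) =
        (\<Sum>e\<in>Ev. card (trails src tgt r (tgt e) (E - {e})))"
      unfolding Ev_def by (rule card_trails_step[OF fin False])
    have IH: "card (trails src tgt r (tgt e) (E - {e})) = card (exit_trees src tgt r (E - {e})) *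
        (\<Prod>u\<in>src ` (E - {e}) - {r}. fact (deg src (E - {e}) u - 1)) * fact (deg src (E - {e}) r)"
      if e: "e \<in> Ev" for e
    proof (rule less.hyps)
      have eE: "e \<in> E" "src e = v" using e by (auto simp: Ev_def)
      show "card (E - {e}) < card E" by (rule card_Diff1_less[OF fin eE(1)])
      show "finite (E - {e})" using fin by simp
      show "deg src (E - {e}) u + of_bool (u = r) = deg tgt (E - {e}) u + of_bool (u = tgt e)" for u
        using bal[of u] deg_remove[OF fin eE(1), of src u] deg_remove[OF fin eE(1), of tgt u] eE(2)
        by simp
    qed
    have degd: "deg src (E - {e}) u = (if u = v then deg src E v - 1 else deg src E u)" if "e \<in> Ev" for e u
      using deg_remove[OF fin, of e src u] that by (auto simp: Ev_def)
    have srcd: "u \<in> src ` (E - {e}) \<longleftrightarrow> u \<in> src ` E \<and> (u = v \<longrightarrow> deg src E v > 1)" if "e \<in> Ev" for e u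
      unfolding deg_pos_iff[OF fin, symmetric] deg_pos_iff[OF finite_Diff[OF fin], symmetric] degd[OF that]
      by auto
    show ?thesis
    proof (cases "v = r")
      case True
      show ?thesis
      proof (cases "Ev = {}")
        case empty: True
        have "r \<notin> src ` E" using empty True by (auto simp: Ev_def)
        hence U: "U = src ` E" by (auto simp: U_def)
        have "deg tgt E r = 0" using bal[of r] cEv empty True by simp
        hence no: "r \<notin> tgt ` E" using deg_pos_iff[OF fin, of tgt r] by simp
        \<comment> \<open>There are edges, but none enters \<open>r\<close>. Hence only
          \<open>r\<close> itself reaches \<open>r\<close>, no exit tree exists, and both sides are
          0.\<close>
        have "\<not> rooted U (tgt \<circ> L) r" if L: "L \<in> (\<Pi>\<^sub>E u\<in>U. {e \<in> E. src e = u})" for L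
        proof
          assume roo: "rooted U (tgt \<circ> L) r"
          have "u = r" if "reaches U (tgt \<circ> L) r u" for u
            using that
          proof induction
            case (step u)
            hence "L u \<in> E" using L by auto
            thus ?case using step no by auto
          qed auto
          moreover obtain u where "u \<in> U" using False U by auto
          ultimately show False using roo finU by (auto simp: rooted_def)
        qed
        hence "exit_trees src tgt r E = {}" by (auto simp: exit_trees_def U_def)
        thus ?thesis unfolding step by (simp add: empty)
      next
        case False
        have pos: "deg src E r > 0" using False cEv finU True by (metis card_gt_0_iff)
        \<comment> \<open>The root carries no last exit, so removing an edge at the root does not
          affect the exit trees. The choice of the first edge then turns
          \<open>fact (deg src E r - 1)\<close> into \<open>fact (deg src E r)\<close>.\<close>
        have "card (trails src tgt r (tgt e) (E - {e})) = card (exit_trees src tgt r E) *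
          (\<Prod>u\<in>U. fact (deg src E u - 1)) * fact (deg src E r - 1)" if e: "e \<in> Ev" for e
        proof -
          have U': "src ` (E - {e}) - {r} = U" using srcd[OF e] True by (auto simp: U_def)
          have "(\<Pi>\<^sub>E u\<in>U. {e' \<in> E - {e}. src e' = u}) = (\<Pi>\<^sub>E u\<in>U. {e' \<in> E. src e' = u})"
            by (rule PiE_cong) (use e True in \<open>auto simp: U_def Ev_def\<close>)
          hence "exit_trees src tgt r (E - {e}) = exit_trees src tgt r E"
            unfolding exit_trees_def U' by (simp add: U_def)
          moreover have "(\<Prod>u\<in>U. fact (deg src (E - {e}) u - 1)) = (\<Prod>u\<in>U. fact (deg src E u - 1) :: nat)"
            by (rule prod.cong) (use degd[OF e] True finU in auto)
          ultimately show ?thesis using IH[OF e] degd[OF e, of r] True by (simp add: U')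
        qed
        hence "card (trails src tgt r v E) = deg src E r * (card (exit_trees src tgt r E) *
          (\<Prod>u\<in>U. fact (deg src E u - 1)) * fact (deg src E r - 1))"
          unfolding step by (simp add: cEv True)
        also have "\<dots> = card (exit_trees src tgt r E) * (\<Prod>u\<in>U. fact (deg src E u - 1)) * fact (deg src E r)"
          using pos by (simp add: fact_reduce)
        finally show ?thesis by (simp add: U_def)
      qed
    next
      case vr: False
      have bv: "deg src E v = Suc (deg tgt E v)" using bal[of v] vr by simp
      hence vU: "v \<in> U" using deg_pos_iff[OF fin, of src v] vr by (simp add: U_def)
      define K where "K = (\<Prod>u\<in>U - {v}. fact (deg src E u - 1) :: nat)"
      have prodU: "(\<Prod>u\<in>U. fact (deg src E u - 1) :: nat) = fact (deg src E v - 1) * K"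
        unfolding K_def by (rule prod.remove) (use finU vU in auto)
      show ?thesis
      proof (cases "deg src E v = 1")
        case False
        hence big: "deg src E v > 1" using bv by simp
        \<comment> \<open>As \<open>v\<close> has to be left again after \<open>e\<close>, the exit
          trees of the remaining edges are those of \<open>E\<close> whose exit from
          \<open>v\<close> is not \<open>e\<close>.\<close>
        have "card (trails src tgt r (tgt e) (E - {e})) =
            card {L \<in> exit_trees src tgt r E. L v \<noteq> e} * (fact (deg src E v - 2) * K * fact (deg src E r))"
          if e: "e \<in> Ev" for e
        proof -
          have U': "src ` (E - {e}) - {r} = U" using srcd[OF e] big by (auto simp: U_def)
          have "L \<in> (\<Pi>\<^sub>E u\<in>U. {e' \<in> E - {e}. src e' = u}) \<longleftrightarrow>
             L \<in> (\<Pi>\<^sub>E u\<in>U. {e' \<in> E. src e' = u}) \<and> L v \<noteq> e" for L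
            using vU e by (auto simp: PiE_iff Ev_def)
          hence "exit_trees src tgt r (E - {e}) = {L \<in> exit_trees src tgt r E. L v \<noteq> e}"
            unfolding exit_trees_def U' by (auto simp: U_def)
          moreover have "(\<Prod>u\<in>U. fact (deg src (E - {e}) u - 1) :: nat) =
              fact (deg src (E - {e}) v - 1) * (\<Prod>u\<in>U - {v}. fact (deg src (E - {e}) u - 1))"
            by (rule prod.remove) (use finU vU in auto)
          moreover have "(\<Prod>u\<in>U - {v}. fact (deg src (E - {e}) u - 1) :: nat) = K"
            unfolding K_def by (rule prod.cong) (use degd[OF e] in auto)
          ultimately show ?thesis using IH[OF e] degd[OF e, of r] degd[OF e, of v] vr
            by (simp add: U' numeral_2_eq_2 mult.assoc)
        qed
        hence "card (trails src tgt r v E) = (\<Sum>e\<in>Ev. card {L \<in> exit_trees src tgt r E. L v \<noteq> e}) *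
            (fact (deg src E v - 2) * K * fact (deg src E r))"
          unfolding step by (simp add: sum_distrib_right)
        also have "(\<Sum>e\<in>Ev. card {L \<in> exit_trees src tgt r E. L v \<noteq> e}) =
            card (exit_trees src tgt r E) * (card Ev - 1)"
          by (rule sum_card_diff_eq[OF finite_exit_trees[OF fin] finU(2)])
            (use vU in \<open>auto simp: exit_trees_def Ev_def U_def PiE_iff\<close>)
        finally show ?thesis using big prodU fact_reduce[of "deg src E v - 1", where ?'a=nat]
          by (simp add: U_def[symmetric] cEv numeral_2_eq_2)
      next
        case one: True
        then obtain e where Ev: "Ev = {e}" using cEv by (metis card_1_singletonE)
        hence e: "e \<in> Ev" by simp
        \<comment> \<open>By the degree condition no edge enters \<open>v\<close>, so
          \<open>v\<close> is a leaf of every exit tree, with \<open>e\<close> as its only possible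
          exit. Contracting this leaf gives the exit trees of \<open>E - {e}\<close>.\<close>
        have notgt: "v \<notin> tgt ` E" using bv one deg_pos_iff[OF fin, of tgt v] by simp
        define A where "A = U - {v}"
        have UA: "U = insert v A" "v \<notin> A" "r \<notin> A" using vU finU by (auto simp: A_def)
        have U': "src ` (E - {e}) - {r} = A" using srcd[OF e] one by (auto simp: U_def A_def)
        have eE: "e \<in> E" "src e = v" using e by (auto simp: Ev_def)
        have tev: "tgt e \<noteq> v" using notgt imageI[OF eE(1), of tgt] by auto
        have teA: "tgt e \<in> insert r A"
        proof (cases "tgt e = r")
          case False
          have "deg tgt E (tgt e) > 0" using deg_pos_iff[OF fin, of tgt "tgt e"] eE by auto
          hence "deg src E (tgt e) > 0" using bal[of "tgt e"] False tev by simp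
          thus ?thesis using deg_pos_iff[OF fin, of src "tgt e"] False tev by (simp add: A_def U_def)
        qed simp
        have roo: "rooted (insert v A) (tgt \<circ> g(v := e)) r \<longleftrightarrow> rooted A (tgt \<circ> g) r"
          if g: "g \<in> (\<Pi>\<^sub>E u\<in>A. {e' \<in> E. src e' = u})" for g
        proof -
          have "tgt (g u) \<noteq> v" if "u \<in> A" for u using g that notgt by (auto simp: PiE_iff)
          hence eq: "rooted A (\<lambda>u. if (tgt \<circ> g(v := e)) u = v then (tgt \<circ> g(v := e)) v else (tgt \<circ> g(v := e)) u) r
             = rooted A (tgt \<circ> g) r"
            by (intro rooted_cong) (use UA(2) in auto)
          have v: "(tgt \<circ> g(v := e)) v = tgt e" by simp
          have "rooted (insert v A) (tgt \<circ> g(v := e)) r \<longleftrightarrow>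
              (tgt \<circ> g(v := e)) v \<noteq> v \<and> (tgt \<circ> g(v := e)) v \<in> insert r A \<and> rooted A (tgt \<circ> g) r"
            using rooted_insert_contract[OF UA(3,2) vr, of "tgt \<circ> g(v := e)"] unfolding eq .
          thus ?thesis unfolding v by (simp only: tev teA not_False_eq_True simp_thms)
        qed
        have "card (exit_trees src tgt r E) =
          (\<Sum>y\<in>{e' \<in> E. src e' = v}. card {g \<in> (\<Pi>\<^sub>E u\<in>A. {e' \<in> E. src e' = u}). rooted (insert v A) (tgt \<circ> g(v := y)) r})"
          unfolding exit_trees_def U_def[symmetric] UA(1)
          by (rule card_PiE_insert_split[where x = v and A = A and B = "\<lambda>u. {e' \<in> E. src e' = u}" and
                P = "\<lambda>L. rooted (insert v A) (tgt \<circ> L) r"])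
            (use fin finU(1) in \<open>auto simp: A_def\<close>)
        also have "\<dots> = card {g \<in> (\<Pi>\<^sub>E u\<in>A. {e' \<in> E. src e' = u}). rooted (insert v A) (tgt \<circ> g(v := e)) r}"
          using Ev by (simp add: Ev_def)
        also have "{g \<in> (\<Pi>\<^sub>E u\<in>A. {e' \<in> E. src e' = u}). rooted (insert v A) (tgt \<circ> g(v := e)) r} =
            {g \<in> (\<Pi>\<^sub>E u\<in>A. {e' \<in> E. src e' = u}). rooted A (tgt \<circ> g) r}"
          using roo by blast
        also have "(\<Pi>\<^sub>E u\<in>A. {e' \<in> E. src e' = u}) = (\<Pi>\<^sub>E u\<in>A. {e' \<in> E - {e}. src e' = u})"
          by (rule PiE_cong) (use eE UA(2) in auto)
        finally have ex: "card (exit_trees src tgt r E) = card (exit_trees src tgt r (E - {e}))"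
          by (simp only: exit_trees_def U')
        have "(\<Prod>u\<in>A. fact (deg src (E - {e}) u - 1) :: nat) = K"
          unfolding K_def A_def by (rule prod.cong) (use degd[OF e] in auto)
        thus ?thesis unfolding step Ev using IH[OF e] ex prodU one degd[OF e, of r] vr
          by (simp add: U' U_def[symmetric])
      qed
    qed
  qed
qed

lemma rooted_no_fixpoint:
  assumes "rooted U h r" "u \<in> U" "r \<notin> U"
  shows "h u \<noteq> u"
proof
  assume fx: "h u = u"
  have "v \<noteq> u" if "reaches U h r v" for v
    using that
  proof induction
    case base
    show ?case using assms(2,3) by blast
  next
    case (step v)
    show ?case using step.IH fx by metis
  qed
  thus False using assms(1,2) by (auto simp: rooted_def)
qed

text \<open>In a bipartite graph it suffices to watch every second vertex of a path. The root
  \<open>b0\<close> lies on the side that is skipped, so a dummy \<open>r\<close> takes its place;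
  the vertices of \<open>Q\<close> follow because their next vertex is in \<open>P\<close>.\<close>

lemma rooted_bipartite:
  fixes g1 :: "'p \<Rightarrow> 'q" and g2 :: "'q \<Rightarrow> 'p"
  assumes g1: "\<And>a. a \<in> P \<Longrightarrow> g1 a \<in> insert b0 Q" and g2: "\<And>b. b \<in> Q \<Longrightarrow> g2 b \<in> P"
    and b0: "b0 \<notin> Q" and r: "r \<notin> P"
  shows "rooted (Inl ` Q \<union> Inr ` P) (case_sum (Inr \<circ> g2) (Inl \<circ> g1)) (Inl b0) \<longleftrightarrow>
    rooted P (\<lambda>a. if g1 a = b0 then r else g2 (g1 a)) r"
proof
  let ?X = "Inl ` Q \<union> Inr ` P :: ('q + 'p) set"
  let ?h = "case_sum (Inr \<circ> g2) (Inl \<circ> g1)"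
  let ?k = "\<lambda>a. if g1 a = b0 then r else g2 (g1 a)"
  assume R: "rooted ?X ?h (Inl b0)"
  have *: "case v of Inl b \<Rightarrow> b = b0 \<or> reaches P ?k r (g2 b) | Inr a \<Rightarrow> reaches P ?k r a"
    if "reaches ?X ?h (Inl b0) v" for v
    using that
  proof induction
    case base
    show ?case by simp
  next
    case (step u)
    show ?case
    proof (cases u)
      case (Inl b)
      thus ?thesis using step.IH by simp
    next
      case (Inr a)
      hence a: "a \<in> P" using step.hyps by auto
      have "g1 a = b0 \<or> reaches P ?k r (g2 (g1 a))" using step.IH Inr by simp
      hence "reaches P ?k r (?k a)" by (auto intro: reaches.base)
      thus ?thesis using a Inr by (simp add: reaches.step)
    qed
  qed
  show "rooted P ?k r"
    unfolding rooted_def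
  proof
    fix a assume "a \<in> P"
    hence "reaches ?X ?h (Inl b0) (Inr a)" using R by (auto simp: rooted_def)
    from *[OF this] show "reaches P ?k r a" by simp
  qed
next
  let ?X = "Inl ` Q \<union> Inr ` P :: ('q + 'p) set"
  let ?h = "case_sum (Inr \<circ> g2) (Inl \<circ> g1)"
  let ?k = "\<lambda>a. if g1 a = b0 then r else g2 (g1 a)"
  assume R: "rooted P ?k r"
  have *: "a = r \<or> reaches ?X ?h (Inl b0) (Inr a)" if "reaches P ?k r a" for a
    using that
  proof induction
    case base
    show ?case by simp
  next
    case (step a)
    have "reaches ?X ?h (Inl b0) (Inl (g1 a))"
    proof (cases "g1 a = b0")
      case True
      thus ?thesis by (simp add: reaches.base)
    next
      case False
      hence Q: "g1 a \<in> Q" using g1[OF step.hyps(1)] by simp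
      hence "g2 (g1 a) \<noteq> r" using g2 r by metis
      hence "reaches ?X ?h (Inl b0) (Inr (g2 (g1 a)))" using step.IH False by simp
      thus ?thesis using Q reaches.step[of "Inl (g1 a)" ?X ?h "Inl b0"] by auto
    qed
    hence "reaches ?X ?h (Inl b0) (Inr a)" using step.hyps(1) reaches.step[of "Inr a" ?X ?h "Inl b0"] by auto
    thus ?case ..
  qed
  have P: "reaches ?X ?h (Inl b0) (Inr a)" if "a \<in> P" for a
  proof -
    have "reaches P ?k r a" using R that by (simp add: rooted_def)
    moreover have "a \<noteq> r" using that r by blast
    ultimately show ?thesis using * by blast
  qed
  show "rooted ?X ?h (Inl b0)"
    unfolding rooted_def
  proof
    fix v assume v: "v \<in> ?X"
    show "reaches ?X ?h (Inl b0) v"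
    proof (cases v)
      case (Inl b)
      hence b: "b \<in> Q" using v by auto
      have "reaches ?X ?h (Inl b0) (?h v)" using P[OF g2[OF b]] Inl by simp
      thus ?thesis by (rule reaches.step[OF v])
    next
      case (Inr a)
      thus ?thesis using P v by auto
    qed
  qed
qed

section \<open>Permutations with a prescribed tree of last exits\<close>

lemma exists_permutes_extending:
  assumes "finite N" "inj_on s D" "inj_on t D" "s ` D \<subseteq> N" "t ` D \<subseteq> N"
  obtains \<phi> where "\<phi> permutes N" "\<And>d. d \<in> D \<Longrightarrow> \<phi> (s d) = t d"
proof -
  have b1: "bij_betw (t \<circ> inv_into D s) (s ` D) (t ` D)"
    by (rule bij_betw_trans[OF bij_betw_inv_into[OF inj_on_imp_bij_betw[OF assms(2)]]
          inj_on_imp_bij_betw[OF assms(3)]])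
  have "card (N - s ` D) = card (N - t ` D)"
    using assms(1,2,3) finite_subset[OF assms(4,1)] finite_subset[OF assms(5,1)] assms(4,5)
    by (simp add: card_Diff_subset card_image)
  then obtain g where b2: "bij_betw g (N - s ` D) (N - t ` D)"
    using finite_same_card_bij[of "N - s ` D" "N - t ` D"] finite_Diff[OF assms(1)] by metis
  define f where "f = (\<lambda>x. if x \<in> s ` D then (t \<circ> inv_into D s) x else if x \<in> N then g x else x)"
  have "bij_betw f (s ` D) (t ` D)"
    by (rule bij_betw_cong[THEN iffD2, OF _ b1]) (simp add: f_def)
  moreover have "bij_betw f (N - s ` D) (N - t ` D)"
    by (rule bij_betw_cong[THEN iffD2, OF _ b2]) (simp add: f_def)
  ultimately have "bij_betw f (s ` D \<union> (N - s ` D)) (t ` D \<union> (N - t ` D))"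
    by (rule bij_betw_combine) auto
  moreover have "s ` D \<union> (N - s ` D) = N" "t ` D \<union> (N - t ` D) = N" using assms(4,5) by auto
  ultimately have "bij_betw f N N" by simp
  hence "f permutes N" by (rule bij_imp_permutes) (use assms(4) in \<open>auto simp: f_def\<close>)
  moreover have "f (s d) = t d" if "d \<in> D" for d
    using that assms(2) by (simp add: f_def)
  ultimately show ?thesis using that by blast
qed

lemma card_permutes_extending:
  assumes "finite N" "inj_on s D" "inj_on t D" "s ` D \<subseteq> N" "t ` D \<subseteq> N"
  shows "card {\<phi>. \<phi> permutes N \<and> (\<forall>d\<in>D. \<phi> (s d) = t d)} = fact (card N - card D)"
proof -
  obtain \<phi>0 where p0: "\<phi>0 permutes N" "\<And>d. d \<in> D \<Longrightarrow> \<phi>0 (s d) = t d"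
    using exists_permutes_extending[OF assms] by blast
  have "bij_betw (\<lambda>\<rho>. \<phi>0 \<circ> \<rho>) {\<rho>. \<rho> permutes (N - s ` D)}
     {\<phi>. \<phi> permutes N \<and> (\<forall>d\<in>D. \<phi> (s d) = t d)}"
  proof (rule bij_betw_byWitness[where f' = "\<lambda>\<phi>. inv \<phi>0 \<circ> \<phi>"])
    show "\<forall>\<rho>\<in>{\<rho>. \<rho> permutes (N - s ` D)}. inv \<phi>0 \<circ> (\<phi>0 \<circ> \<rho>) = \<rho>"
      by (simp add: o_assoc permutes_inv_o[OF p0(1)])
    show "\<forall>\<phi>\<in>{\<phi>. \<phi> permutes N \<and> (\<forall>d\<in>D. \<phi> (s d) = t d)}. \<phi>0 \<circ> (inv \<phi>0 \<circ> \<phi>) = \<phi>"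
      by (simp add: o_assoc permutes_inv_o[OF p0(1)])
    show "(\<lambda>\<rho>. \<phi>0 \<circ> \<rho>) ` {\<rho>. \<rho> permutes (N - s ` D)} \<subseteq> {\<phi>. \<phi> permutes N \<and> (\<forall>d\<in>D. \<phi> (s d) = t d)}"
    proof safe
      fix \<rho> assume \<rho>: "\<rho> permutes (N - s ` D)"
      have "\<rho> permutes N" using \<rho> by (rule permutes_subset) auto
      thus "\<phi>0 \<circ> \<rho> permutes N" using p0(1) by (rule permutes_compose)
      fix d assume d: "d \<in> D"
      hence "\<rho> (s d) = s d" using \<rho> by (auto simp: permutes_def)
      thus "(\<phi>0 \<circ> \<rho>) (s d) = t d" using p0(2)[OF d] by simp
    qed
    show "(\<lambda>\<phi>. inv \<phi>0 \<circ> \<phi>) ` {\<phi>. \<phi> permutes N \<and> (\<forall>d\<in>D. \<phi> (s d) = t d)} \<subseteq> {\<rho>. \<rho> permutes (N - s ` D)}"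
    proof safe
      fix \<phi> assume \<phi>: "\<phi> permutes N" "\<forall>d\<in>D. \<phi> (s d) = t d"
      have "inv \<phi>0 \<circ> \<phi> permutes N" using \<phi>(1) permutes_inv[OF p0(1)] by (rule permutes_compose)
      thus "inv \<phi>0 \<circ> \<phi> permutes (N - s ` D)"
      proof (rule permutes_superset)
        fix x assume "x \<in> N - (N - s ` D)"
        then obtain d where "d \<in> D" "x = s d" by auto
        thus "(inv \<phi>0 \<circ> \<phi>) x = x"
          using \<phi>(2) p0(2)[of d] permutes_inverses(2)[OF p0(1), of "s d"] by simp
      qed
    qed
  qed
  hence "card {\<phi>. \<phi> permutes N \<and> (\<forall>d\<in>D. \<phi> (s d) = t d)} = card {\<rho>. \<rho> permutes (N - s ` D)}"
    by (simp add: bij_betw_same_card)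
  also have "\<dots> = fact (card N - card D)"
  proof (rule card_permutations)
    show "card (N - s ` D) = card N - card D"
      using finite_subset[OF assms(4,1)] assms(4) by (simp add: card_Diff_subset card_image assms(2))
  qed (use assms(1) in simp)
  finally show ?thesis .
qed

lemma card_inj_PiE:
  assumes "finite B" "finite C" "card B \<le> card C"
  shows "card {f \<in> B \<rightarrow>\<^sub>E C. inj_on f B} * fact (card C - card B) = fact (card C)"
proof -
  have "(\<Prod>i = 0..<k. c - i) * fact (c - k) = fact c" if "k \<le> c" for k c :: nat
    using that
  proof (induction k)
    case (Suc k)
    have "fact (c - k) = (c - k) * fact (c - Suc k)"
      using Suc.prems fact_reduce[of "c - k", where ?'a = nat] by simp
    thus ?case using Suc by (simp add: mult.assoc)
  qed simp
  thus ?thesis using assms by (simp add: card_inj_on_subset_funcset)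
qed

lemma card_eq_sum_fibers:
  assumes "finite X" "finite Y" "F ` X \<subseteq> Y"
  shows "card X = (\<Sum>y\<in>Y. card {x \<in> X. F x = y})"
  using sum.group[OF assms, of "\<lambda>_. 1::nat"] by simp

lemma inj_on_case_sum:
  assumes "inj_on f A" "inj_on g B" "\<And>a b. a \<in> A \<Longrightarrow> b \<in> B \<Longrightarrow> f a \<noteq> g b"
  shows "inj_on (case_sum f g) (A <+> B)"
proof (rule inj_onI)
  fix x y assume x: "x \<in> A <+> B" and y: "y \<in> A <+> B" and eq: "case_sum f g x = case_sum f g y"
  show "x = y"
  proof (cases x; cases y)
    fix a b assume "x = Inl a" "y = Inr b"
    thus ?thesis using x y eq assms(3)[of a b] by auto
  next
    fix a b assume "x = Inr b" "y = Inl a"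
    thus ?thesis using x y eq assms(3)[of a b] by auto
  next
    fix a b assume "x = Inl a" "y = Inl b"
    thus ?thesis using x y eq inj_onD[OF assms(1), of a b] by auto
  next
    fix a b assume "x = Inr a" "y = Inr b"
    thus ?thesis using x y eq inj_onD[OF assms(2), of a b] by auto
  qed
qed

text \<open>
  Fixing \<open>\<psi>2 = \<phi> \<circ> l2\<close> turns the bipartite graph into a functional graph on \<open>P\<close>, and the number of
  admissible \<open>\<psi>1 = inv \<phi> \<circ> l1\<close> does not depend on \<open>\<psi>2\<close>.
\<close>

lemma card_permutes_rooted:
  fixes l1 :: "'p \<Rightarrow> 'e" and l2 :: "'q \<Rightarrow> 'e"
  assumes fin: "finite N" and Q: "finite Q" and P: "finite P" "P \<noteq> {}" and b0: "b0 \<notin> Q" and r: "r \<notin> P"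
    and l1: "\<And>a. a \<in> P \<Longrightarrow> l1 a \<in> N" "\<And>a. a \<in> P \<Longrightarrow> o1 (l1 a) = a"
    and l2: "\<And>b. b \<in> Q \<Longrightarrow> l2 b \<in> N" "\<And>b. b \<in> Q \<Longrightarrow> o2 (l2 b) = b"
    and o1: "\<And>e. e \<in> N \<Longrightarrow> o1 e \<in> P" and o2: "\<And>e. e \<in> N \<Longrightarrow> o2 e \<in> insert b0 Q"
    and le: "card P + card Q \<le> card N"
  shows "card {\<phi>. \<phi> permutes N \<and> rooted (Inl ` Q \<union> Inr ` P)
           (case_sum (Inr \<circ> (o1 \<circ> \<phi> \<circ> l2)) (Inl \<circ> (o2 \<circ> inv \<phi> \<circ> l1))) (Inl b0)} * fact (card N - card P - card Q) =
         card {e \<in> N. o2 e = b0} * fact (card N - card P) * fact (card N - card Q - 1)"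
proof -
  \<comment> \<open>The values still available for \<open>\<psi>1\<close> and, with
    \<open>T\<close>, for \<open>\<psi>2\<close>: if \<open>\<phi>\<close> made the last exits
    \<open>l2 b\<close> and \<open>l1 a\<close> reverse to each other, then \<open>a\<close> and
    \<open>b\<close> would lead to each other and never to the root.\<close>
  define S where "S = N - l2 ` Q"
  define T where "T = N - l1 ` P"
  define k where "k \<psi>2 s = (if o2 s = b0 then r else o1 (\<psi>2 (o2 s)))" for \<psi>2 s
  define \<Phi> where "\<Phi> = {\<phi>. \<phi> permutes N \<and> rooted (Inl ` Q \<union> Inr ` P)
           (case_sum (Inr \<circ> (o1 \<circ> \<phi> \<circ> l2)) (Inl \<circ> (o2 \<circ> inv \<phi> \<circ> l1))) (Inl b0)}"
  define R where "R \<psi>2 = {\<psi>1 \<in> P \<rightarrow>\<^sub>E S. inj_on \<psi>1 P \<and> rooted P (k \<psi>2 \<circ> \<psi>1) r}" for \<psi>2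
  define I2 where "I2 = {\<psi>2 \<in> Q \<rightarrow>\<^sub>E T. inj_on \<psi>2 Q}"
  have injl: "inj_on l1 P" "inj_on l2 Q"
    using l1(2) l2(2) by (metis inj_onI)+
  have fST: "finite S" "finite T" using fin by (auto simp: S_def T_def)
  have cS: "card S = card N - card Q" unfolding S_def
    by (subst card_Diff_subset) (use Q l2(1) injl in \<open>auto simp: card_image\<close>)
  have cT: "card T = card N - card P" unfolding T_def
    by (subst card_Diff_subset) (use P l1(1) injl in \<open>auto simp: card_image\<close>)
  define F where "F \<phi> = (restrict (\<phi> \<circ> l2) Q, restrict (inv \<phi> \<circ> l1) P)" for \<phi>
  have fin\<Phi>: "finite \<Phi>" unfolding \<Phi>_def
    by (rule finite_subset[OF _ finite_permutations[OF fin]]) auto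
  have roo: "rooted (Inl ` Q \<union> Inr ` P) (case_sum (Inr \<circ> (o1 \<circ> \<phi> \<circ> l2)) (Inl \<circ> (o2 \<circ> inv \<phi> \<circ> l1))) (Inl b0) \<longleftrightarrow>
      rooted P (k (restrict (\<phi> \<circ> l2) Q) \<circ> restrict (inv \<phi> \<circ> l1) P) r" if \<phi>: "\<phi> permutes N" for \<phi>
  proof -
    have g1: "(o2 \<circ> inv \<phi> \<circ> l1) a \<in> insert b0 Q" if "a \<in> P" for a
      using o2[of "inv \<phi> (l1 a)"] l1(1)[OF that] permutes_in_image[OF permutes_inv[OF \<phi>]] by simp
    have g2: "(o1 \<circ> \<phi> \<circ> l2) b \<in> P" if "b \<in> Q" for b
      using o1[of "\<phi> (l2 b)"] l2(1)[OF that] permutes_in_image[OF \<phi>] by simp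
    show ?thesis
    proof (rule trans[OF rooted_bipartite[OF g1 g2 b0 r] rooted_cong])
      fix a assume a: "a \<in> P"
      show "(if (o2 \<circ> inv \<phi> \<circ> l1) a = b0 then r else (o1 \<circ> \<phi> \<circ> l2) ((o2 \<circ> inv \<phi> \<circ> l1) a)) =
         (k (restrict (\<phi> \<circ> l2) Q) \<circ> restrict (inv \<phi> \<circ> l1) P) a"
        using g1[OF a] a by (auto simp: k_def)
    qed
  qed
  have sub: "F ` \<Phi> \<subseteq> (SIGMA \<psi>2:I2. R \<psi>2)"
  proof (rule image_subsetI)
    fix \<phi> assume "\<phi> \<in> \<Phi>"
    hence \<phi>: "\<phi> permutes N"
      and ro: "rooted P (k (restrict (\<phi> \<circ> l2) Q) \<circ> restrict (inv \<phi> \<circ> l1) P) r"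
      using roo by (auto simp: \<Phi>_def)
    have apart: "\<phi> (l2 b) \<noteq> l1 a" if ab: "a \<in> P" "b \<in> Q" for a b
    proof
      assume eq: "\<phi> (l2 b) = l1 a"
      hence "inv \<phi> (l1 a) = l2 b" using permutes_inverses(2)[OF \<phi>, of "l2 b"] by simp
      hence "(k (restrict (\<phi> \<circ> l2) Q) \<circ> restrict (inv \<phi> \<circ> l1) P) a = a"
        using ab b0 l2(2)[OF ab(2)] l1(2)[OF ab(1)] eq by (auto simp: k_def)
      thus False using rooted_no_fixpoint[OF ro ab(1) r] by simp
    qed
    have inv\<phi>: "inv \<phi> permutes N" by (rule permutes_inv[OF \<phi>])
    have "restrict (\<phi> \<circ> l2) Q \<in> I2"
    proof -
      have "\<phi> (l2 b) \<in> T" if "b \<in> Q" for b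
        using apart that l2(1)[OF that] permutes_in_image[OF \<phi>] by (auto simp: T_def)
      moreover have "inj_on (\<phi> \<circ> l2) Q"
        by (rule comp_inj_on[OF injl(2)]) (rule permutes_inj_on[OF \<phi>])
      ultimately show ?thesis by (auto simp: I2_def)
    qed
    moreover have "restrict (inv \<phi> \<circ> l1) P \<in> R (restrict (\<phi> \<circ> l2) Q)"
    proof -
      have "inv \<phi> (l1 a) \<in> S" if a: "a \<in> P" for a
      proof -
        have "inv \<phi> (l1 a) \<noteq> l2 b" if "b \<in> Q" for b
          using apart[OF a that] permutes_inverses(1)[OF \<phi>, of "l1 a"] by metis
        thus ?thesis using l1(1)[OF a] permutes_in_image[OF inv\<phi>] by (auto simp: S_def)
      qed
      moreover have "inj_on (inv \<phi> \<circ> l1) P"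
        by (rule comp_inj_on[OF injl(1)]) (rule permutes_inj_on[OF inv\<phi>])
      ultimately show ?thesis using ro by (auto simp: R_def)
    qed
    ultimately show "F \<phi> \<in> (SIGMA \<psi>2:I2. R \<psi>2)" by (simp add: F_def)
  qed
  \<comment> \<open>Together \<open>\<psi>2\<close> and \<open>\<psi>1\<close> prescribe
    \<open>\<phi>\<close> at \<open>card Q + card P\<close> distinct points with distinct values,
    and the rest of \<open>\<phi>\<close> is free.\<close>
  have fiber: "card {\<phi> \<in> \<Phi>. F \<phi> = y} = fact (card N - card P - card Q)" if y: "y \<in> (SIGMA \<psi>2:I2. R \<psi>2)" for y
  proof -
    obtain \<psi>2 \<psi>1 where y': "y = (\<psi>2, \<psi>1)" by (cases y)
    hence p2: "\<psi>2 \<in> Q \<rightarrow>\<^sub>E T" "inj_on \<psi>2 Q" and p1: "\<psi>1 \<in> P \<rightarrow>\<^sub>E S" "inj_on \<psi>1 P" "rooted P (k \<psi>2 \<circ> \<psi>1) r"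
      using y by (auto simp: I2_def R_def)
    have iff: "F \<phi> = y \<longleftrightarrow> (\<forall>d\<in>Q <+> P. \<phi> (case_sum l2 \<psi>1 d) = case_sum \<psi>2 l1 d)" if \<phi>: "\<phi> permutes N" for \<phi>
    proof -
      have "F \<phi> = y \<longleftrightarrow> (\<forall>b\<in>Q. \<phi> (l2 b) = \<psi>2 b) \<and> (\<forall>a\<in>P. inv \<phi> (l1 a) = \<psi>1 a)"
      proof -
        have "restrict (\<phi> \<circ> l2) Q = \<psi>2 \<longleftrightarrow> (\<forall>b\<in>Q. \<phi> (l2 b) = \<psi>2 b)"
          using p2(1) by (auto simp: fun_eq_iff restrict_def PiE_def extensional_def)
        moreover have "restrict (inv \<phi> \<circ> l1) P = \<psi>1 \<longleftrightarrow> (\<forall>a\<in>P. inv \<phi> (l1 a) = \<psi>1 a)"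
          using p1(1) by (auto simp: fun_eq_iff restrict_def PiE_def extensional_def)
        ultimately show ?thesis by (simp add: F_def y')
      qed
      also have "\<dots> \<longleftrightarrow> (\<forall>b\<in>Q. \<phi> (l2 b) = \<psi>2 b) \<and> (\<forall>a\<in>P. \<phi> (\<psi>1 a) = l1 a)"
        by (metis permutes_inv_eq[OF \<phi>])
      also have "\<dots> \<longleftrightarrow> (\<forall>d\<in>Q <+> P. \<phi> (case_sum l2 \<psi>1 d) = case_sum \<psi>2 l1 d)"
        by (simp add: Plus_def ball_Un)
      finally show ?thesis .
    qed
    have "{\<phi> \<in> \<Phi>. F \<phi> = y} = {\<phi>. \<phi> permutes N \<and> (\<forall>d\<in>Q <+> P. \<phi> (case_sum l2 \<psi>1 d) = case_sum \<psi>2 l1 d)}"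
    proof (intro set_eqI iffI)
      fix \<phi> assume "\<phi> \<in> {\<phi> \<in> \<Phi>. F \<phi> = y}"
      thus "\<phi> \<in> {\<phi>. \<phi> permutes N \<and> (\<forall>d\<in>Q <+> P. \<phi> (case_sum l2 \<psi>1 d) = case_sum \<psi>2 l1 d)}"
        using iff[of \<phi>] by (simp add: \<Phi>_def)
    next
      fix \<phi> assume "\<phi> \<in> {\<phi>. \<phi> permutes N \<and> (\<forall>d\<in>Q <+> P. \<phi> (case_sum l2 \<psi>1 d) = case_sum \<psi>2 l1 d)}"
      hence \<phi>: "\<phi> permutes N" "F \<phi> = y" using iff[of \<phi>] by simp_all
      hence "rooted P (k (restrict (\<phi> \<circ> l2) Q) \<circ> restrict (inv \<phi> \<circ> l1) P) r"
        using p1(3) by (simp add: F_def y')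
      thus "\<phi> \<in> {\<phi> \<in> \<Phi>. F \<phi> = y}" using \<phi> roo[OF \<phi>(1)] by (simp add: \<Phi>_def)
    qed
    also have "card \<dots> = fact (card N - card (Q <+> P))"
    proof (rule card_permutes_extending[OF fin])
      show "inj_on (case_sum l2 \<psi>1) (Q <+> P)"
      proof (rule inj_on_case_sum[OF injl(2) p1(2)])
        fix b a assume "b \<in> Q" "a \<in> P"
        moreover have "\<psi>1 a \<in> S" using p1(1) \<open>a \<in> P\<close> by blast
        ultimately show "l2 b \<noteq> \<psi>1 a" unfolding S_def by (metis DiffD2 imageI)
      qed
      show "inj_on (case_sum \<psi>2 l1) (Q <+> P)"
      proof (rule inj_on_case_sum[OF p2(2) injl(1)])
        fix b a assume "b \<in> Q" "a \<in> P"
        moreover have "\<psi>2 b \<in> T" using p2(1) \<open>b \<in> Q\<close> by blast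
        ultimately show "\<psi>2 b \<noteq> l1 a" unfolding T_def by (metis DiffD2 imageI)
      qed
      show "case_sum l2 \<psi>1 ` (Q <+> P) \<subseteq> N" using l2(1) p1(1) by (auto simp: S_def PiE_iff)
      show "case_sum \<psi>2 l1 ` (Q <+> P) \<subseteq> N" using l1(1) p2(1) by (auto simp: T_def PiE_iff)
    qed
    also have "card (Q <+> P) = card Q + card P" by (rule card_Plus[OF Q P(1)])
    finally show ?thesis by (simp add: add.commute)
  qed
  define w where "w = card {e \<in> N. o2 e = b0} * fact (card N - card Q - 1)"
  have finI: "finite I2" "finite (R \<psi>2)" for \<psi>2
    unfolding I2_def R_def using finite_PiE[of Q "\<lambda>_. T"] finite_PiE[of P "\<lambda>_. S"] fST Q P by auto
  have cR: "card (R \<psi>2) * fact (card N - card P - card Q) = w" if p2: "\<psi>2 \<in> I2" for \<psi>2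
  proof -
    have "card (R \<psi>2) * fact (card S - card P) = card {s \<in> S. k \<psi>2 s = r} * fact (card S - 1)"
      unfolding R_def
    proof (rule card_rooted_injections[OF P fST(1) _ r])
      show "k \<psi>2 ` S \<subseteq> insert r P"
      proof (rule image_subsetI)
        fix s assume "s \<in> S"
        hence "o2 s \<in> insert b0 Q" by (intro o2) (simp add: S_def)
        moreover have "o1 (\<psi>2 b) \<in> P" if "b \<in> Q" for b
          using p2 that by (intro o1) (auto simp: I2_def T_def PiE_iff)
        ultimately show "k \<psi>2 s \<in> insert r P" by (auto simp: k_def)
      qed
      show "card P \<le> card S" using le cS by linarith
    qed
    \<comment> \<open>This is where the dependence on \<open>\<psi>2\<close> disappears. A slot
      leads to the root at once exactly if its colour is \<open>b0\<close>, and none of the removed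
      slots \<open>l2 b\<close> has that colour, so their number is the full class size of
      \<open>b0\<close>.\<close>
    moreover have "{s \<in> S. k \<psi>2 s = r} = {e \<in> N. o2 e = b0}"
    proof -
      have "k \<psi>2 s = r \<longleftrightarrow> o2 s = b0" if s: "s \<in> S" for s
      proof -
        have "o2 s \<in> insert b0 Q" using s by (intro o2) (simp add: S_def)
        moreover have "o1 (\<psi>2 b) \<noteq> r" if "b \<in> Q" for b
        proof -
          have "o1 (\<psi>2 b) \<in> P" using p2 that by (intro o1) (auto simp: I2_def T_def PiE_iff)
          thus ?thesis using r by metis
        qed
        ultimately show ?thesis by (auto simp: k_def)
      qed
      moreover have "o2 e \<noteq> b0" if "e \<in> l2 ` Q" for e using that l2(2) b0 by auto
      ultimately show ?thesis by (auto simp: S_def)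
    qed
    moreover have "card S - card P = card N - card P - card Q" "card S - 1 = card N - card Q - 1" using cS by simp_all
    ultimately show ?thesis by (simp add: w_def)
  qed
  have "card \<Phi> = (\<Sum>y\<in>(SIGMA \<psi>2:I2. R \<psi>2). card {\<phi> \<in> \<Phi>. F \<phi> = y})"
    by (rule card_eq_sum_fibers[OF fin\<Phi> _ sub]) (use finI in auto)
  also have "\<dots> = (\<Sum>\<psi>2\<in>I2. card (R \<psi>2)) * fact (card N - card P - card Q)"
    using fiber finI by simp
  also have "\<dots> = card I2 * w" using cR by (simp add: sum_distrib_right)
  finally have "card \<Phi> * fact (card N - card P - card Q) = (card I2 * fact (card T - card Q)) * w"
    by (simp add: cT)
  also have "card I2 * fact (card T - card Q) = fact (card T)"
    unfolding I2_def by (rule card_inj_PiE[OF Q fST(2)]) (use le cT in linarith)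
  finally show ?thesis unfolding \<Phi>_def[symmetric] w_def cT by (simp add: mult_ac)
qed

text \<open>In a tree no two last exits are reverse to each other, so the elements
  \<open>l1 a\<close> and \<open>\<phi> (l2 b)\<close> of \<open>N\<close> are all distinct, and
  there must be room for \<open>card P + card Q\<close> of them.\<close>

lemma not_rooted_if_card_gt:
  fixes l1 :: "'p \<Rightarrow> 'e" and l2 :: "'q \<Rightarrow> 'e"
  assumes fin: "finite N" and Q: "finite Q" and P: "finite P" and b0: "b0 \<notin> Q"
    and l1: "\<And>a. a \<in> P \<Longrightarrow> l1 a \<in> N" "\<And>a. a \<in> P \<Longrightarrow> o1 (l1 a) = a"
    and l2: "\<And>b. b \<in> Q \<Longrightarrow> l2 b \<in> N" "\<And>b. b \<in> Q \<Longrightarrow> o2 (l2 b) = b"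
    and gt: "card P + card Q > card N" and \<phi>: "\<phi> permutes N"
  shows "\<not> rooted (Inl ` Q \<union> Inr ` P)
           (case_sum (Inr \<circ> (o1 \<circ> \<phi> \<circ> l2)) (Inl \<circ> (o2 \<circ> inv \<phi> \<circ> l1))) (Inl b0)"
proof
  let ?X = "Inl ` Q \<union> Inr ` P :: ('q + 'p) set"
  let ?h = "case_sum (Inr \<circ> (o1 \<circ> \<phi> \<circ> l2)) (Inl \<circ> (o2 \<circ> inv \<phi> \<circ> l1))"
  assume ro: "rooted ?X ?h (Inl b0)"
  have apart: "\<phi> (l2 b) \<noteq> l1 a" if ab: "a \<in> P" "b \<in> Q" for a b
  proof
    assume eq: "\<phi> (l2 b) = l1 a"
    hence eq': "inv \<phi> (l1 a) = l2 b" using permutes_inverses(2)[OF \<phi>, of "l2 b"] by simp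
    have h: "?h (Inl b) = Inr a" "?h (Inr a) = Inl b"
      using eq eq' l1(2)[OF ab(1)] l2(2)[OF ab(2)] by simp_all
    have "v \<noteq> Inl b \<and> v \<noteq> Inr a" if "reaches ?X ?h (Inl b0) v" for v
      using that
    proof induction
      case base
      show ?case using ab(2) b0 by auto
    next
      case (step v)
      thus ?case using h by metis
    qed
    thus False using ro ab by (auto simp: rooted_def)
  qed
  have "inj_on l1 P" "inj_on l2 Q" using l1(2) l2(2) by (metis inj_onI)+
  hence c: "card (l1 ` P) = card P" "card ((\<phi> \<circ> l2) ` Q) = card Q"
    by (simp_all only: card_image comp_inj_on[OF _ permutes_inj_on[OF \<phi>]])
  have "card (l1 ` P \<union> (\<phi> \<circ> l2) ` Q) = card P + card Q"
    unfolding c[symmetric]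
  proof (rule card_Un_disjoint)
    show "l1 ` P \<inter> (\<phi> \<circ> l2) ` Q = {}"
    proof (rule ccontr)
      assume "l1 ` P \<inter> (\<phi> \<circ> l2) ` Q \<noteq> {}"
      then obtain a b where "a \<in> P" "b \<in> Q" "l1 a = \<phi> (l2 b)" by auto
      thus False using apart[of a b] by simp
    qed
  qed (use P Q in auto)
  moreover have "card (l1 ` P \<union> (\<phi> \<circ> l2) ` Q) \<le> card N"
    by (rule card_mono[OF fin]) (use l1(1) l2(1) permutes_in_image[OF \<phi>] in auto)
  ultimately show False using gt by linarith
qed

section \<open>Coloured factorisations of the long cycle\<close>

text \<open>
  The steps of the walk: \<open>Inl e\<close> leaves a colour of \<open>g\<close> and \<open>Inr e\<close> a colour of \<open>f\<close>. The reverse of the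
  step \<open>Inl e\<close> is \<open>Inr (\<phi> e)\<close>.
\<close>

definition step_src :: "('e \<Rightarrow> 'q) \<Rightarrow> ('e \<Rightarrow> 'p) \<Rightarrow> 'e + 'e \<Rightarrow> 'q + 'p" where
  "step_src o2 o1 = map_sum o2 o1"

text \<open>A step ends where its reverse step starts.\<close>

definition step_tgt :: "('e \<Rightarrow> 'q) \<Rightarrow> ('e \<Rightarrow> 'p) \<Rightarrow> ('e \<Rightarrow> 'e) \<Rightarrow> 'e + 'e \<Rightarrow> 'q + 'p" where
  "step_tgt o2 o1 \<phi> = case_sum (Inr \<circ> o1 \<circ> \<phi>) (Inl \<circ> o2 \<circ> inv \<phi>)"

lemma deg_comp_permutes:
  assumes "\<phi> permutes N"
  shows "deg (s \<circ> \<phi>) N u = deg s N u"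
proof -
  have "bij_betw \<phi> {e \<in> N. (s \<circ> \<phi>) e = u} {e \<in> N. s e = u}"
  proof (rule bij_betw_subset[OF permutes_imp_bij[OF assms]])
    show "\<phi> ` {e \<in> N. (s \<circ> \<phi>) e = u} = {e \<in> N. s e = u}"
    proof
      show "\<phi> ` {e \<in> N. (s \<circ> \<phi>) e = u} \<subseteq> {e \<in> N. s e = u}"
        using permutes_in_image[OF assms] by auto
      show "{e \<in> N. s e = u} \<subseteq> \<phi> ` {e \<in> N. (s \<circ> \<phi>) e = u}"
      proof
        fix e assume "e \<in> {e \<in> N. s e = u}"
        hence "inv \<phi> e \<in> {e \<in> N. (s \<circ> \<phi>) e = u}"
          using permutes_in_image[OF permutes_inv[OF assms]] permutes_inverses[OF assms] by auto
        thus "e \<in> \<phi> ` {e \<in> N. (s \<circ> \<phi>) e = u}"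
          using permutes_inverses(1)[OF assms, of e] by (metis imageI)
      qed
    qed
  qed auto
  thus ?thesis unfolding deg_def by (rule bij_betw_same_card)
qed

lemma deg_case_sum:
  assumes "finite N"
  shows "deg (case_sum (Inl \<circ> s) (Inr \<circ> t)) (N <+> N) (Inl b) = deg s N b"
    and "deg (case_sum (Inl \<circ> s) (Inr \<circ> t)) (N <+> N) (Inr a) = deg t N a"
    and "deg (case_sum (Inr \<circ> t) (Inl \<circ> s)) (N <+> N) (Inl b) = deg s N b"
    and "deg (case_sum (Inr \<circ> t) (Inl \<circ> s)) (N <+> N) (Inr a) = deg t N a"
proof -
  have i: "card (Inl ` X) = card X" "card (Inr ` X) = card X" for X :: "'c set"
    by (simp_all add: card_image)
  have 1: "{e \<in> N <+> N. case_sum (Inl \<circ> s) (Inr \<circ> t) e = Inl b} = Inl ` {e \<in> N. s e = b}"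
    "{e \<in> N <+> N. case_sum (Inl \<circ> s) (Inr \<circ> t) e = Inr a} = Inr ` {e \<in> N. t e = a}"
    "{e \<in> N <+> N. case_sum (Inr \<circ> t) (Inl \<circ> s) e = Inl b} = Inr ` {e \<in> N. s e = b}"
    "{e \<in> N <+> N. case_sum (Inr \<circ> t) (Inl \<circ> s) e = Inr a} = Inl ` {e \<in> N. t e = a}"
    by auto
  show "deg (case_sum (Inl \<circ> s) (Inr \<circ> t)) (N <+> N) (Inl b) = deg s N b"
    "deg (case_sum (Inl \<circ> s) (Inr \<circ> t)) (N <+> N) (Inr a) = deg t N a"
    "deg (case_sum (Inr \<circ> t) (Inl \<circ> s)) (N <+> N) (Inl b) = deg s N b"
    "deg (case_sum (Inr \<circ> t) (Inl \<circ> s)) (N <+> N) (Inr a) = deg t N a"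
    unfolding deg_def 1 by (simp_all add: card_image)
qed

lemma step_src_case_sum: "step_src o2 o1 = case_sum (Inl \<circ> o2) (Inr \<circ> o1)"
  by (rule ext) (auto simp: step_src_def split: sum.split)

text \<open>Every \<open>\<phi>\<close> gives a balanced digraph, and the out-degrees are the class
  sizes of \<open>o2\<close> and \<open>o1\<close> whatever \<open>\<phi>\<close> is. So the
  factorials in the BEST theorem are common to all \<open>\<phi>\<close>, and only the exit trees
  vary.\<close>

lemma deg_step:
  assumes "finite N" "\<phi> permutes N"
  shows "deg (step_src o2 o1) (N <+> N) (Inl b) = deg o2 N b"
    and "deg (step_src o2 o1) (N <+> N) (Inr a) = deg o1 N a"
    and "deg (step_tgt o2 o1 \<phi>) (N <+> N) u = deg (step_src o2 o1) (N <+> N) u"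
proof -
  show 1: "deg (step_src o2 o1) (N <+> N) (Inl b) = deg o2 N b" for b
    unfolding step_src_case_sum by (rule deg_case_sum(1)[OF assms(1)])
  show 2: "deg (step_src o2 o1) (N <+> N) (Inr a) = deg o1 N a" for a
    unfolding step_src_case_sum by (rule deg_case_sum(2)[OF assms(1)])
  have 3: "step_tgt o2 o1 \<phi> = case_sum (Inr \<circ> (o1 \<circ> \<phi>)) (Inl \<circ> (o2 \<circ> inv \<phi>))"
    by (simp add: step_tgt_def o_assoc)
  show "deg (step_tgt o2 o1 \<phi>) (N <+> N) u = deg (step_src o2 o1) (N <+> N) u"
  proof (cases u)
    case (Inl b)
    show ?thesis unfolding 3 Inl 1 deg_case_sum(3)[OF assms(1)]
      by (rule deg_comp_permutes[OF permutes_inv[OF assms(2)]])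
  next
    case (Inr a)
    show ?thesis unfolding 3 Inr 2 deg_case_sum(4)[OF assms(1)]
      by (rule deg_comp_permutes[OF assms(2)])
  qed
qed

text \<open>The BEST theorem gives a sum over \<open>\<phi>\<close> and over choices
  \<open>L\<close> of last exits. After exchanging the two sums, the number of \<open>\<phi>\<close>
  for which \<open>L\<close> is a tree is the same for every \<open>L\<close>, so that the choices
  of \<open>L\<close> only contribute their number. The colour \<open>r\<close> is the dummy root of
  \<open>rooted_bipartite\<close>.\<close>

lemma sum_card_trails:
  fixes o1 :: "'e \<Rightarrow> 'p" and o2 :: "'e \<Rightarrow> 'q"
  assumes fin: "finite N" and b0: "b0 \<in> o2 ` N" and r: "r \<notin> o1 ` N"
  defines "p \<equiv> card (o1 ` N)" and "q \<equiv> card (o2 ` N)" and "n \<equiv> card N"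
  defines "tot \<equiv> (\<Sum>\<phi> | \<phi> permutes N.
    card (trails (step_src o2 o1) (step_tgt o2 o1 \<phi>) (Inl b0) (Inl b0) (N <+> N)))"
  shows "p + q \<le> n + 1 \<Longrightarrow> tot * fact (n + 1 - p - q) =
      (\<Prod>a\<in>o1 ` N. fact (deg o1 N a)) * (\<Prod>b\<in>o2 ` N. fact (deg o2 N b)) *
        (deg o2 N b0 * fact (n - p) * fact (n - q))"
    and "p + q > n + 1 \<Longrightarrow> tot = 0"
proof -
  define E where "E = N <+> N"
  define P where "P = o1 ` N"
  define Q where "Q = o2 ` N - {b0}"
  define X where "X = Inl ` Q \<union> Inr ` P"
  define src where "src = step_src o2 o1"
  define tgt where "tgt = step_tgt o2 o1"
  define Ls where "Ls = (\<Pi>\<^sub>E u\<in>X. {e \<in> E. src e = u})"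
  define K :: nat where "K = (\<Prod>u\<in>X. fact (deg src E u - 1)) * fact (deg o2 N b0)"
  have finE: "finite E" using fin by (simp add: E_def)
  have finPQ: "finite P" "finite Q" using fin by (simp_all add: P_def Q_def)
  hence finX: "finite X" by (simp add: X_def)
  have cQ: "q = Suc (card Q)"
    unfolding q_def Q_def using fin b0 by (metis card_Suc_Diff1 finite_imageI)
  have srcE: "src ` E - {Inl b0} = X"
  proof -
    have "src ` E = Inl ` (o2 ` N) \<union> Inr ` (o1 ` N)"
      unfolding src_def step_src_case_sum E_def Plus_def by (simp add: image_Un image_image)
    thus ?thesis by (auto simp: X_def Q_def P_def)
  qed
  have finLs: "finite Ls" unfolding Ls_def by (rule finite_PiE[OF finX]) (use finE in simp)
  have finPerm: "finite {\<phi>. \<phi> permutes N}" using fin by (rule finite_permutations)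
  have tr: "card (trails src (tgt \<phi>) (Inl b0) (Inl b0) E) =
      card {L \<in> Ls. rooted X (tgt \<phi> \<circ> L) (Inl b0)} * K" if "\<phi> permutes N" for \<phi>
  proof -
    have "deg src E u + of_bool (u = Inl b0) = deg (tgt \<phi>) E u + of_bool (u = Inl b0)" for u
      unfolding src_def tgt_def E_def deg_step(3)[OF fin that] by simp
    hence "card (trails src (tgt \<phi>) (Inl b0) (Inl b0) E) = card (exit_trees src (tgt \<phi>) (Inl b0) E) *
     (\<Prod>u\<in>src ` E - {Inl b0}. fact (deg src E u - 1)) * fact (deg src E (Inl b0))"
      by (rule card_trails[OF finE])
    moreover have "deg src E (Inl b0) = deg o2 N b0"
      unfolding src_def E_def by (rule deg_step(1)[OF fin that])
    ultimately show ?thesis unfolding exit_trees_def srcE Ls_def K_def by (simp add: mult.assoc)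
  qed
  have "tot = (\<Sum>\<phi> | \<phi> permutes N. card {L \<in> Ls. rooted X (tgt \<phi> \<circ> L) (Inl b0)}) * K"
    unfolding tot_def sum_distrib_right
    by (rule sum.cong) (use tr in \<open>simp_all add: src_def tgt_def E_def\<close>)
  also have "(\<Sum>\<phi> | \<phi> permutes N. card {L \<in> Ls. rooted X (tgt \<phi> \<circ> L) (Inl b0)}) =
    (\<Sum>L\<in>Ls. card {\<phi> \<in> {\<phi>. \<phi> permutes N}. rooted X (tgt \<phi> \<circ> L) (Inl b0)})"
    by (rule sum_multicount_gen[OF finPerm finLs]) simp
  finally have tot: "tot = (\<Sum>L\<in>Ls. card {\<phi> \<in> {\<phi>. \<phi> permutes N}. rooted X (tgt \<phi> \<circ> L) (Inl b0)}) * K" .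
  define l1 where "l1 L a = projr (L (Inr a))" for L :: "'q + 'p \<Rightarrow> 'e + 'e" and a
  define l2 where "l2 L b = projl (L (Inl b))" for L :: "'q + 'p \<Rightarrow> 'e + 'e" and b
  have LInr: "L (Inr a) = Inr (l1 L a) \<and> l1 L a \<in> N \<and> o1 (l1 L a) = a" if "L \<in> Ls" "a \<in> P" for L a
  proof -
    have "L (Inr a) \<in> {e \<in> E. src e = Inr a}" using that by (auto simp: Ls_def X_def)
    thus ?thesis by (auto simp: l1_def E_def src_def step_src_def)
  qed
  have LInl: "L (Inl b) = Inl (l2 L b) \<and> l2 L b \<in> N \<and> o2 (l2 L b) = b" if "L \<in> Ls" "b \<in> Q" for L b
  proof -
    have "L (Inl b) \<in> {e \<in> E. src e = Inl b}" using that by (auto simp: Ls_def X_def)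
    thus ?thesis by (auto simp: l2_def E_def src_def step_src_def)
  qed
  have roo: "rooted X (tgt \<phi> \<circ> L) (Inl b0) \<longleftrightarrow>
      rooted (Inl ` Q \<union> Inr ` P)
           (case_sum (Inr \<circ> (o1 \<circ> \<phi> \<circ> l2 L)) (Inl \<circ> (o2 \<circ> inv \<phi> \<circ> l1 L))) (Inl b0)" if L: "L \<in> Ls" for L \<phi>
    unfolding X_def
  proof (rule rooted_cong)
    fix u :: "'q + 'p" assume "u \<in> Inl ` Q \<union> Inr ` P"
    thus "(tgt \<phi> \<circ> L) u = case_sum (Inr \<circ> (o1 \<circ> \<phi> \<circ> l2 L)) (Inl \<circ> (o2 \<circ> inv \<phi> \<circ> l1 L)) u"
      using LInl[OF L] LInr[OF L] by (auto simp: tgt_def step_tgt_def)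
  qed
  {
    assume le: "p + q \<le> n + 1"
    \<comment> \<open>The root \<open>b0\<close> is counted by \<open>q\<close> but does not belong
      to \<open>Q\<close>, which accounts for the 1 in \<open>n + 1\<close>.\<close>
    have le': "card P + card Q \<le> card N" using le cQ by (simp add: p_def n_def P_def)
    have "card {\<phi> \<in> {\<phi>. \<phi> permutes N}. rooted X (tgt \<phi> \<circ> L) (Inl b0)} * fact (n + 1 - p - q) =
       deg o2 N b0 * fact (n - p) * fact (n - q)" if L: "L \<in> Ls" for L
    proof -
      have "card {\<phi>. \<phi> permutes N \<and> rooted (Inl ` Q \<union> Inr ` P)
           (case_sum (Inr \<circ> (o1 \<circ> \<phi> \<circ> l2 L)) (Inl \<circ> (o2 \<circ> inv \<phi> \<circ> l1 L))) (Inl b0)} * fact (card N - card P - card Q) =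
         card {e \<in> N. o2 e = b0} * fact (card N - card P) * fact (card N - card Q - 1)"
      proof (rule card_permutes_rooted[OF fin finPQ(2,1), where r = r])
        show "P \<noteq> {}" using b0 by (auto simp: P_def)
        show "b0 \<notin> Q" by (simp add: Q_def)
        show "r \<notin> P" using r by (simp add: P_def)
        show "card P + card Q \<le> card N" by (rule le')
      qed (use LInl[OF L] LInr[OF L] in \<open>auto simp: P_def Q_def\<close>)
      moreover have "n + 1 - p - q = card N - card P - card Q" "n - q = card N - card Q - 1"
        using cQ by (simp_all add: n_def p_def P_def)
      ultimately show ?thesis unfolding roo[OF L] deg_def by (simp add: n_def p_def P_def)
    qed
    hence "tot * fact (n + 1 - p - q) = card Ls * (deg o2 N b0 * fact (n - p) * fact (n - q)) * K"
    proof -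
      assume *: "\<And>L. L \<in> Ls \<Longrightarrow> card {\<phi> \<in> {\<phi>. \<phi> permutes N}. rooted X (tgt \<phi> \<circ> L) (Inl b0)} *
        fact (n + 1 - p - q) = deg o2 N b0 * fact (n - p) * fact (n - q)"
      have "(\<Sum>L\<in>Ls. card {\<phi> \<in> {\<phi>. \<phi> permutes N}. rooted X (tgt \<phi> \<circ> L) (Inl b0)}) * fact (n + 1 - p - q) =
          card Ls * (deg o2 N b0 * fact (n - p) * fact (n - q))"
        unfolding sum_distrib_right using * by (simp only: sum_constant of_nat_id cong: sum.cong)
      moreover have "a * b = c \<Longrightarrow> a * k * b = c * k" for a b c k :: nat
        by (simp add: mult_ac)
      ultimately show ?thesis unfolding tot by blast
    qed
    also have "card Ls = (\<Prod>u\<in>X. deg src E u)"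
      unfolding Ls_def deg_def by (rule card_PiE[OF finX])
    also have "(\<Prod>u\<in>X. deg src E u) * (deg o2 N b0 * fact (n - p) * fact (n - q)) * K =
      ((\<Prod>u\<in>X. deg src E u) * (\<Prod>u\<in>X. fact (deg src E u - 1))) * fact (deg o2 N b0) * (deg o2 N b0 * fact (n - p) * fact (n - q))"
      by (simp add: K_def mult_ac)
    \<comment> \<open>The choice of a last exit at \<open>u\<close> supplies the factor
      \<open>deg src E u\<close> missing from the factorial of the BEST theorem.\<close>
    also have "(\<Prod>u\<in>X. deg src E u) * (\<Prod>u\<in>X. fact (deg src E u - 1)) = (\<Prod>u\<in>X. fact (deg src E u))"
      unfolding prod.distrib[symmetric]
    proof (rule prod.cong[OF refl])
      fix u assume "u \<in> X"
      hence "u \<in> src ` E" using srcE by blast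
      hence "deg src E u > 0" by (simp only: deg_pos_iff[OF finE])
      from fact_reduce[OF this, where ?'a = nat]
      show "deg src E u * fact (deg src E u - 1) = fact (deg src E u)"
        unfolding of_nat_id by (rule sym)
    qed
    also have "\<dots> = (\<Prod>b\<in>Q. fact (deg src E (Inl b))) * (\<Prod>a\<in>P. fact (deg src E (Inr a)))"
    proof -
      have "(\<Prod>u\<in>X. fact (deg src E u)) = (\<Prod>u\<in>Inl ` Q. fact (deg src E u)) * (\<Prod>u\<in>Inr ` P. fact (deg src E u) :: nat)"
        unfolding X_def by (rule prod.union_disjoint) (use finPQ in auto)
      thus ?thesis by (simp add: prod.reindex)
    qed
    also have "\<dots> = (\<Prod>b\<in>Q. fact (deg o2 N b)) * (\<Prod>a\<in>P. fact (deg o1 N a))"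
      unfolding src_def E_def deg_step(1)[OF fin permutes_id] deg_step(2)[OF fin permutes_id] ..
    also have "(\<Prod>b\<in>Q. fact (deg o2 N b)) * (\<Prod>a\<in>P. fact (deg o1 N a)) * fact (deg o2 N b0) =
      (\<Prod>a\<in>P. fact (deg o1 N a)) * (\<Prod>b\<in>o2 ` N. fact (deg o2 N b) :: nat)"
      using prod.remove[of "o2 ` N" b0 "\<lambda>b. fact (deg o2 N b) :: nat"] fin b0
      by (simp add: Q_def)
    finally show "tot * fact (n + 1 - p - q) =
      (\<Prod>a\<in>o1 ` N. fact (deg o1 N a)) * (\<Prod>b\<in>o2 ` N. fact (deg o2 N b)) *
        (deg o2 N b0 * fact (n - p) * fact (n - q))"
      by (simp add: P_def)
  next
    assume gt: "p + q > n + 1"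
    have gt': "card P + card Q > card N" using gt cQ by (simp add: p_def n_def P_def)
    have "{\<phi> \<in> {\<phi>. \<phi> permutes N}. rooted X (tgt \<phi> \<circ> L) (Inl b0)} = {}" if L: "L \<in> Ls" for L
    proof -
      have "\<not> rooted X (tgt \<phi> \<circ> L) (Inl b0)" if "\<phi> permutes N" for \<phi>
        unfolding roo[OF L]
        by (rule not_rooted_if_card_gt[OF fin finPQ(2,1) _ _ _ _ _ gt' that])
          (use LInl[OF L] LInr[OF L] in \<open>auto simp: Q_def\<close>)
      thus ?thesis by blast
    qed
    hence "(\<Sum>L\<in>Ls. card {\<phi> \<in> {\<phi>. \<phi> permutes N}. rooted X (tgt \<phi> \<circ> L) (Inl b0)}) = 0"
      by (simp only: card.empty sum.neutral_const cong: sum.cong)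
    thus "tot = 0" unfolding tot by simp
  }
qed

section \<open>Labellings of a colouring by the points of another one with the same class
  sizes\<close>

text \<open>Each class of \<open>f\<close> is matched in an arbitrary order with the class of
  \<open>ob\<close> of the same colour and size. Injections into a separate set \<open>R\<close> are
  counted because the induction removes a point from \<open>S\<close> and its label, which may be a
  different element, from \<open>R\<close>.\<close>

lemma card_labellings:
  assumes "finite S" "finite R" "finite A" "f ` S \<subseteq> A" "\<And>a. deg f S a = deg ob R a"
  shows "card {\<theta> \<in> S \<rightarrow>\<^sub>E R. inj_on \<theta> S \<and> (\<forall>i\<in>S. ob (\<theta> i) = f i)} = (\<Prod>a\<in>A. fact (deg f S a))"
  using assms
proof (induction S arbitrary: R rule: finite_induct)
  case empty
  have "{\<theta> \<in> {} \<rightarrow>\<^sub>E R. inj_on \<theta> {} \<and> (\<forall>i\<in>{}. ob (\<theta> i) = f i)} = {\<lambda>_. undefined}" by auto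
  thus ?case by (simp add: deg_def)
next
  case (insert x S)
  note fR = insert.prems(1) and fA = insert.prems(2) and fSA = insert.prems(3) and dg = insert.prems(4)
  define B where "B y = {\<theta> \<in> S \<rightarrow>\<^sub>E R - {y}. inj_on \<theta> S \<and> (\<forall>i\<in>S. ob (\<theta> i) = f i)}" for y
  have dS: "deg f (insert x S) a = deg f S a + of_bool (a = f x)" for a
    using deg_remove[of "insert x S" x f a] insert.hyps by simp
  have cB: "card (B y) = (\<Prod>a\<in>A. fact (deg f S a))" if y: "y \<in> R" "ob y = f x" for y
    unfolding B_def
  proof (rule insert.IH)
    show "deg f S a = deg ob (R - {y}) a" for a
      using dg[of a] dS[of a] deg_remove[OF fR y(1), of ob a] y(2) by simp
  qed (use fR fA fSA in auto)
  have "card {\<theta> \<in> insert x S \<rightarrow>\<^sub>E R. inj_on \<theta> (insert x S) \<and> (\<forall>i\<in>insert x S. ob (\<theta> i) = f i)} =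
      (\<Sum>y\<in>R. card {g \<in> S \<rightarrow>\<^sub>E R. inj_on (g(x := y)) (insert x S) \<and> (\<forall>i\<in>insert x S. ob ((g(x := y)) i) = f i)})"
    by (rule card_PiE_insert_split[where x = x and A = S and B = "\<lambda>_. R" and
        P = "\<lambda>\<theta>. inj_on \<theta> (insert x S) \<and> (\<forall>i\<in>insert x S. ob (\<theta> i) = f i)"])
      (use insert.hyps fR in auto)
  also have "\<dots> = (\<Sum>y\<in>R. if ob y = f x then card (B y) else 0)"
  proof (rule sum.cong[OF refl])
    fix y assume "y \<in> R"
    have "inj_on (g(x := y)) (insert x S) \<longleftrightarrow> inj_on g S \<and> y \<notin> g ` S" for g
    proof -
      have "inj_on (g(x := y)) S \<longleftrightarrow> inj_on g S"
        by (rule inj_on_cong) (use \<open>x \<notin> S\<close> in auto)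
      moreover have "(g(x := y)) ` (S - {x}) = g ` S" using \<open>x \<notin> S\<close> by auto
      ultimately show ?thesis unfolding inj_on_insert by simp
    qed
    moreover have "(\<forall>i\<in>insert x S. ob ((g(x := y)) i) = f i) \<longleftrightarrow> ob y = f x \<and> (\<forall>i\<in>S. ob (g i) = f i)" for g
      using \<open>x \<notin> S\<close> by auto
    ultimately have "{g \<in> S \<rightarrow>\<^sub>E R. inj_on (g(x := y)) (insert x S) \<and> (\<forall>i\<in>insert x S. ob ((g(x := y)) i) = f i)} =
      (if ob y = f x then B y else {})"
      by (auto simp: B_def PiE_iff)
    thus "card {g \<in> S \<rightarrow>\<^sub>E R. inj_on (g(x := y)) (insert x S) \<and> (\<forall>i\<in>insert x S. ob ((g(x := y)) i) = f i)} =
      (if ob y = f x then card (B y) else 0)" by simp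
  qed
  also have "\<dots> = (\<Sum>y\<in>{y \<in> R. ob y = f x}. card (B y))"
    by (rule sum.inter_filter[OF fR, symmetric])
  also have "\<dots> = deg ob R (f x) * (\<Prod>a\<in>A. fact (deg f S a))"
    using cB by (simp add: deg_def)
  also have "\<dots> = (\<Prod>a\<in>A. fact (deg f (insert x S) a))"
  proof -
    have fx: "f x \<in> A" using fSA by auto
    have "(\<Prod>a\<in>A - {f x}. fact (deg f (insert x S) a)) = (\<Prod>a\<in>A - {f x}. fact (deg f S a) :: nat)"
      by (rule prod.cong) (use dS in auto)
    moreover have "deg ob R (f x) = Suc (deg f S (f x))" using dg[of "f x"] dS[of "f x"] by simp
    ultimately show ?thesis
      unfolding prod.remove[OF fA fx] dS[of "f x"] by (simp add: algebra_simps)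
  qed
  finally show ?case .
qed

lemma card_permutes_labellings:
  assumes "finite N" "finite A" "f ` N \<subseteq> A" "\<And>a. deg f N a = deg ob N a"
  shows "card {\<theta>. \<theta> permutes N \<and> (\<forall>i\<in>N. ob (\<theta> i) = f i)} = (\<Prod>a\<in>A. fact (deg f N a))"
proof -
  have "bij_betw (\<lambda>\<theta>. restrict \<theta> N) {\<theta>. \<theta> permutes N \<and> (\<forall>i\<in>N. ob (\<theta> i) = f i)}
      {\<theta> \<in> N \<rightarrow>\<^sub>E N. inj_on \<theta> N \<and> (\<forall>i\<in>N. ob (\<theta> i) = f i)}"
  proof (rule bij_betw_byWitness[where f' = "\<lambda>\<theta> x. if x \<in> N then \<theta> x else x"])
    show "\<forall>\<theta>\<in>{\<theta>. \<theta> permutes N \<and> (\<forall>i\<in>N. ob (\<theta> i) = f i)}. (\<lambda>x. if x \<in> N then restrict \<theta> N x else x) = \<theta>"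
      by (auto simp: permutes_def fun_eq_iff)
    show "\<forall>\<theta>\<in>{\<theta> \<in> N \<rightarrow>\<^sub>E N. inj_on \<theta> N \<and> (\<forall>i\<in>N. ob (\<theta> i) = f i)}.
        (\<lambda>x\<in>N. if x \<in> N then \<theta> x else x) = \<theta>"
      by (auto simp: fun_eq_iff PiE_def extensional_def)
    show "(\<lambda>\<theta>. restrict \<theta> N) ` {\<theta>. \<theta> permutes N \<and> (\<forall>i\<in>N. ob (\<theta> i) = f i)}
        \<subseteq> {\<theta> \<in> N \<rightarrow>\<^sub>E N. inj_on \<theta> N \<and> (\<forall>i\<in>N. ob (\<theta> i) = f i)}"
    proof (rule image_subsetI)
      fix \<theta> assume "\<theta> \<in> {\<theta>. \<theta> permutes N \<and> (\<forall>i\<in>N. ob (\<theta> i) = f i)}"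
      hence \<theta>: "\<theta> permutes N" "\<And>i. i \<in> N \<Longrightarrow> ob (\<theta> i) = f i" by auto
      show "restrict \<theta> N \<in> {\<theta> \<in> N \<rightarrow>\<^sub>E N. inj_on \<theta> N \<and> (\<forall>i\<in>N. ob (\<theta> i) = f i)}"
        using \<theta>(2) permutes_in_image[OF \<theta>(1)] permutes_inj_on[OF \<theta>(1), of N] by (auto simp: inj_on_def)
    qed
    show "(\<lambda>\<theta> x. if x \<in> N then \<theta> x else x) ` {\<theta> \<in> N \<rightarrow>\<^sub>E N. inj_on \<theta> N \<and> (\<forall>i\<in>N. ob (\<theta> i) = f i)}
        \<subseteq> {\<theta>. \<theta> permutes N \<and> (\<forall>i\<in>N. ob (\<theta> i) = f i)}"
    proof (rule image_subsetI)
      fix \<theta> assume "\<theta> \<in> {\<theta> \<in> N \<rightarrow>\<^sub>E N. inj_on \<theta> N \<and> (\<forall>i\<in>N. ob (\<theta> i) = f i)}"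
      hence \<theta>: "\<theta> ` N \<subseteq> N" "inj_on \<theta> N" "\<And>i. i \<in> N \<Longrightarrow> ob (\<theta> i) = f i" by auto
      have b: "bij_betw \<theta> N N"
        using \<theta> endo_inj_surj[OF assms(1)] by (auto simp: bij_betw_def)
      have "bij_betw (\<lambda>x. if x \<in> N then \<theta> x else x) N N"
        by (rule bij_betw_cong[THEN iffD2, OF _ b]) simp
      hence "(\<lambda>x. if x \<in> N then \<theta> x else x) permutes N"
        by (rule bij_imp_permutes) simp
      thus "(\<lambda>x. if x \<in> N then \<theta> x else x) \<in> {\<theta>. \<theta> permutes N \<and> (\<forall>i\<in>N. ob (\<theta> i) = f i)}"
        using \<theta>(3) by simp
    qed
  qed
  hence "card {\<theta>. \<theta> permutes N \<and> (\<forall>i\<in>N. ob (\<theta> i) = f i)} =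
     card {\<theta> \<in> N \<rightarrow>\<^sub>E N. inj_on \<theta> N \<and> (\<forall>i\<in>N. ob (\<theta> i) = f i)}" by (rule bij_betw_same_card)
  also have "\<dots> = (\<Prod>a\<in>A. fact (deg f N a))"
    by (rule card_labellings[OF assms(1,1,2,3,4)])
  finally show ?thesis .
qed

section \<open>Closed trails as pairs of permutations\<close>

text \<open>A trail that starts and ends at a colour of \<open>g\<close> uses steps
  \<open>Inl\<close> and \<open>Inr\<close> alternately, so it is a list of pairs: one step from
  \<open>g\<close> to \<open>f\<close> and the following one back.\<close>

fun weave :: "('e \<times> 'e) list \<Rightarrow> ('e + 'e) list" where
  "weave [] = []"
| "weave ((x, y) # zs) = Inl x # Inr y # weave zs"

lemma weave_inj: "weave zs = weave zs' \<Longrightarrow> zs = zs'"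
proof (induction zs arbitrary: zs' rule: weave.induct)
  case 1
  thus ?case by (cases zs' rule: weave.cases) auto
next
  case (2 x y zs)
  thus ?case by (cases zs' rule: weave.cases) auto
qed

lemma set_weave: "set (weave zs) = set (map fst zs) <+> set (map snd zs)"
  by (induction zs rule: weave.induct) auto

lemma distinct_weave: "distinct (weave zs) \<longleftrightarrow> distinct (map fst zs) \<and> distinct (map snd zs)"
  by (induction zs rule: weave.induct) (auto simp: set_weave)

lemma Plus_eq_iff: "A <+> B = C <+> D \<longleftrightarrow> A = C \<and> B = D"
  by (auto simp: Plus_def set_eq_iff image_iff)

fun pair_walk :: "('e \<Rightarrow> 'q) \<Rightarrow> ('e \<Rightarrow> 'p) \<Rightarrow> ('e \<Rightarrow> 'e) \<Rightarrow> 'q \<Rightarrow> ('e \<times> 'e) list \<Rightarrow> 'q \<Rightarrow> bool" where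
  "pair_walk o2 o1 \<phi> b [] b' \<longleftrightarrow> b' = b"
| "pair_walk o2 o1 \<phi> b ((x, y) # zs) b' \<longleftrightarrow>
     o2 x = b \<and> o1 (\<phi> x) = o1 y \<and> pair_walk o2 o1 \<phi> (o2 (inv \<phi> y)) zs b'"

lemma walk_weave:
  "walk (step_src o2 o1) (step_tgt o2 o1 \<phi>) (Inl b) (weave zs) (Inl b') \<longleftrightarrow> pair_walk o2 o1 \<phi> b zs b'"
  by (induction o2 o1 \<phi> b zs b' rule: pair_walk.induct) (auto simp: step_src_def step_tgt_def)

text \<open>Every step changes sides, so a walk between two left vertices has even length and
  alternates.\<close>

lemma walk_imp_weave:
  "walk (step_src o2 o1) (step_tgt o2 o1 \<phi>) (Inl b) xs (Inl b') \<Longrightarrow> \<exists>zs. xs = weave zs"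
proof (induction xs arbitrary: b rule: induct_list012)
  case 1
  have "[] = weave []" by simp
  thus ?case by blast
next
  case (2 x)
  thus ?case by (cases x) (auto simp: step_src_def step_tgt_def)
next
  case (3 x y xs)
  then obtain e e' where e: "x = Inl e" "y = Inr e'"
    by (cases x; cases y) (auto simp: step_src_def step_tgt_def)
  hence "walk (step_src o2 o1) (step_tgt o2 o1 \<phi>) (Inl (o2 (inv \<phi> e'))) xs (Inl b')"
    using 3 by (simp add: step_src_def step_tgt_def)
  then obtain zs where "xs = weave zs" using 3 by blast
  hence "x # y # xs = weave ((e, e') # zs)" using e by simp
  thus ?case by blast
qed

lemma pair_walk_nth:
  assumes "zs \<noteq> []"
  shows "pair_walk o2 o1 \<phi> b zs b' \<longleftrightarrow> o2 (fst (zs ! 0)) = b \<and>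
    (\<forall>i<length zs. o1 (\<phi> (fst (zs ! i))) = o1 (snd (zs ! i))) \<and>
    (\<forall>i. Suc i < length zs \<longrightarrow> o2 (fst (zs ! Suc i)) = o2 (inv \<phi> (snd (zs ! i)))) \<and>
    b' = o2 (inv \<phi> (snd (zs ! (length zs - 1))))"
  using assms
proof (induction zs arbitrary: b rule: list_nonempty_induct)
  case (single z)
  show ?case by (cases z) auto
next
  case (cons z zs)
  obtain x y where z: "z = (x, y)" by (cases z)
  obtain m where m: "length zs = Suc m" using cons.hyps by (cases zs) auto
  show ?case
    unfolding z pair_walk.simps cons.IH
    by (simp add: m All_less_Suc2) (auto simp: nth_Cons' gr0_conv_Suc)
qed

lemma long_cycle_nth:
  assumes "i < n"
  shows "long_cycle n (Suc i) = Suc (Suc i mod n)"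
proof -
  have "map (long_cycle n ^^ 1) [1..<Suc n] = rotate 1 [1..<Suc n]"
    unfolding long_cycle_def by (rule cyclic_rotation) simp
  hence "map (long_cycle n) [1..<Suc n] ! i = rotate1 [1..<Suc n] ! i" by simp
  thus ?thesis using assms by (simp add: nth_rotate1 del: upt_Suc)
qed

lemma long_cycle_permutes: "long_cycle n permutes {1..n}"
proof -
  have "set [1..<Suc n] = {1..n}" by auto
  thus ?thesis unfolding long_cycle_def using cycle_permutes[of "[1..<Suc n]"] by (simp del: upt_Suc set_upt)
qed

lemma permutes_of_list:
  assumes "distinct ys" "set ys = {1..n}"
  defines "\<theta> \<equiv> (\<lambda>i. if i \<in> {1..n} then ys ! (i - 1) else i)"
  shows "\<theta> permutes {1..n}" and "map \<theta> [1..<Suc n] = ys"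
proof -
  have len: "length ys = n" using distinct_card[OF assms(1)] assms(2) by simp
  show m: "map \<theta> [1..<Suc n] = ys"
    by (rule nth_equalityI) (auto simp: len \<theta>_def simp del: upt_Suc)
  have "\<theta> ` {1..n} = {1..n}"
    using arg_cong[OF m, of set] assms(2) by (simp only: set_map set_upt atLeastLessThanSuc_atLeastAtMost)
  moreover have "inj_on \<theta> {1..n}"
    using assms(1) m by (metis distinct_map set_upt atLeastLessThanSuc_atLeastAtMost)
  ultimately show "\<theta> permutes {1..n}"
    by (intro bij_imp_permutes) (auto simp: bij_betw_def \<theta>_def)
qed

text \<open>Let \<open>\<theta>2 i\<close> and \<open>\<theta>1 i\<close> be the labels of the two
  steps made at time \<open>i\<close>. Since \<open>long_cycle n\<close> takes \<open>n\<close> back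
  to 1, the condition that the pairs of steps fit together and the condition that the trail closes
  are one and the same. The sum runs over the starting colours, which are determined by the first
  label.\<close>

lemma card_closed_trails:
  assumes n: "1 \<le> n"
  shows "card {(\<theta>1, \<theta>2). \<theta>1 permutes {1..n} \<and> \<theta>2 permutes {1..n} \<and>
      (\<forall>i\<in>{1..n}. o1 (\<phi> (\<theta>2 i)) = o1 (\<theta>1 i) \<and> o2 (\<theta>2 (long_cycle n i)) = o2 (inv \<phi> (\<theta>1 i)))} =
    (\<Sum>b\<in>o2 ` {1..n}. card (trails (step_src o2 o1) (step_tgt o2 o1 \<phi>) (Inl b) (Inl b) ({1..n} <+> {1..n})))"
    (is "card ?W = _")
proof -
  define T where "T b = trails (step_src o2 o1) (step_tgt o2 o1 \<phi>) (Inl b) (Inl b) ({1..n} <+> {1..n})" for b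
  define G where "G = (\<lambda>(\<theta>1 :: nat \<Rightarrow> nat, \<theta>2 :: nat \<Rightarrow> nat). map (\<lambda>i. (\<theta>2 i, \<theta>1 i)) [1..<Suc n])"
  define good where "good zs \<longleftrightarrow> distinct (map fst zs) \<and> set (map fst zs) = {1..n} \<and>
      distinct (map snd zs) \<and> set (map snd zs) = {1..n} \<and>
      (\<forall>i<n. o1 (\<phi> (fst (zs ! i))) = o1 (snd (zs ! i)) \<and>
         o2 (fst (zs ! (Suc i mod n))) = o2 (inv \<phi> (snd (zs ! i))))" for zs :: "(nat \<times> nat) list"
  have lengood: "length zs = n" if "distinct (map fst zs)" "set (map fst zs) = {1..n}" for zs :: "(nat \<times> nat) list"
    using distinct_card[OF that(1)] that(2) by simp
  have T: "(\<Union>b\<in>o2 ` {1..n}. T b) = weave ` {zs. good zs}"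
  proof -
    have closed: "(\<exists>b\<in>o2 ` {1..n}. pair_walk o2 o1 \<phi> b zs b) \<longleftrightarrow>
        (\<forall>i<n. o1 (\<phi> (fst (zs ! i))) = o1 (snd (zs ! i)) \<and>
         o2 (fst (zs ! (Suc i mod n))) = o2 (inv \<phi> (snd (zs ! i))))"
      if zs: "distinct (map fst zs)" "set (map fst zs) = {1..n}" for zs :: "(nat \<times> nat) list"
    proof -
      have len: "length zs = n" by (rule lengood[OF zs])
      hence ne: "zs \<noteq> []" using n by auto
      have "fst (zs ! 0) \<in> {1..n}" unfolding zs(2)[symmetric] using ne by simp
      hence "(\<exists>b\<in>o2 ` {1..n}. pair_walk o2 o1 \<phi> b zs b) \<longleftrightarrow>
        (\<forall>i<n. o1 (\<phi> (fst (zs ! i))) = o1 (snd (zs ! i))) \<and>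
        (\<forall>i. Suc i < n \<longrightarrow> o2 (fst (zs ! Suc i)) = o2 (inv \<phi> (snd (zs ! i)))) \<and>
        o2 (fst (zs ! 0)) = o2 (inv \<phi> (snd (zs ! (n - 1))))"
        unfolding pair_walk_nth[OF ne] len by auto
      moreover have "(\<forall>i<n. o2 (fst (zs ! (Suc i mod n))) = o2 (inv \<phi> (snd (zs ! i)))) \<longleftrightarrow>
        (\<forall>i. Suc i < n \<longrightarrow> o2 (fst (zs ! Suc i)) = o2 (inv \<phi> (snd (zs ! i)))) \<and>
        o2 (fst (zs ! 0)) = o2 (inv \<phi> (snd (zs ! (n - 1))))"
      proof -
        obtain m where m: "n = Suc m" using n by (cases n) auto
        show ?thesis unfolding m by (simp add: All_less_Suc) blast
      qed
      ultimately show ?thesis by blast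
    qed
    show ?thesis
    proof (intro set_eqI iffI)
      fix xs assume "xs \<in> (\<Union>b\<in>o2 ` {1..n}. T b)"
      then obtain b where b: "b \<in> o2 ` {1..n}" "xs \<in> T b" by blast
      have "walk (step_src o2 o1) (step_tgt o2 o1 \<phi>) (Inl b) xs (Inl b)"
        using b(2) by (simp add: T_def trails_def)
      from walk_imp_weave[OF this] obtain zs where zs: "xs = weave zs" ..
      have d: "distinct (map fst zs)" "distinct (map snd zs)"
        using b(2) by (auto simp: T_def trails_def zs distinct_weave)
      have "set (map fst zs) <+> set (map snd zs) = {1..n} <+> {1..n}"
        using b(2) by (simp only: T_def trails_def zs set_weave mem_Collect_eq)
      hence s: "set (map fst zs) = {1..n}" "set (map snd zs) = {1..n}"
        by (simp_all only: Plus_eq_iff)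
      have "pair_walk o2 o1 \<phi> b zs b" using b(2) by (simp add: T_def trails_def zs walk_weave)
      hence "good zs" using closed[OF d(1) s(1)] b(1) d s unfolding good_def by blast
      thus "xs \<in> weave ` {zs. good zs}" using zs by blast
    next
      fix xs assume "xs \<in> weave ` {zs. good zs}"
      then obtain zs where zs: "xs = weave zs" "good zs" by blast
      then obtain b where b: "b \<in> o2 ` {1..n}" "pair_walk o2 o1 \<phi> b zs b"
        using closed[of zs] unfolding good_def by blast
      hence "xs \<in> T b" using zs unfolding T_def trails_def good_def
        by (simp add: walk_weave distinct_weave set_weave)
      thus "xs \<in> (\<Union>b\<in>o2 ` {1..n}. T b)" using b by blast
    qed
  qed
  have G: "bij_betw G ?W {zs. good zs}"
  proof (rule bij_betw_imageI)
    show "inj_on G ?W"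
    proof (rule inj_onI)
      fix w w' assume "w \<in> ?W" "w' \<in> ?W" and eq: "G w = G w'"
      then obtain a b a' b' where w: "w = (a, b)" "w' = (a', b')"
        and p: "a permutes {1..n}" "b permutes {1..n}" "a' permutes {1..n}" "b' permutes {1..n}" by auto
      have "\<forall>i\<in>{1..n}. b i = b' i \<and> a i = a' i" using eq by (auto simp: G_def w)
      hence "a = a'" "b = b'" using p unfolding permutes_def by (metis ext)+
      thus "w = w'" using w by simp
    qed
    have goodG: "good (map (\<lambda>i. (\<theta>2 i, \<theta>1 i)) [1..<Suc n]) \<longleftrightarrow> (\<theta>1, \<theta>2) \<in> ?W"
      if p: "\<theta>1 permutes {1..n}" "\<theta>2 permutes {1..n}" for \<theta>1 \<theta>2
    proof -
      have s: "set [1..<Suc n] = {1..n}" by auto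
      have 1: "map fst (map (\<lambda>i. (\<theta>2 i, \<theta>1 i)) [1..<Suc n]) = map \<theta>2 [1..<Suc n]"
        "map snd (map (\<lambda>i. (\<theta>2 i, \<theta>1 i)) [1..<Suc n]) = map \<theta>1 [1..<Suc n]" by simp_all
      have 2: "distinct (map \<theta> [1..<Suc n]) \<and> set (map \<theta> [1..<Suc n]) = {1..n}" if "\<theta> permutes {1..n}" for \<theta>
        unfolding distinct_map set_map s using permutes_inj_on[OF that] permutes_image[OF that] by simp
      have 3: "(\<forall>i<n. A (Suc i)) \<longleftrightarrow> (\<forall>i\<in>{1..n}. A i)" for A
        by (auto simp: Ball_def) (metis Suc_le_eq Suc_pred less_eq_Suc_le)
      have 4: "map (\<lambda>i. (\<theta>2 i, \<theta>1 i)) [1..<Suc n] ! i = (\<theta>2 (Suc i), \<theta>1 (Suc i))" if "i < n" for i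
        using that by (simp del: upt_Suc)
      have 5: "Suc i mod n < n" for i using n by simp
      have "good (map (\<lambda>i. (\<theta>2 i, \<theta>1 i)) [1..<Suc n]) \<longleftrightarrow>
        (\<forall>i<n. o1 (\<phi> (\<theta>2 (Suc i))) = o1 (\<theta>1 (Suc i)) \<and>
         o2 (\<theta>2 (long_cycle n (Suc i))) = o2 (inv \<phi> (\<theta>1 (Suc i))))"
        unfolding good_def 1 using 2[OF p(1)] 2[OF p(2)] 4 5 by (simp add: long_cycle_nth del: upt_Suc)
      also have "\<dots> \<longleftrightarrow> (\<forall>i\<in>{1..n}. o1 (\<phi> (\<theta>2 i)) = o1 (\<theta>1 i) \<and>
         o2 (\<theta>2 (long_cycle n i)) = o2 (inv \<phi> (\<theta>1 i)))" by (rule 3)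
      also have "\<dots> \<longleftrightarrow> (\<theta>1, \<theta>2) \<in> ?W"
        using p by simp
      finally show ?thesis .
    qed
    show "G ` ?W = {zs. good zs}"
    proof (intro set_eqI iffI)
      fix zs assume "zs \<in> G ` ?W"
      then obtain a b where "(a, b) \<in> ?W" "zs = G (a, b)" by blast
      thus "zs \<in> {zs. good zs}" using goodG[of a b] by (auto simp: G_def simp del: upt_Suc)
    next
      fix zs assume "zs \<in> {zs. good zs}"
      hence zs: "good zs" by simp
      define a where "a = (\<lambda>i. if i \<in> {1..n} then map snd zs ! (i - 1) else i)"
      define b where "b = (\<lambda>i. if i \<in> {1..n} then map fst zs ! (i - 1) else i)"
      have a: "a permutes {1..n}" "map a [1..<Suc n] = map snd zs"
        unfolding a_def by (rule permutes_of_list; use zs good_def in blast)+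
      have b: "b permutes {1..n}" "map b [1..<Suc n] = map fst zs"
        unfolding b_def by (rule permutes_of_list; use zs good_def in blast)+
      have "map (\<lambda>i. (b i, a i)) [1..<Suc n] = zip (map b [1..<Suc n]) (map a [1..<Suc n])"
        by (simp add: zip_map_map map2_map_map zip_same_conv_map del: upt_Suc)
      also have "\<dots> = zs" unfolding a b by (rule zip_map_fst_snd)
      finally have eq: "map (\<lambda>i. (b i, a i)) [1..<Suc n] = zs" .
      hence "(a, b) \<in> ?W" using goodG[OF a(1) b(1)] zs by (simp only:)
      moreover have "zs = G (a, b)" using eq by (simp add: G_def)
      ultimately show "zs \<in> G ` ?W" by blast
    qed
  qed
  have "card ?W = card {zs. good zs}" using G by (rule bij_betw_same_card)
  also have "\<dots> = card (weave ` {zs. good zs})"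
    by (rule card_image[symmetric]) (auto intro: inj_onI weave_inj)
  also have "\<dots> = card (\<Union>b\<in>o2 ` {1..n}. T b)" by (simp only: T)
  also have "\<dots> = (\<Sum>b\<in>o2 ` {1..n}. card (T b))"
  proof (rule card_UN_disjoint)
    show "\<forall>b\<in>o2 ` {1..n}. finite (T b)" by (simp add: T_def)
    show "\<forall>b\<in>o2 ` {1..n}. \<forall>b'\<in>o2 ` {1..n}. b \<noteq> b' \<longrightarrow> T b \<inter> T b' = {}"
    proof (intro ballI impI equals0I)
      fix b b' xs assume bb: "b \<noteq> b'" "xs \<in> T b \<inter> T b'"
      have "{1..n} <+> {1..n} \<noteq> {}" using n by auto
      hence "xs \<noteq> []" using bb(2) by (auto simp: T_def trails_def)
      thus False using bb by (cases xs) (auto simp: T_def trails_def)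
    qed
  qed simp
  finally show ?thesis by (simp add: T_def)
qed

section \<open>Counting the coloured factorisations\<close>

text \<open>Extensionality gives each colouring of \<open>N\<close> a single representative, which
  makes cardinalities meaningful; the colour set is implicit in the support of
  \<open>\<gamma>\<close>.\<close>

definition colourings :: "'i set \<Rightarrow> ('c \<Rightarrow> nat) \<Rightarrow> ('i \<Rightarrow> 'c) set" where
  "colourings N \<gamma> = {f \<in> extensional N. \<forall>a. deg f N a = \<gamma> a}"

text \<open>Invariance under a permutation means being constant on its cycles, so \<open>f\<close>
  colours the cycles of \<open>\<pi>\<close> and \<open>g\<close> those of
  \<open>\<pi> \<circ> long_cycle n\<close>.\<close>

definition factorisations ::
    "nat \<Rightarrow> ('c \<Rightarrow> nat) \<Rightarrow> ('d \<Rightarrow> nat) \<Rightarrow> ((nat \<Rightarrow> nat) \<times> (nat \<Rightarrow> 'c) \<times> (nat \<Rightarrow> 'd)) set" where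
  "factorisations n \<gamma> \<delta> = {(\<pi>, f, g). \<pi> permutes {1..n} \<and> f \<in> colourings {1..n} \<gamma> \<and>
     g \<in> colourings {1..n} \<delta> \<and> (\<forall>i\<in>{1..n}. f (\<pi> i) = f i \<and> g (\<pi> (long_cycle n i)) = g i)}"

text \<open>It supplies the fixed colourings \<open>o1\<close>, \<open>o2\<close> and
  \<open>ob\<close> whose classes serve as stocks of labels.\<close>

lemma exists_colouring:
  assumes "finite P" "finite N" "sum \<gamma> P = card N" "\<And>a. a \<notin> P \<Longrightarrow> \<gamma> a = 0"
  shows "\<exists>f. \<forall>a. deg f N a = \<gamma> a"
  using assms
proof (induction P arbitrary: N \<gamma> rule: finite_induct)
  case empty
  thus ?case by (auto simp: deg_def)
next
  case (insert a P)
  have "\<gamma> a \<le> card N" using insert.prems(2) insert.hyps by simp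
  then obtain M where M: "M \<subseteq> N" "card M = \<gamma> a" by (rule obtain_subset_with_card_n)
  have finM: "finite M" using M(1) insert.prems(1) by (rule finite_subset)
  have "\<exists>f. \<forall>x. deg f (N - M) x = (\<gamma>(a := 0)) x"
  proof (rule insert.IH)
    have "sum (\<gamma>(a := 0)) P = sum \<gamma> P" by (rule sum.cong) (use insert.hyps in auto)
    moreover have "card (N - M) = card N - \<gamma> a" using M finM by (simp add: card_Diff_subset)
    ultimately show "sum (\<gamma>(a := 0)) P = card (N - M)" using insert.prems(2) insert.hyps by simp
    show "(\<gamma>(a := 0)) x = 0" if "x \<notin> P" for x using insert.prems(3)[of x] that by auto
  qed (use insert.prems(1) in simp)
  then obtain f where f: "\<And>x. deg f (N - M) x = (\<gamma>(a := 0)) x" by blast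
  define f' where "f' = (\<lambda>i. if i \<in> M then a else f i)"
  have "deg f' N x = \<gamma> x" for x
  proof (cases "x = a")
    case True
    have "{i \<in> N - M. f i = a} = {}"
      using f[of a] insert.prems(1) by (simp add: deg_def)
    hence "{i \<in> N. f' i = a} = M" using M(1) by (auto simp: f'_def)
    thus ?thesis using True M(2) by (simp add: deg_def)
  next
    case False
    hence "{i \<in> N. f' i = x} = {i \<in> N - M. f i = x}" by (auto simp: f'_def)
    thus ?thesis using f[of x] False by (simp add: deg_def)
  qed
  thus ?case by blast
qed

lemma finite_colourings:
  assumes "finite N" "finite {a. \<gamma> a > 0}"
  shows "finite (colourings N \<gamma>)"
proof (rule finite_subset)
  show "colourings N \<gamma> \<subseteq> N \<rightarrow>\<^sub>E {a. \<gamma> a > 0}"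
  proof
    fix f assume f: "f \<in> colourings N \<gamma>"
    have "\<gamma> (f i) > 0" if "i \<in> N" for i
      using deg_pos_iff[OF assms(1), of f "f i"] f that by (auto simp: colourings_def)
    thus "f \<in> N \<rightarrow>\<^sub>E {a. \<gamma> a > 0}" using f by (auto simp: colourings_def PiE_def)
  qed
qed (use assms in \<open>auto intro: finite_PiE\<close>)

lemma colourings_image:
  assumes "finite N" "\<And>a. deg f N a = \<gamma> a"
  shows "f ` N = {a. \<gamma> a > 0}"
  using deg_pos_iff[OF assms(1), of f] assms(2) by auto

lemma colourings_comp_permutes:
  assumes "\<And>a. deg ob N a = \<gamma> a" "\<theta> permutes N"
  shows "restrict (ob \<circ> \<theta>) N \<in> colourings N \<gamma>"
proof -
  have "deg (restrict (ob \<circ> \<theta>) N) N a = deg (ob \<circ> \<theta>) N a" for a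
    unfolding deg_def by (rule arg_cong[of _ _ card]) auto
  thus ?thesis using deg_comp_permutes[OF assms(2), of ob] assms(1) by (simp add: colourings_def)
qed

text \<open>
  In the proof, \<open>\<theta>1\<close> and \<open>\<theta>2\<close> label the two kinds of steps by time, \<open>Z\<close> consists of the labelled
  triples, and \<open>W\<close> of the trails together with their pairing \<open>\<phi>\<close>.
\<close>

theorem card_factorisations:
  fixes \<gamma> :: "nat \<Rightarrow> nat" and \<delta> :: "'d \<Rightarrow> nat"
  assumes n: "1 \<le> n"
    and \<gamma>: "finite {a. \<gamma> a > 0}" "sum \<gamma> {a. \<gamma> a > 0} = n"
    and \<delta>: "finite {b. \<delta> b > 0}" "sum \<delta> {b. \<delta> b > 0} = n"
  defines "p \<equiv> card {a. \<gamma> a > 0}" and "q \<equiv> card {b. \<delta> b > 0}"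
  shows "p + q \<le> n + 1 \<Longrightarrow> card (factorisations n \<gamma> \<delta>) * fact (n + 1 - p - q) =
      n * fact (n - p) * fact (n - q)"
    and "p + q > n + 1 \<Longrightarrow> card (factorisations n \<gamma> \<delta>) = 0"
proof -
  define N where "N = {1..n}"
  define c where "c = long_cycle n"
  \<comment> \<open>The number of labellings of one triple, the same for all triples.\<close>
  define A where "A = (\<Prod>a\<in>{a. \<gamma> a > 0}. fact (\<gamma> a)) * (\<Prod>b\<in>{b. \<delta> b > 0}. fact (\<delta> b) :: nat)"
  have finN: "finite N" and cN: "card N = n" by (simp_all add: N_def)
  have c: "c permutes N" unfolding c_def N_def by (rule long_cycle_permutes)
  obtain o1 where o1: "\<And>a. deg o1 N a = \<gamma> a"
    using exists_colouring[OF \<gamma>(1) finN] \<gamma>(2) cN by auto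
  obtain o2 where o2: "\<And>b. deg o2 N b = \<delta> b"
    using exists_colouring[OF \<delta>(1) finN] \<delta>(2) cN by auto
  have im: "o1 ` N = {a. \<gamma> a > 0}" "o2 ` N = {b. \<delta> b > 0}"
    using colourings_image[OF finN, of o1 \<gamma>] colourings_image[OF finN, of o2 \<delta>] o1 o2 by blast+
  define T where "T = factorisations n \<gamma> \<delta>"
  define Z where "Z = {(\<pi>, \<theta>1, \<theta>2). \<pi> permutes N \<and> \<theta>1 permutes N \<and> \<theta>2 permutes N \<and>
      (\<forall>i\<in>N. o1 (\<theta>1 (\<pi> i)) = o1 (\<theta>1 i) \<and> o2 (\<theta>2 (\<pi> (c i))) = o2 (\<theta>2 i))}"
  define W where "W = (SIGMA \<phi>:{\<phi>. \<phi> permutes N}. {(\<theta>1, \<theta>2). \<theta>1 permutes N \<and> \<theta>2 permutes N \<and>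
      (\<forall>i\<in>N. o1 (\<phi> (\<theta>2 i)) = o1 (\<theta>1 i) \<and> o2 (\<theta>2 (c i)) = o2 (inv \<phi> (\<theta>1 i)))})"
  have finS: "finite {\<phi>. \<phi> permutes N}" by (rule finite_permutations[OF finN])
  have finT: "finite T"
  proof (rule finite_subset)
    show "T \<subseteq> {\<phi>. \<phi> permutes N} \<times> colourings N \<gamma> \<times> colourings N \<delta>"
      by (auto simp: T_def factorisations_def N_def)
    show "finite ({\<phi>. \<phi> permutes N} \<times> colourings N \<gamma> \<times> colourings N \<delta>)"
      by (intro finite_cartesian_product finS finite_colourings finN \<gamma>(1) \<delta>(1))
  qed
  have finZ: "finite Z"
    by (rule finite_subset[of _ "{\<phi>. \<phi> permutes N} \<times> {\<phi>. \<phi> permutes N} \<times> {\<phi>. \<phi> permutes N}"])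
      (use finS in \<open>auto simp: Z_def\<close>)
  define F where "F = (\<lambda>(\<pi> :: nat \<Rightarrow> nat, \<theta>1, \<theta>2). (\<pi>, restrict (o1 \<circ> \<theta>1) N, restrict (o2 \<circ> \<theta>2) N))"
  have FZ: "F ` Z \<subseteq> T"
  proof (rule image_subsetI)
    fix z assume "z \<in> Z"
    then obtain \<pi> \<theta>1 \<theta>2 where z: "z = (\<pi>, \<theta>1, \<theta>2)" and p: "\<pi> permutes N" "\<theta>1 permutes N" "\<theta>2 permutes N"
      and eq: "\<And>i. i \<in> N \<Longrightarrow> o1 (\<theta>1 (\<pi> i)) = o1 (\<theta>1 i) \<and> o2 (\<theta>2 (\<pi> (c i))) = o2 (\<theta>2 i)"
      by (auto simp: Z_def)
    have "(\<pi>, restrict (o1 \<circ> \<theta>1) N, restrict (o2 \<circ> \<theta>2) N) \<in> T"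
      unfolding T_def factorisations_def mem_Collect_eq case_prod_conv N_def[symmetric] c_def[symmetric]
      using p(1) colourings_comp_permutes[OF o1 p(2)] colourings_comp_permutes[OF o2 p(3)] eq
        permutes_in_image[OF p(1)] permutes_in_image[OF c] by simp
    thus "F z \<in> T" by (simp add: F_def z)
  qed
  have fiber: "card {z \<in> Z. F z = t} = A" if t: "t \<in> T" for t
  proof -
    obtain \<pi> f g where t': "t = (\<pi>, f, g)" by (cases t)
    have p: "\<pi> permutes N" and f: "f \<in> colourings N \<gamma>" and g: "g \<in> colourings N \<delta>"
      and fg: "\<And>i. i \<in> N \<Longrightarrow> f (\<pi> i) = f i" "\<And>i. i \<in> N \<Longrightarrow> g (\<pi> (c i)) = g i"
      using t by (auto simp: T_def factorisations_def t' N_def c_def)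
    have r: "restrict (ob \<circ> \<theta>) N = h \<longleftrightarrow> (\<forall>i\<in>N. ob (\<theta> i) = h i)" if "h \<in> extensional N"
      for ob :: "nat \<Rightarrow> 'x" and \<theta> h
      using that by (auto simp: fun_eq_iff restrict_def extensional_def)
    have ext: "f \<in> extensional N" "g \<in> extensional N" using f g by (auto simp: colourings_def)
    have "{z \<in> Z. F z = t} = {\<pi>} \<times> {\<theta>. \<theta> permutes N \<and> (\<forall>i\<in>N. o1 (\<theta> i) = f i)} \<times>
        {\<theta>. \<theta> permutes N \<and> (\<forall>i\<in>N. o2 (\<theta> i) = g i)}"
    proof (intro set_eqI iffI)
      fix z assume "z \<in> {z \<in> Z. F z = t}"
      thus "z \<in> {\<pi>} \<times> {\<theta>. \<theta> permutes N \<and> (\<forall>i\<in>N. o1 (\<theta> i) = f i)} \<times>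
        {\<theta>. \<theta> permutes N \<and> (\<forall>i\<in>N. o2 (\<theta> i) = g i)}"
        by (cases z) (auto simp: Z_def F_def t' r[OF ext(1)] r[OF ext(2)])
    next
      fix z assume "z \<in> {\<pi>} \<times> {\<theta>. \<theta> permutes N \<and> (\<forall>i\<in>N. o1 (\<theta> i) = f i)} \<times>
        {\<theta>. \<theta> permutes N \<and> (\<forall>i\<in>N. o2 (\<theta> i) = g i)}"
      then obtain a b where z: "z = (\<pi>, a, b)" and ab: "a permutes N" "b permutes N"
        "\<And>i. i \<in> N \<Longrightarrow> o1 (a i) = f i" "\<And>i. i \<in> N \<Longrightarrow> o2 (b i) = g i" by (cases z) auto
      have "F z = t" unfolding F_def z t' using ab(3,4) r[OF ext(1), of o1 a] r[OF ext(2), of o2 b] by simp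
      moreover have "z \<in> Z"
        unfolding Z_def z using p ab fg permutes_in_image[OF p] permutes_in_image[OF c] by simp
      ultimately show "z \<in> {z \<in> Z. F z = t}" by simp
    qed
    moreover have "card {\<theta>. \<theta> permutes N \<and> (\<forall>i\<in>N. o1 (\<theta> i) = f i)} = (\<Prod>a\<in>{a. \<gamma> a > 0}. fact (\<gamma> a))"
    proof -
      have d: "deg f N a = \<gamma> a" for a using f by (simp add: colourings_def)
      show ?thesis
        using card_permutes_labellings[OF finN \<gamma>(1), of f o1] colourings_image[OF finN d] d o1 by simp
    qed
    moreover have "card {\<theta>. \<theta> permutes N \<and> (\<forall>i\<in>N. o2 (\<theta> i) = g i)} = (\<Prod>b\<in>{b. \<delta> b > 0}. fact (\<delta> b))"
    proof -
      have d: "deg g N a = \<delta> a" for a using g by (simp add: colourings_def)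
      show ?thesis
        using card_permutes_labellings[OF finN \<delta>(1), of g o2] colourings_image[OF finN d] d o2 by simp
    qed
    ultimately show ?thesis by (simp only: A_def card_cartesian_product card_1_singleton_iff[THEN iffD2, OF exI[of _ \<pi>, OF refl]] One_nat_def[symmetric] mult_1)
  qed
  have ZT: "card Z = card T * A"
    using card_eq_sum_fibers[OF finZ finT FZ] fiber by simp
  \<comment> \<open>At time \<open>i\<close> the walk goes from the colour of \<open>g\<close> at
    \<open>inv c i\<close> to the colour of \<open>f\<close> at \<open>i\<close>, so this step
    carries the label \<open>\<theta>2 (inv c i)\<close>. Its reverse is the step made from
    \<open>f\<close> to \<open>g\<close> at time \<open>\<pi> i\<close>, with label
    \<open>\<theta>1 (\<pi> i)\<close>; this determines \<open>\<phi>\<close>.\<close>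
  let ?to = "\<lambda>(\<pi>, \<theta>1, \<theta>2). (\<theta>1 \<circ> \<pi> \<circ> inv (\<theta>2 \<circ> inv c), \<theta>1, \<theta>2 \<circ> inv c)"
    and ?from = "\<lambda>(\<phi>, \<theta>1, \<theta>2). (inv \<theta>1 \<circ> \<phi> \<circ> \<theta>2, \<theta>1, \<theta>2 \<circ> c)"
  have "bij_betw ?to Z W"
  proof (rule bij_betw_byWitness[where f' = ?from])
    show "\<forall>z\<in>Z. ?from (?to z) = z"
    proof
      fix z assume "z \<in> Z"
      then obtain \<pi> \<theta>1 \<theta>2 where z: "z = (\<pi>, \<theta>1, \<theta>2)" and p: "\<theta>1 permutes N" "\<theta>2 permutes N"
        by (auto simp: Z_def)
      have q: "\<theta>2 \<circ> inv c permutes N" by (intro permutes_compose permutes_inv c p(2))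
      have "inv \<theta>1 \<circ> (\<theta>1 \<circ> \<pi> \<circ> inv (\<theta>2 \<circ> inv c)) \<circ> (\<theta>2 \<circ> inv c) = \<pi>"
        using permutes_inverses(2)[OF p(1)] permutes_inverses(2)[OF q] by (simp add: fun_eq_iff)
      moreover have "\<theta>2 \<circ> inv c \<circ> c = \<theta>2"
        using permutes_inverses(2)[OF c] by (simp add: fun_eq_iff)
      ultimately show "?from (?to z) = z"
        unfolding z case_prod_conv by simp
    qed
    show "\<forall>w\<in>W. ?to (?from w) = w"
    proof
      fix w assume "w \<in> W"
      then obtain \<phi> \<theta>1 \<theta>2 where w: "w = (\<phi>, \<theta>1, \<theta>2)" and p: "\<theta>1 permutes N" "\<theta>2 permutes N"
        by (auto simp: W_def)
      have e: "\<theta>2 \<circ> c \<circ> inv c = \<theta>2"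
        using permutes_inverses(1)[OF c] by (simp add: fun_eq_iff)
      have "\<theta>1 \<circ> (inv \<theta>1 \<circ> \<phi> \<circ> \<theta>2) \<circ> inv \<theta>2 = \<phi>"
        using permutes_inverses(1)[OF p(1)] permutes_inverses(1)[OF p(2)] by (simp add: fun_eq_iff)
      thus "?to (?from w) = w"
        unfolding w case_prod_conv e by simp
    qed
    show "?to ` Z \<subseteq> W"
    proof (rule image_subsetI)
      fix z assume "z \<in> Z"
      then obtain \<pi> \<theta>1 \<theta>2 where z: "z = (\<pi>, \<theta>1, \<theta>2)" and p: "\<pi> permutes N" "\<theta>1 permutes N" "\<theta>2 permutes N"
        and eq: "\<And>i. i \<in> N \<Longrightarrow> o1 (\<theta>1 (\<pi> i)) = o1 (\<theta>1 i)" "\<And>i. i \<in> N \<Longrightarrow> o2 (\<theta>2 (\<pi> (c i))) = o2 (\<theta>2 i)"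
        by (auto simp: Z_def)
      define \<theta> where "\<theta> = \<theta>2 \<circ> inv c"
      define \<phi> where "\<phi> = \<theta>1 \<circ> \<pi> \<circ> inv \<theta>"
      have \<theta>: "\<theta> permutes N" unfolding \<theta>_def by (intro permutes_compose permutes_inv c p)
      have \<phi>: "\<phi> permutes N" unfolding \<phi>_def by (intro permutes_compose permutes_inv \<theta> p)
      have e1: "\<phi> (\<theta> i) = \<theta>1 (\<pi> i)" for i
        using permutes_inverses(2)[OF \<theta>] by (simp add: \<phi>_def)
      have e2: "\<theta> (c i) = \<theta>2 i" for i using permutes_inverses(2)[OF c] by (simp add: \<theta>_def)
      have "o2 (\<theta> (c i)) = o2 (inv \<phi> (\<theta>1 i))" if i: "i \<in> N" for i
      proof -
        \<comment> \<open>The point that \<open>\<pi> \<circ> c\<close> takes to \<open>i\<close>,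
          and hence a point of the same \<open>g\<close>-class.\<close>
        define j where "j = inv c (inv \<pi> i)"
        have j: "j \<in> N" "\<pi> (c j) = i"
          using i permutes_in_image[OF permutes_inv[OF c]] permutes_in_image[OF permutes_inv[OF p(1)]]
            permutes_inverses(1)[OF c] permutes_inverses(1)[OF p(1)] by (simp_all add: j_def)
        have "\<phi> (\<theta> (c j)) = \<theta>1 i" unfolding e1 j(2) ..
        hence "inv \<phi> (\<theta>1 i) = \<theta>2 j" using permutes_inverses(2)[OF \<phi>] e2 by metis
        thus ?thesis using eq(2)[OF j(1)] by (simp add: e2 j(2))
      qed
      hence "(\<phi>, \<theta>1, \<theta>) \<in> W" using \<phi> \<theta> p(2) eq(1) e1 by (simp add: W_def)
      thus "?to z \<in> W"
        unfolding z case_prod_conv \<theta>_def[symmetric] \<phi>_def[symmetric] .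
    qed
    show "?from ` W \<subseteq> Z"
    proof (rule image_subsetI)
      fix w assume "w \<in> W"
      then obtain \<phi> \<theta>1 \<theta>2 where w: "w = (\<phi>, \<theta>1, \<theta>2)" and p: "\<phi> permutes N" "\<theta>1 permutes N" "\<theta>2 permutes N"
        and eq: "\<And>i. i \<in> N \<Longrightarrow> o1 (\<phi> (\<theta>2 i)) = o1 (\<theta>1 i)" "\<And>i. i \<in> N \<Longrightarrow> o2 (\<theta>2 (c i)) = o2 (inv \<phi> (\<theta>1 i))"
        by (auto simp: W_def)
      define \<pi> where "\<pi> = inv \<theta>1 \<circ> \<phi> \<circ> \<theta>2"
      have \<pi>: "\<pi> permutes N" unfolding \<pi>_def by (intro permutes_compose permutes_inv p)
      have e1: "\<theta>1 (\<pi> i) = \<phi> (\<theta>2 i)" for i using permutes_inverses(1)[OF p(2)] by (simp add: \<pi>_def)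
      have "o2 (\<theta>2 (c (\<pi> (c i)))) = o2 (\<theta>2 (c i))" if i: "i \<in> N" for i
      proof -
        have "\<pi> (c i) \<in> N" using i permutes_in_image[OF \<pi>] permutes_in_image[OF c] by simp
        from eq(2)[OF this] have "o2 (\<theta>2 (c (\<pi> (c i)))) = o2 (inv \<phi> (\<phi> (\<theta>2 (c i))))"
          by (simp add: e1)
        thus ?thesis using permutes_inverses(2)[OF p(1)] by simp
      qed
      hence "(\<pi>, \<theta>1, \<theta>2 \<circ> c) \<in> Z"
        using \<pi> p eq(1) e1 permutes_compose[OF c p(3)] by (simp add: Z_def)
      thus "?from w \<in> Z"
        unfolding w case_prod_conv \<pi>_def[symmetric] .
    qed
  qed
  hence ZW: "card Z = card W" by (rule bij_betw_same_card)
  define tr where "tr b \<phi> = card (trails (step_src o2 o1) (step_tgt o2 o1 \<phi>) (Inl b) (Inl b) (N <+> N))" for b \<phi>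
  have "card W = (\<Sum>\<phi> | \<phi> permutes N. \<Sum>b\<in>o2 ` N. tr b \<phi>)"
  proof -
    have "finite {(\<theta>1, \<theta>2). \<theta>1 permutes N \<and> \<theta>2 permutes N \<and> R \<theta>1 \<theta>2}" for R
      by (rule finite_subset[of _ "{\<phi>. \<phi> permutes N} \<times> {\<phi>. \<phi> permutes N}"]) (use finS in auto)
    hence "card W = (\<Sum>\<phi> | \<phi> permutes N. card {(\<theta>1, \<theta>2). \<theta>1 permutes N \<and> \<theta>2 permutes N \<and>
      (\<forall>i\<in>N. o1 (\<phi> (\<theta>2 i)) = o1 (\<theta>1 i) \<and> o2 (\<theta>2 (c i)) = o2 (inv \<phi> (\<theta>1 i)))})"
      unfolding W_def by (intro card_SigmaI finS ballI)
    thus ?thesis unfolding N_def c_def tr_def card_closed_trails[OF n] .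
  qed
  also have "\<dots> = (\<Sum>b\<in>o2 ` N. \<Sum>\<phi> | \<phi> permutes N. tr b \<phi>)" by (rule sum.swap)
  finally have TA: "card T * A = (\<Sum>b\<in>o2 ` N. \<Sum>\<phi> | \<phi> permutes N. tr b \<phi>)" using ZT ZW by simp
  \<comment> \<open>The dummy root, a colour that \<open>o1\<close> does not use; it exists because
    the colours of \<open>f\<close> are natural numbers.\<close>
  obtain r where r: "r \<notin> o1 ` N" using ex_new_if_finite[OF infinite_UNIV_nat, of "o1 ` N"] finN by blast
  have A0: "A > 0" by (simp add: A_def prod_pos)
  show "card (factorisations n \<gamma> \<delta>) * fact (n + 1 - p - q) = n * fact (n - p) * fact (n - q)"
    if le: "p + q \<le> n + 1"
  proof -
    have "card T * A * fact (n + 1 - p - q) =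
        (\<Sum>b\<in>o2 ` N. (\<Sum>\<phi> | \<phi> permutes N. tr b \<phi>) * fact (n + 1 - p - q))"
      unfolding TA sum_distrib_right ..
    also have "\<dots> = (\<Sum>b\<in>o2 ` N. A * (\<delta> b * fact (n - p) * fact (n - q)))"
    proof (rule sum.cong[OF refl])
      fix b assume b: "b \<in> o2 ` N"
      show "(\<Sum>\<phi> | \<phi> permutes N. tr b \<phi>) * fact (n + 1 - p - q) = A * (\<delta> b * fact (n - p) * fact (n - q))"
        using sum_card_trails(1)[OF finN b r] le
        unfolding im cN p_def[symmetric] q_def[symmetric] o1 o2 A_def tr_def by blast
    qed
    \<comment> \<open>The starting colour \<open>b\<close> contributes its class size, and the class
      sizes add up to \<open>n\<close>.\<close>
    also have "\<dots> = A * (sum \<delta> {b. \<delta> b > 0} * (fact (n - p) * fact (n - q)))"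
      unfolding im by (simp add: sum_distrib_left sum_distrib_right mult.assoc)
    finally have "A * (card T * fact (n + 1 - p - q)) = A * (n * fact (n - p) * fact (n - q))"
      unfolding \<delta>(2) by (simp add: mult_ac)
    thus ?thesis using A0 by (simp add: T_def)
  qed
  show "card (factorisations n \<gamma> \<delta>) = 0" if gt: "p + q > n + 1"
  proof -
    have "(\<Sum>\<phi> | \<phi> permutes N. tr b \<phi>) = 0" if b: "b \<in> o2 ` N" for b
      using sum_card_trails(2)[OF finN b r] gt
      unfolding im cN p_def[symmetric] q_def[symmetric] tr_def by blast
    hence "card T * A = 0" unfolding TA by simp
    thus ?thesis using A0 by (simp add: T_def)
  qed
qed

section \<open>Coefficients of power sums\<close>

lemma mvps_coeff_simps [simp]:
  "mvps_coeff 0 \<mu> = 0"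
  "mvps_coeff (f + g) \<mu> = mvps_coeff f \<mu> + mvps_coeff g \<mu>"
  "mvps_coeff (mvps_scale c f) \<mu> = c * mvps_coeff f \<mu>"
  by (transfer, simp)+

lemma mvps_coeff_1: "mvps_coeff 1 \<mu> = (if \<mu> = 0 then 1 else 0)"
  by (transfer, simp)

lemma mvps_coeff_mult: "mvps_coeff (f * g) \<mu> = (\<Sum>(a, b)\<in>splits \<mu>. mvps_coeff f a * mvps_coeff g b)"
  by (transfer, simp)

lemma mvps_coeff_power_sum_var:
  "mvps_coeff (power_sum_var d) \<mu> = (if \<exists>i. \<mu> = Poly_Mapping.single i d then 1 else 0)"
  by (transfer, simp)

lemma mvps_coeff_sum: "mvps_coeff (sum f A) \<mu> = (\<Sum>a\<in>A. mvps_coeff (f a) \<mu>)"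
  by (induction A rule: infinite_finite_induct) auto

lemma mvps_coeff_monomial_sym:
  "mvps_coeff (monomial_sym lam) \<mu> =
     (if image_mset (Poly_Mapping.lookup \<mu>) (mset_set (Poly_Mapping.keys \<mu>)) = lam then 1 else 0)"
  unfolding monomial_sym_def by (subst Abs_mvps_inverse) auto

lemma single_inj_left: "d > 0 \<Longrightarrow> Poly_Mapping.single i d = Poly_Mapping.single j (d::nat) \<Longrightarrow> i = j"
  by (metis lookup_single_eq lookup_single_not_eq less_not_refl)

text \<open>The condition says that the \<open>d\<close>-th power of the variable \<open>j\<close>
  divides the monomial; only then is the subtraction of exponents not truncated. \<open>K\<close>
  may exceed the support of \<open>\<mu>\<close>, so that it can stay fixed in the induction on the
  factors.\<close>

lemma mvps_coeff_power_sum_var_mult: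
  assumes d: "d > 0" and K: "Poly_Mapping.keys \<mu> \<subseteq> K" "finite K"
  shows "mvps_coeff (power_sum_var d * g) \<mu> =
    (\<Sum>j\<in>K. if \<exists>b. Poly_Mapping.single j d + b = \<mu> then mvps_coeff g (\<mu> - Poly_Mapping.single j d) else 0)"
proof -
  define J where "J = {j \<in> K. \<exists>b. Poly_Mapping.single j d + b = \<mu>}"
  have "mvps_coeff (power_sum_var d * g) \<mu> =
      (\<Sum>p\<in>splits \<mu>. if \<exists>i. fst p = Poly_Mapping.single i d then mvps_coeff g (snd p) else 0)"
    unfolding mvps_coeff_mult mvps_coeff_power_sum_var by (rule sum.cong) auto
  also have "\<dots> = (\<Sum>p\<in>{p \<in> splits \<mu>. \<exists>i. fst p = Poly_Mapping.single i d}. mvps_coeff g (snd p))"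
    by (rule sum.inter_filter[symmetric]) simp
  also have "{p \<in> splits \<mu>. \<exists>i. fst p = Poly_Mapping.single i d} =
      (\<lambda>j. (Poly_Mapping.single j d, \<mu> - Poly_Mapping.single j d)) ` J"
  proof (intro set_eqI iffI)
    fix p assume "p \<in> {p \<in> splits \<mu>. \<exists>i. fst p = Poly_Mapping.single i d}"
    then obtain i where i: "fst p = Poly_Mapping.single i d" "Poly_Mapping.single i d + snd p = \<mu>"
      by (cases p) (auto simp: splits_def)
    have "Poly_Mapping.lookup \<mu> i \<noteq> 0" unfolding i(2)[symmetric] using d by (simp add: lookup_add)
    hence "i \<in> K" using K by (auto simp: in_keys_iff)
    moreover have "snd p = \<mu> - Poly_Mapping.single i d" unfolding i(2)[symmetric] by simp
    ultimately show "p \<in> (\<lambda>j. (Poly_Mapping.single j d, \<mu> - Poly_Mapping.single j d)) ` J"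
      using i by (intro image_eqI[of _ _ i]) (auto simp: J_def prod_eq_iff)
  next
    fix p assume "p \<in> (\<lambda>j. (Poly_Mapping.single j d, \<mu> - Poly_Mapping.single j d)) ` J"
    thus "p \<in> {p \<in> splits \<mu>. \<exists>i. fst p = Poly_Mapping.single i d}"
      by (auto simp: J_def splits_def)
  qed
  also have "(\<Sum>p\<in>(\<lambda>j. (Poly_Mapping.single j d, \<mu> - Poly_Mapping.single j d)) ` J. mvps_coeff g (snd p)) =
      (\<Sum>j\<in>J. mvps_coeff g (\<mu> - Poly_Mapping.single j d))"
    by (subst sum.reindex) (auto intro!: inj_onI dest: single_inj_left[OF d])
  also have "\<dots> = (\<Sum>j\<in>K. if \<exists>b. Poly_Mapping.single j d + b = \<mu> then mvps_coeff g (\<mu> - Poly_Mapping.single j d) else 0)"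
    unfolding J_def by (rule sum.inter_filter[OF K(2)])
  finally show ?thesis .
qed

text \<open>Multiplying out picks a variable \<open>F i\<close> from every factor. The coefficient
  is therefore a number of assignments, which will become a number of colourings of cycles.\<close>

lemma mvps_coeff_prod_power_sum_var:
  assumes "finite I" "\<And>i. i \<in> I \<Longrightarrow> d i > 0" "Poly_Mapping.keys \<mu> \<subseteq> K" "finite K"
  shows "mvps_coeff (\<Prod>i\<in>I. power_sum_var (d i) :: 'a::comm_ring_1 mvps) \<mu> =
    of_nat (card {F \<in> I \<rightarrow>\<^sub>E K. (\<Sum>i\<in>I. Poly_Mapping.single (F i) (d i)) = \<mu>})"
  using assms
proof (induction I arbitrary: \<mu> rule: finite_induct)
  case empty
  have "{F \<in> {} \<rightarrow>\<^sub>E K. (\<Sum>i\<in>{}. Poly_Mapping.single (F i) (d i)) = \<mu>} = (if \<mu> = 0 then {\<lambda>_. undefined} else {})"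
    by auto
  thus ?case by (simp add: mvps_coeff_1)
next
  case (insert x I)
  note hyps = insert.hyps and prems = insert.prems
  define S where "S \<mu> = {F \<in> I \<rightarrow>\<^sub>E K. (\<Sum>i\<in>I. Poly_Mapping.single (F i) (d i)) = \<mu>}" for \<mu>
  have "(if \<exists>b. Poly_Mapping.single j (d x) + b = \<mu>
        then mvps_coeff (\<Prod>i\<in>I. power_sum_var (d i) :: 'a mvps) (\<mu> - Poly_Mapping.single j (d x)) else 0) =
      of_nat (card {F \<in> I \<rightarrow>\<^sub>E K. (\<Sum>i\<in>insert x I. Poly_Mapping.single ((F(x := j)) i) (d i)) = \<mu>})" for j
  proof -
    have s: "(\<Sum>i\<in>insert x I. Poly_Mapping.single ((F(x := j)) i) (d i)) =
        Poly_Mapping.single j (d x) + (\<Sum>i\<in>I. Poly_Mapping.single (F i) (d i))" for F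
    proof -
      have "(\<Sum>i\<in>I. Poly_Mapping.single ((F(x := j)) i) (d i)) = (\<Sum>i\<in>I. Poly_Mapping.single (F i) (d i))"
        by (rule sum.cong) (use hyps in auto)
      thus ?thesis using hyps by simp
    qed
    show ?thesis
    proof (cases "\<exists>b. Poly_Mapping.single j (d x) + b = \<mu>")
      case True
      then obtain b where b: "\<mu> = Poly_Mapping.single j (d x) + b" by blast
      have "Poly_Mapping.keys b \<subseteq> Poly_Mapping.keys \<mu>"
        unfolding b by (auto simp: in_keys_iff lookup_add)
      hence kb: "Poly_Mapping.keys b \<subseteq> K" using prems(2) by (rule subset_trans)
      have "mvps_coeff (\<Prod>i\<in>I. power_sum_var (d i) :: 'a mvps) b = of_nat (card (S b))"
        unfolding S_def by (rule insert.IH[OF _ kb prems(3)]) (use prems(1) in simp)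
      moreover have "{F \<in> I \<rightarrow>\<^sub>E K. (\<Sum>i\<in>insert x I. Poly_Mapping.single ((F(x := j)) i) (d i)) = \<mu>} = S b"
        unfolding s S_def b by simp
      ultimately show ?thesis using True b by simp
    next
      case False
      hence "{F \<in> I \<rightarrow>\<^sub>E K. (\<Sum>i\<in>insert x I. Poly_Mapping.single ((F(x := j)) i) (d i)) = \<mu>} = {}"
        unfolding s by blast
      thus ?thesis by (simp only: False if_False card.empty of_nat_0)
    qed
  qed
  moreover have "mvps_coeff (\<Prod>i\<in>insert x I. power_sum_var (d i) :: 'a mvps) \<mu> =
      (\<Sum>j\<in>K. if \<exists>b. Poly_Mapping.single j (d x) + b = \<mu>
        then mvps_coeff (\<Prod>i\<in>I. power_sum_var (d i) :: 'a mvps) (\<mu> - Poly_Mapping.single j (d x)) else 0)"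
    unfolding prod.insert[OF hyps] by (rule mvps_coeff_power_sum_var_mult) (use prems in auto)
  ultimately have "mvps_coeff (\<Prod>i\<in>insert x I. power_sum_var (d i) :: 'a mvps) \<mu> =
      of_nat (\<Sum>j\<in>K. card {F \<in> I \<rightarrow>\<^sub>E K. (\<Sum>i\<in>insert x I. Poly_Mapping.single ((F(x := j)) i) (d i)) = \<mu>})"
    by simp
  also have "(\<Sum>j\<in>K. card {F \<in> I \<rightarrow>\<^sub>E K. (\<Sum>i\<in>insert x I. Poly_Mapping.single ((F(x := j)) i) (d i)) = \<mu>}) =
     card {F \<in> insert x I \<rightarrow>\<^sub>E K. (\<Sum>i\<in>insert x I. Poly_Mapping.single (F i) (d i)) = \<mu>}"
    by (rule card_PiE_insert_split[where x = x and A = I and B = "\<lambda>_. K" and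
        P = "\<lambda>F. (\<Sum>i\<in>insert x I. Poly_Mapping.single (F i) (d i)) = \<mu>", symmetric])
      (use hyps prems in auto)
  finally show ?case .
qed

lemma card_bij_betw_Collect:
  assumes "bij_betw h X Y"
  shows "card {x \<in> X. P (h x)} = card {y \<in> Y. P y}"
proof -
  have "bij_betw h {x \<in> X. P (h x)} {y \<in> Y. P y}"
    by (rule bij_betw_subset[OF assms]) (use assms in \<open>auto simp: bij_betw_def\<close>)
  thus ?thesis by (rule bij_betw_same_card)
qed

section \<open>Colourings that are constant on the cycles of a permutation\<close>

lemma orbit_eq_of_mem:
  assumes "\<pi> permutes N" "finite N" "j \<in> orbit \<pi> i"
  shows "orbit \<pi> j = orbit \<pi> i"
  using orbit_cyclic_eq3[OF cyclic_on_orbit[OF assms(1,2)] assms(3)] .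

lemma self_in_orbit:
  assumes "\<pi> permutes N" "finite N"
  shows "i \<in> orbit \<pi> i"
  using assms by (intro permutation_self_in_orbit) (auto simp: permutation_permutes)

text \<open>An invariant colouring is a function on the set of cycles; conversely, the colour of a
  cycle is read off at any chosen element of it.\<close>

lemma bij_betw_invariant_colourings:
  assumes p: "\<pi> permutes N" and fin: "finite N"
  shows "bij_betw (\<lambda>G. \<lambda>i\<in>N. G (orbit \<pi> i)) (orbit \<pi> ` N \<rightarrow>\<^sub>E K) {f \<in> N \<rightarrow>\<^sub>E K. \<forall>i\<in>N. f (\<pi> i) = f i}"
proof (rule bij_betw_byWitness[where f' = "\<lambda>f. \<lambda>C\<in>orbit \<pi> ` N. f (SOME i. i \<in> C)"])
  have some: "(SOME j. j \<in> orbit \<pi> i) \<in> orbit \<pi> i" for i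
    using self_in_orbit[OF p fin] by (rule someI)
  have oN: "orbit \<pi> i \<subseteq> N" if "i \<in> N" for i by (rule permutes_orbit_subset[OF p that])
  show "\<forall>G\<in>orbit \<pi> ` N \<rightarrow>\<^sub>E K. (\<lambda>C\<in>orbit \<pi> ` N. (\<lambda>i\<in>N. G (orbit \<pi> i)) (SOME i. i \<in> C)) = G"
  proof
    fix G assume G: "G \<in> orbit \<pi> ` N \<rightarrow>\<^sub>E K"
    show "(\<lambda>C\<in>orbit \<pi> ` N. (\<lambda>i\<in>N. G (orbit \<pi> i)) (SOME i. i \<in> C)) = G"
    proof
      fix C
      show "(\<lambda>C\<in>orbit \<pi> ` N. (\<lambda>i\<in>N. G (orbit \<pi> i)) (SOME i. i \<in> C)) C = G C"
      proof (cases "C \<in> orbit \<pi> ` N")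
        case True
        then obtain i where i: "i \<in> N" "C = orbit \<pi> i" by blast
        have "orbit \<pi> (SOME j. j \<in> C) = C" "(SOME j. j \<in> C) \<in> N"
          using orbit_eq_of_mem[OF p fin some] some[of i] oN[OF i(1)] i by auto
        thus ?thesis using True by simp
      next
        case False
        thus ?thesis using PiE_arb[OF G False] by simp
      qed
    qed
  qed
  have const: "f j = f i" if "\<forall>i\<in>N. f (\<pi> i) = f i" "j \<in> orbit \<pi> i" "i \<in> N" for f :: "'a \<Rightarrow> 'b" and i j
    using that(2)
  proof induction
    case base
    show ?case using that by simp
  next
    case (step j)
    have "j \<in> N" using step.hyps oN[OF that(3)] by blast
    thus ?case using step.IH that(1) by simp
  qed
  show "\<forall>f\<in>{f \<in> N \<rightarrow>\<^sub>E K. \<forall>i\<in>N. f (\<pi> i) = f i}.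
      (\<lambda>i\<in>N. (\<lambda>C\<in>orbit \<pi> ` N. f (SOME i. i \<in> C)) (orbit \<pi> i)) = f"
  proof
    fix f assume f: "f \<in> {f \<in> N \<rightarrow>\<^sub>E K. \<forall>i\<in>N. f (\<pi> i) = f i}"
    show "(\<lambda>i\<in>N. (\<lambda>C\<in>orbit \<pi> ` N. f (SOME i. i \<in> C)) (orbit \<pi> i)) = f"
    proof
      fix i
      show "(\<lambda>i\<in>N. (\<lambda>C\<in>orbit \<pi> ` N. f (SOME i. i \<in> C)) (orbit \<pi> i)) i = f i"
      proof (cases "i \<in> N")
        case True
        thus ?thesis using const[OF _ some True, of f] f by simp
      next
        case False
        thus ?thesis using f PiE_arb[of f N "\<lambda>_. K" i] by simp
      qed
    qed
  qed
  show "(\<lambda>G. \<lambda>i\<in>N. G (orbit \<pi> i)) ` (orbit \<pi> ` N \<rightarrow>\<^sub>E K) \<subseteq> {f \<in> N \<rightarrow>\<^sub>E K. \<forall>i\<in>N. f (\<pi> i) = f i}"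
  proof (rule image_subsetI)
    fix G assume G: "G \<in> orbit \<pi> ` N \<rightarrow>\<^sub>E K"
    have "orbit \<pi> (\<pi> i) = orbit \<pi> i" for i
      by (rule orbit_eq_of_mem[OF p fin orbit.base])
    thus "(\<lambda>i\<in>N. G (orbit \<pi> i)) \<in> {f \<in> N \<rightarrow>\<^sub>E K. \<forall>i\<in>N. f (\<pi> i) = f i}"
      using G permutes_in_image[OF p] by auto
  qed
  show "(\<lambda>f. \<lambda>C\<in>orbit \<pi> ` N. f (SOME i. i \<in> C)) ` {f \<in> N \<rightarrow>\<^sub>E K. \<forall>i\<in>N. f (\<pi> i) = f i} \<subseteq> orbit \<pi> ` N \<rightarrow>\<^sub>E K"
  proof (rule image_subsetI)
    fix f assume f: "f \<in> {f \<in> N \<rightarrow>\<^sub>E K. \<forall>i\<in>N. f (\<pi> i) = f i}"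
    have "f (SOME j. j \<in> orbit \<pi> i) \<in> K" if "i \<in> N" for i
      using f some[of i] oN[OF that] by auto
    thus "(\<lambda>C\<in>orbit \<pi> ` N. f (SOME i. i \<in> C)) \<in> orbit \<pi> ` N \<rightarrow>\<^sub>E K" by auto
  qed
qed

lemma deg_invariant_colouring:
  assumes p: "\<pi> permutes N" and fin: "finite N"
  shows "deg (\<lambda>i\<in>N. G (orbit \<pi> i)) N a = (\<Sum>C\<in>orbit \<pi> ` N. if G C = a then card C else 0)"
proof -
  have "{i \<in> N. (\<lambda>i\<in>N. G (orbit \<pi> i)) i = a} = \<Union>{C \<in> orbit \<pi> ` N. G C = a}"
  proof (intro set_eqI iffI)
    fix i assume "i \<in> {i \<in> N. (\<lambda>i\<in>N. G (orbit \<pi> i)) i = a}"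
    thus "i \<in> \<Union>{C \<in> orbit \<pi> ` N. G C = a}" using self_in_orbit[OF p fin, of i] by auto
  next
    fix i assume "i \<in> \<Union>{C \<in> orbit \<pi> ` N. G C = a}"
    then obtain j where j: "j \<in> N" "G (orbit \<pi> j) = a" "i \<in> orbit \<pi> j" by auto
    hence "i \<in> N" "orbit \<pi> i = orbit \<pi> j"
      using permutes_orbit_subset[OF p j(1)] orbit_eq_of_mem[OF p fin j(3)] by auto
    thus "i \<in> {i \<in> N. (\<lambda>i\<in>N. G (orbit \<pi> i)) i = a}" using j(2) by simp
  qed
  moreover have "card (\<Union>{C \<in> orbit \<pi> ` N. G C = a}) = (\<Sum>C\<in>{C \<in> orbit \<pi> ` N. G C = a}. card C)"
  proof (rule card_Union_disjoint)
    show "disjoint {C \<in> orbit \<pi> ` N. G C = a}"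
    proof (rule pairwiseI)
      fix C D assume "C \<in> {C \<in> orbit \<pi> ` N. G C = a}" "D \<in> {C \<in> orbit \<pi> ` N. G C = a}" and ne: "C \<noteq> D"
      then obtain i j where ij: "C = orbit \<pi> i" "D = orbit \<pi> j" by blast
      show "disjnt C D"
        unfolding disjnt_def
      proof (rule equals0I)
        fix x assume "x \<in> C \<inter> D"
        hence "orbit \<pi> x = C" "orbit \<pi> x = D" using orbit_eq_of_mem[OF p fin] ij by blast+
        thus False using ne by simp
      qed
    qed
    show "finite C" if "C \<in> {C \<in> orbit \<pi> ` N. G C = a}" for C
      using that permutes_orbit_subset[OF p] finite_subset[OF _ fin] by auto
  qed
  moreover have "(\<Sum>C\<in>{C \<in> orbit \<pi> ` N. G C = a}. card C) = (\<Sum>C\<in>orbit \<pi> ` N. if G C = a then card C else 0)"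
    by (rule sum.inter_filter) (use fin in simp)
  ultimately show ?thesis by (simp add: deg_def)
qed

text \<open>The product runs over the cycles of \<open>\<pi>\<close>, with the length of a cycle as
  degree of its factor. Picking a variable from each factor colours the cycles, and the exponent of
  a variable is the number of points of that colour. This turns coefficients into the colourings
  \<open>f\<close> of \<open>factorisations\<close>.\<close>

theorem mvps_coeff_power_sum_cycle_type:
  assumes p: "\<pi> permutes {1..n}"
  shows "mvps_coeff (power_sum (cycle_type n \<pi>) :: 'a::comm_ring_1 mvps) \<mu> =
    of_nat (card {f \<in> colourings {1..n} (Poly_Mapping.lookup \<mu>). \<forall>i\<in>{1..n}. f (\<pi> i) = f i})"
proof -
  define N where "N = {1..n}"
  define Cs where "Cs = orbit \<pi> ` N"
  define K where "K = Poly_Mapping.keys \<mu>"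
  have fin: "finite N" and pN: "\<pi> permutes N" using p by (simp_all add: N_def)
  have finC: "finite Cs" "finite K" by (simp_all add: Cs_def N_def K_def)
  have cpos: "card C > 0" if C: "C \<in> Cs" for C
  proof -
    obtain i where i: "i \<in> N" "C = orbit \<pi> i" using C unfolding Cs_def by blast
    hence "finite C" using permutes_orbit_subset[OF pN i(1)] finite_subset[OF _ fin] by blast
    thus ?thesis using self_in_orbit[OF pN fin, of i] i by (auto simp: card_gt_0_iff)
  qed
  have "power_sum (cycle_type n \<pi>) = (\<Prod>C\<in>Cs. power_sum_var (card C) :: 'a mvps)"
    by (simp add: power_sum_def cycle_type_def cycles_on_def Cs_def N_def prod_unfold_prod_mset multiset.map_comp o_def)
  hence "mvps_coeff (power_sum (cycle_type n \<pi>) :: 'a mvps) \<mu> =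
    of_nat (card {F \<in> Cs \<rightarrow>\<^sub>E K. (\<Sum>C\<in>Cs. Poly_Mapping.single (F C) (card C)) = \<mu>})"
    using mvps_coeff_prod_power_sum_var[where I = Cs and d = card and K = K and \<mu> = \<mu>] finC cpos by (simp add: K_def)
  also have "{F \<in> Cs \<rightarrow>\<^sub>E K. (\<Sum>C\<in>Cs. Poly_Mapping.single (F C) (card C)) = \<mu>} =
      {F \<in> Cs \<rightarrow>\<^sub>E K. (\<lambda>i\<in>N. F (orbit \<pi> i)) \<in> colourings N (Poly_Mapping.lookup \<mu>)}"
  proof -
    have "(\<Sum>C\<in>Cs. Poly_Mapping.single (F C) (card C)) = \<mu> \<longleftrightarrow>
        (\<lambda>i\<in>N. F (orbit \<pi> i)) \<in> colourings N (Poly_Mapping.lookup \<mu>)" for F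
    proof -
      have "Poly_Mapping.lookup (\<Sum>C\<in>Cs. Poly_Mapping.single (F C) (card C)) a = deg (\<lambda>i\<in>N. F (orbit \<pi> i)) N a" for a
        unfolding deg_invariant_colouring[OF pN fin] lookup_sum Cs_def lookup_single when_def ..
      thus ?thesis unfolding poly_mapping_eq_iff fun_eq_iff colourings_def by simp
    qed
    thus ?thesis by blast
  qed
  also have "card \<dots> = card {f \<in> {f \<in> N \<rightarrow>\<^sub>E K. \<forall>i\<in>N. f (\<pi> i) = f i}. f \<in> colourings N (Poly_Mapping.lookup \<mu>)}"
    unfolding Cs_def by (rule card_bij_betw_Collect[OF bij_betw_invariant_colourings[OF pN fin]])
  also have "{f \<in> {f \<in> N \<rightarrow>\<^sub>E K. \<forall>i\<in>N. f (\<pi> i) = f i}. f \<in> colourings N (Poly_Mapping.lookup \<mu>)} =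
      {f \<in> colourings N (Poly_Mapping.lookup \<mu>). \<forall>i\<in>N. f (\<pi> i) = f i}"
  proof -
    have "f \<in> N \<rightarrow>\<^sub>E K" if f: "f \<in> colourings N (Poly_Mapping.lookup \<mu>)" for f
    proof -
      have "Poly_Mapping.lookup \<mu> (f i) > 0" if "i \<in> N" for i
        using deg_pos_iff[OF fin, of f "f i"] f that by (auto simp: colourings_def)
      thus ?thesis using f by (auto simp: K_def in_keys_iff colourings_def PiE_def)
    qed
    thus ?thesis by blast
  qed
  finally show ?thesis by (simp add: N_def)
qed

section \<open>Colourings that separate a tuple of sets\<close>

text \<open>A cycle that meets \<open>A ! j\<close> is forced to have colour \<open>j\<close>, a
  cycle that meets none of the sets may have any of the \<open>K\<close> colours, and a cycle that
  meets two of them admits no colour at all. So the count yields both the separation condition and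
  the power with exponent \<open>uc\<close>.\<close>

lemma card_separating_colourings:
  assumes p: "\<sigma> permutes {1..n}" and A: "\<And>j. j < length A \<Longrightarrow> A ! j \<subseteq> {1..n}" and k: "length A \<le> K"
  shows "card {g \<in> {1..n} \<rightarrow>\<^sub>E {..<K}. (\<forall>i\<in>{1..n}. g (\<sigma> i) = g i) \<and> (\<forall>j<length A. \<forall>x\<in>A ! j. g x = j)} =
    (if separated n A \<sigma> then K ^ card {C \<in> cycles_on n \<sigma>. C \<inter> \<Union>(set A) = {}} else 0)"
proof -
  define N where "N = {1..n}"
  define Cs where "Cs = orbit \<sigma> ` N"
  define B where "B C = {v \<in> {..<K}. \<forall>j<length A. C \<inter> A ! j \<noteq> {} \<longrightarrow> v = j}" for C
  have fin: "finite N" and pN: "\<sigma> permutes N" using p by (simp_all add: N_def)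
  have finC: "finite Cs" using fin by (simp add: Cs_def)
  have cyc: "cycles_on n \<sigma> = Cs" by (simp add: cycles_on_def Cs_def N_def)
  have "card {g \<in> N \<rightarrow>\<^sub>E {..<K}. (\<forall>i\<in>N. g (\<sigma> i) = g i) \<and> (\<forall>j<length A. \<forall>x\<in>A ! j. g x = j)} =
      card {g \<in> {g \<in> N \<rightarrow>\<^sub>E {..<K}. \<forall>i\<in>N. g (\<sigma> i) = g i}. \<forall>j<length A. \<forall>x\<in>A ! j. g x = j}"
    by (rule arg_cong[of _ _ card]) blast
  also have "\<dots> = card {G \<in> Cs \<rightarrow>\<^sub>E {..<K}. \<forall>j<length A. \<forall>x\<in>A ! j. (\<lambda>i\<in>N. G (orbit \<sigma> i)) x = j}"
    unfolding Cs_def by (rule card_bij_betw_Collect[OF bij_betw_invariant_colourings[OF pN fin], symmetric])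
  also have "{G \<in> Cs \<rightarrow>\<^sub>E {..<K}. \<forall>j<length A. \<forall>x\<in>A ! j. (\<lambda>i\<in>N. G (orbit \<sigma> i)) x = j} = (\<Pi>\<^sub>E C\<in>Cs. B C)"
  proof (intro set_eqI iffI)
    fix G assume G: "G \<in> {G \<in> Cs \<rightarrow>\<^sub>E {..<K}. \<forall>j<length A. \<forall>x\<in>A ! j. (\<lambda>i\<in>N. G (orbit \<sigma> i)) x = j}"
    have "G C = j" if C: "C \<in> Cs" "j < length A" "C \<inter> A ! j \<noteq> {}" for C j
    proof -
      obtain x where x: "x \<in> C" "x \<in> A ! j" using C(3) by blast
      obtain i where i: "C = orbit \<sigma> i" using C(1) unfolding Cs_def by blast
      have "orbit \<sigma> x = C" using orbit_eq_of_mem[OF pN fin, of x i] x i by simp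
      moreover have "x \<in> N" using A[OF C(2)] x(2) by (auto simp: N_def)
      moreover have "(\<lambda>i\<in>N. G (orbit \<sigma> i)) x = j" using G C(2) x(2) by blast
      ultimately show ?thesis by simp
    qed
    moreover have "G C < K" if "C \<in> Cs" for C using G that by auto
    moreover have "G \<in> extensional Cs" using G by (simp add: PiE_def)
    ultimately show "G \<in> (\<Pi>\<^sub>E C\<in>Cs. B C)" unfolding PiE_def B_def by blast
  next
    fix G assume G: "G \<in> (\<Pi>\<^sub>E C\<in>Cs. B C)"
    have "(\<lambda>i\<in>N. G (orbit \<sigma> i)) x = j" if j: "j < length A" "x \<in> A ! j" for j x
    proof -
      have x: "x \<in> N" using A[OF j(1)] j(2) by (auto simp: N_def)
      hence "G (orbit \<sigma> x) \<in> B (orbit \<sigma> x)" using G by (auto simp: Cs_def)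
      moreover have "orbit \<sigma> x \<inter> A ! j \<noteq> {}" using self_in_orbit[OF pN fin, of x] j(2) by blast
      ultimately show ?thesis using x j(1) by (simp add: B_def)
    qed
    moreover have "G \<in> Cs \<rightarrow>\<^sub>E {..<K}" using G unfolding PiE_def B_def by blast
    ultimately show "G \<in> {G \<in> Cs \<rightarrow>\<^sub>E {..<K}. \<forall>j<length A. \<forall>x\<in>A ! j. (\<lambda>i\<in>N. G (orbit \<sigma> i)) x = j}"
      by blast
  qed
  also have "card (\<Pi>\<^sub>E C\<in>Cs. B C) = (\<Prod>C\<in>Cs. card (B C))" by (rule card_PiE[OF finC])
  also have "\<dots> = (if separated n A \<sigma> then K ^ card {C \<in> Cs. C \<inter> \<Union>(set A) = {}} else 0)"
  proof (cases "separated n A \<sigma>")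
    case True
    have "card (B C) = (if C \<inter> \<Union>(set A) = {} then K else 1)" if C: "C \<in> Cs" for C
    proof (cases "C \<inter> \<Union>(set A) = {}")
      case t: True
      have "B C = {..<K}" unfolding B_def using t nth_mem[of _ A] by blast
      thus ?thesis using t by simp
    next
      case False
      then obtain j where j: "j < length A" "C \<inter> A ! j \<noteq> {}"
        by (metis Int_Union disjoint_iff UnionE in_set_conv_nth IntE UnionI)
      have "B C = {j}"
      proof
        show "B C \<subseteq> {j}" using j unfolding B_def by blast
        have "j = j'" if "j' < length A" "C \<inter> A ! j' \<noteq> {}" for j'
          using True C j that unfolding separated_def cyc by blast
        thus "{j} \<subseteq> B C" using j(1) k unfolding B_def by auto
      qed
      thus ?thesis by (simp only: False if_False) simp
    qed
    hence "(\<Prod>C\<in>Cs. card (B C)) = (\<Prod>C\<in>Cs. if C \<inter> \<Union>(set A) = {} then K else 1)"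
      by (rule prod.cong[OF refl])
    also have "\<dots> = (\<Prod>C\<in>{C \<in> Cs. C \<inter> \<Union>(set A) = {}}. K)"
      by (rule prod.inter_filter[OF finC, symmetric])
    finally show ?thesis using True by simp
  next
    case False
    then obtain C i j where C: "C \<in> Cs" "i < length A" "j < length A" "C \<inter> A ! i \<noteq> {}" "C \<inter> A ! j \<noteq> {}" "i \<noteq> j"
      unfolding separated_def cyc by blast
    have "B C = {}" unfolding B_def using C by blast
    hence "\<exists>C\<in>Cs. card (B C) = 0" using C(1) by (intro bexI[of _ C]) simp_all
    hence "(\<Prod>C\<in>Cs. card (B C)) = 0" using finC by (simp add: prod_zero_iff)
    thus ?thesis using False by simp
  qed
  finally show ?thesis by (simp add: N_def cyc)
qed

text \<open>Given \<open>g\<close>, the set \<open>A ! j\<close> is an arbitrary subset of the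
  colour class of \<open>j\<close> with \<open>\<alpha> ! j\<close> elements. Disjointness comes for
  free, since distinct colour classes are disjoint.\<close>

lemma card_disjoint_tuples_below:
  "card {A \<in> disjoint_tuples n \<alpha>. \<forall>j<length A. \<forall>x\<in>A ! j. g x = j} =
     (\<Prod>j<length \<alpha>. deg g {1..n} j choose \<alpha> ! j)"
proof -
  define k where "k = length \<alpha>"
  define B where "B j = {B. B \<subseteq> {i \<in> {1..n}. g i = j} \<and> card B = \<alpha> ! j}" for j
  have "bij_betw (\<lambda>f. map f [0..<k]) (\<Pi>\<^sub>E j\<in>{..<k}. B j)
     {A \<in> disjoint_tuples n \<alpha>. \<forall>j<length A. \<forall>x\<in>A ! j. g x = j}"
  proof (rule bij_betw_byWitness[where f' = "\<lambda>A. \<lambda>j\<in>{..<k}. A ! j"])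
    show "\<forall>f\<in>(\<Pi>\<^sub>E j\<in>{..<k}. B j). (\<lambda>j\<in>{..<k}. map f [0..<k] ! j) = f"
      by (auto simp: fun_eq_iff PiE_def extensional_def)
    show "\<forall>A\<in>{A \<in> disjoint_tuples n \<alpha>. \<forall>j<length A. \<forall>x\<in>A ! j. g x = j}. map (\<lambda>j\<in>{..<k}. A ! j) [0..<k] = A"
      by (auto simp: disjoint_tuples_def k_def intro!: nth_equalityI)
    show "(\<lambda>f. map f [0..<k]) ` (\<Pi>\<^sub>E j\<in>{..<k}. B j)
        \<subseteq> {A \<in> disjoint_tuples n \<alpha>. \<forall>j<length A. \<forall>x\<in>A ! j. g x = j}"
    proof (rule image_subsetI)
      fix f assume "f \<in> (\<Pi>\<^sub>E j\<in>{..<k}. B j)"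
      hence "f j \<in> B j" if "j < k" for j using that by (auto dest: PiE_mem)
      hence f: "f j \<subseteq> {1..n}" "card (f j) = \<alpha> ! j" "\<And>x. x \<in> f j \<Longrightarrow> g x = j" if "j < k" for j
        using that unfolding B_def by blast+
      have "f i \<inter> f j = {}" if "i < k" "j < k" "i \<noteq> j" for i j
        using f(3)[OF that(1)] f(3)[OF that(2)] that(3) by blast
      thus "map f [0..<k] \<in> {A \<in> disjoint_tuples n \<alpha>. \<forall>j<length A. \<forall>x\<in>A ! j. g x = j}"
        using f by (simp add: disjoint_tuples_def k_def)
    qed
    show "(\<lambda>A. \<lambda>j\<in>{..<k}. A ! j) ` {A \<in> disjoint_tuples n \<alpha>. \<forall>j<length A. \<forall>x\<in>A ! j. g x = j}
        \<subseteq> (\<Pi>\<^sub>E j\<in>{..<k}. B j)"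
    proof (rule image_subsetI)
      fix A assume "A \<in> {A \<in> disjoint_tuples n \<alpha>. \<forall>j<length A. \<forall>x\<in>A ! j. g x = j}"
      hence A: "A ! j \<subseteq> {1..n}" "card (A ! j) = \<alpha> ! j" "\<forall>x\<in>A ! j. g x = j" if "j < k" for j
        using that by (simp_all add: disjoint_tuples_def k_def)
      have "A ! j \<in> B j" if "j < k" for j
        unfolding B_def using A[OF that] by blast
      thus "(\<lambda>j\<in>{..<k}. A ! j) \<in> (\<Pi>\<^sub>E j\<in>{..<k}. B j)" by auto
    qed
  qed
  hence "card {A \<in> disjoint_tuples n \<alpha>. \<forall>j<length A. \<forall>x\<in>A ! j. g x = j} = card (\<Pi>\<^sub>E j\<in>{..<k}. B j)"
    by (rule bij_betw_same_card[symmetric])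
  also have "\<dots> = (\<Prod>j<k. card (B j))" by (rule card_PiE) simp
  also have "\<dots> = (\<Prod>j<k. deg g {1..n} j choose \<alpha> ! j)"
    unfolding B_def deg_def by (rule prod.cong[OF refl], rule n_subsets) simp
  finally show ?thesis by (simp add: k_def)
qed

section \<open>Sums of products of binomial coefficients over class sizes\<close>

text \<open>The expansion of \<open>1 / (1 - X)\<close> to the power \<open>d + 1\<close>.\<close>

definition binom_fps :: "nat \<Rightarrow> rat fps" where
  "binom_fps d = Abs_fps (\<lambda>i. of_nat ((i + d) choose d))"

text \<open>On coefficients this is Pascal's rule.\<close>

lemma one_minus_X_mult_binom_fps_Suc: "(1 - fps_X) * binom_fps (Suc d) = binom_fps d"
proof (rule fps_ext)
  fix i
  show "fps_nth ((1 - fps_X) * binom_fps (Suc d)) i = fps_nth (binom_fps d) i"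
    by (cases i) (simp_all add: left_diff_distrib binom_fps_def)
qed

lemma one_minus_X_power_mult_binom_fps: "(1 - fps_X) ^ Suc d * binom_fps d = 1"
proof (induction d)
  case 0
  show ?case
  proof (rule fps_ext)
    fix i
    show "fps_nth ((1 - fps_X) ^ Suc 0 * binom_fps 0) i = fps_nth 1 i"
      by (cases i) (simp_all add: left_diff_distrib binom_fps_def)
  qed
next
  case (Suc d)
  have "(1 - fps_X) ^ Suc (Suc d) * binom_fps (Suc d) = (1 - fps_X) ^ Suc d * ((1 - fps_X) * binom_fps (Suc d))"
    by (simp add: mult_ac)
  thus ?case by (simp only: one_minus_X_mult_binom_fps_Suc Suc)
qed

lemma binomial_fps_eq: "Abs_fps (\<lambda>i. of_nat (i choose a)) = fps_X ^ a * binom_fps a"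
  by (rule fps_ext) (simp add: fps_X_power_mult_nth binom_fps_def binomial_eq_0)

lemma positive_fps_eq: "Abs_fps (\<lambda>i. of_bool (0 < i)) = fps_X * binom_fps 0"
  by (rule fps_ext) (simp add: binom_fps_def)

text \<open>The left side is the coefficient of X^n in a product with a factor X^a / (1-X)^(a+1) for
  each reserved colour and a factor X / (1-X) for each colour in \<open>R\<close>. With r = card R
  the product is X^(m+r) / (1-X)^(m+k+r), so the individual \<open>a j\<close> matter only through
  their sum.\<close>

lemma sum_prod_binomial:
  fixes a :: "nat \<Rightarrow> nat" and n :: nat
  assumes n: "1 \<le> n" and R: "finite R" "R \<inter> {..<k} = {}"
  defines "m \<equiv> (\<Sum>j<k. a j)"
  shows "(\<Sum>X\<in>multisets_of_size ({..<k} \<union> R) n.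
      (\<Prod>j<k. count X j choose a j) * (\<Prod>j\<in>R. of_bool (0 < count X j))) =
    (if m + card R \<le> n then (n + k - 1) choose (n - m - card R) else 0)"
proof -
  define r where "r = card R"
  define M where "M = m + k + r"
  define f where "f j = (if j < k then Abs_fps (\<lambda>i. of_nat (i choose a j)) else Abs_fps (\<lambda>i. of_bool (0 < i)) :: rat fps)" for j
  define A where "A = {..<k} \<union> R"
  have disj: "{..<k} \<inter> R = {}" using R(2) by blast
  have finA: "finite A" using R(1) by (simp add: A_def)
  have split: "(\<Prod>j\<in>A. h j) = (\<Prod>j<k. h j) * (\<Prod>j\<in>R. h j)" for h :: "nat \<Rightarrow> 'z::comm_monoid_mult"
    unfolding A_def by (rule prod.union_disjoint) (use R disj in auto)
  have fR: "f j = Abs_fps (\<lambda>i. of_bool (0 < i))" if "j \<in> R" for j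
    using that disj by (auto simp: f_def)
  have "rat_of_nat (\<Sum>X\<in>multisets_of_size A n.
      (\<Prod>j<k. count X j choose a j) * (\<Prod>j\<in>R. of_bool (0 < count X j))) = fps_nth (\<Prod>j\<in>A. f j) n"
    unfolding fps_prod_nth'[OF finA] of_nat_sum
  proof (rule sum.cong[OF refl])
    fix X
    have "(\<Prod>j\<in>R. fps_nth (f j) (count X j)) = (\<Prod>j\<in>R. of_bool (0 < count X j))"
      by (rule prod.cong) (simp_all add: fR)
    thus "rat_of_nat ((\<Prod>j<k. count X j choose a j) * (\<Prod>j\<in>R. of_bool (0 < count X j))) =
        (\<Prod>j\<in>A. fps_nth (f j) (count X j))"
      unfolding split by (simp add: f_def)
  qed
  also have "(\<Prod>j\<in>A. f j) = (\<Prod>j<k. fps_X ^ a j * binom_fps (a j)) * (\<Prod>j\<in>R. fps_X * binom_fps 0)"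
    unfolding split using fR by (simp add: f_def binomial_fps_eq positive_fps_eq)
  finally have lhs: "rat_of_nat (\<Sum>X\<in>multisets_of_size A n.
      (\<Prod>j<k. count X j choose a j) * (\<Prod>j\<in>R. of_bool (0 < count X j))) =
      fps_nth ((\<Prod>j<k. fps_X ^ a j * binom_fps (a j)) * (\<Prod>j\<in>R. fps_X * binom_fps 0)) n" .
  define P :: "rat fps" where "P = (\<Prod>j<k. fps_X ^ a j * binom_fps (a j)) * (\<Prod>j\<in>R. fps_X * binom_fps 0)"
  have P: "(1 - fps_X) ^ M * P = fps_X ^ (m + r)"
  proof -
    have "(1 - fps_X) ^ M = (\<Prod>j<k. (1 - fps_X) ^ Suc (a j)) * (\<Prod>j\<in>R. (1 - fps_X) ^ Suc 0 :: rat fps)"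
      by (simp add: M_def m_def r_def power_add power_sum prod.distrib)
    hence "(1 - fps_X) ^ M * P =
       (\<Prod>j<k. fps_X ^ a j * ((1 - fps_X) ^ Suc (a j) * binom_fps (a j))) * (\<Prod>j\<in>R. fps_X * ((1 - fps_X) ^ Suc 0 * binom_fps 0))"
      unfolding P_def prod.distrib by (simp only: mult_ac)
    also have "\<dots> = (\<Prod>j<k. fps_X ^ a j) * (\<Prod>j\<in>R. fps_X)"
      by (simp only: one_minus_X_power_mult_binom_fps mult_1_right)
    finally show ?thesis by (simp add: m_def r_def power_add power_sum)
  qed
  have "fps_nth P n = of_nat (if m + r \<le> n then (n + k - 1) choose (n - m - r) else 0)"
  proof (cases M)
    \<comment> \<open>The empty product 1 is not of the form \<open>fps_X ^ s * binom_fps d\<close>.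
      Because n is positive its coefficient is 0, in agreement with \<open>n - 1\<close> choose
      \<open>n\<close>.\<close>
    case 0
    hence "m = 0" "r = 0" "k = 0" by (simp_all add: M_def)
    moreover from this have "P = 1" using P 0 by simp
    ultimately show ?thesis using n by (simp add: binomial_eq_0)
  next
    case (Suc d)
    have "(1 - fps_X) ^ M * P = (1 - fps_X) ^ M * (fps_X ^ (m + r) * binom_fps d)"
      unfolding P using one_minus_X_power_mult_binom_fps[of d] by (simp add: Suc mult.left_commute del: power_Suc)
    moreover have "(1 - fps_X :: rat fps) \<noteq> 0"
    proof
      assume "1 - fps_X = (0 :: rat fps)"
      hence "fps_nth (1 - fps_X :: rat fps) 0 = 0" by simp
      thus False by simp
    qed
    ultimately have "P = fps_X ^ (m + r) * binom_fps d" by simp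
    hence "fps_nth P n = (if n < m + r then 0 else of_nat ((n - (m + r) + d) choose d))"
      by (simp add: fps_X_power_mult_nth binom_fps_def)
    moreover have "(n - (m + r) + d) choose d = (n + k - 1) choose (n - m - r)" if "m + r \<le> n"
    proof -
      have "n - (m + r) + d = n + k - 1" using that Suc by (simp add: M_def)
      moreover have "n - (m + r) + d choose d = n - (m + r) + d choose (n - (m + r))"
        by (subst binomial_symmetric) simp_all
      ultimately show ?thesis by simp
    qed
    ultimately show ?thesis by auto
  qed
  hence "rat_of_nat (\<Sum>X\<in>multisets_of_size A n.
      (\<Prod>j<k. count X j choose a j) * (\<Prod>j\<in>R. of_bool (0 < count X j))) =
      of_nat (if m + r \<le> n then (n + k - 1) choose (n - m - r) else 0)"
    unfolding lhs P_def .
  thus ?thesis unfolding of_nat_eq_iff A_def r_def .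
qed

lemma sum_multisets_by_support:
  fixes a :: "nat \<Rightarrow> nat" and n :: nat and \<kappa> :: "nat \<Rightarrow> nat"
  assumes n: "1 \<le> n" and a: "\<And>j. j < k \<Longrightarrow> 0 < a j"
  defines "m \<equiv> (\<Sum>j<k. a j)"
  assumes mn: "m \<le> n"
  shows "(\<Sum>X\<in>multisets_of_size {..<q + k} n. (\<Prod>j<k. count X j choose a j) * \<kappa> (card (set_mset X))) =
    (\<Sum>r=0..n - m. (q choose r) * ((n + k - 1) choose (n - m - r)) * \<kappa> (k + r))"
proof -
  define MM where "MM = multisets_of_size {..<q + k} n"
  define w where "w X = (\<Prod>j<k. count X j choose a j)" for X
  define c where "c r = (if m + r \<le> n then (n + k - 1) choose (n - m - r) else 0)" for r
  have finMM: "finite MM" unfolding MM_def by (rule finite_multisets_of_size) simp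
  have "(\<Sum>X\<in>MM. w X * \<kappa> (card (set_mset X))) =
      (\<Sum>R\<in>Pow {k..<q + k}. \<Sum>X\<in>{X \<in> MM. set_mset X - {..<k} = R}. w X * \<kappa> (card (set_mset X)))"
  proof (rule sum.group[symmetric])
    show "(\<lambda>X. set_mset X - {..<k}) ` MM \<subseteq> Pow {k..<q + k}"
    proof (rule image_subsetI)
      fix X assume "X \<in> MM"
      hence "set_mset X \<subseteq> {..<q + k}" by (simp add: MM_def multisets_of_size_def)
      thus "set_mset X - {..<k} \<in> Pow {k..<q + k}" by auto
    qed
  qed (use finMM in auto)
  also have "\<dots> = (\<Sum>R\<in>Pow {k..<q + k}. c (card R) * \<kappa> (k + card R))"
  proof (rule sum.cong[OF refl])
    fix R assume "R \<in> Pow {k..<q + k}"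
    hence R: "R \<subseteq> {k..<q + k}" "finite R" by (auto intro: finite_subset)
    have disj: "R \<inter> {..<k} = {}" using R(1) by fastforce
    have "w X * \<kappa> (card (set_mset X)) = w X * \<kappa> (k + card R)" if X: "set_mset X - {..<k} = R" for X
    proof (cases "\<forall>j<k. 0 < count X j")
      case True
      hence "{..<k} \<subseteq> set_mset X" by auto
      hence "set_mset X = {..<k} \<union> R" using X by blast
      hence "card (set_mset X) = k + card R"
        using R(2) disj by (simp add: card_Un_disjoint Int_commute)
      thus ?thesis by simp
    next
      case False
      then obtain j where j: "j < k" "\<not> 0 < count X j" by blast
      hence "count X j choose a j = 0" by (intro binomial_eq_0) (use a[OF j(1)] j(2) in linarith)
      hence "w X = 0" unfolding w_def using j(1) by (intro prod_zero) auto
      thus ?thesis by simp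
    qed
    hence "(\<Sum>X\<in>{X \<in> MM. set_mset X - {..<k} = R}. w X * \<kappa> (card (set_mset X))) =
        (\<Sum>X\<in>{X \<in> MM. set_mset X - {..<k} = R}. w X) * \<kappa> (k + card R)"
      unfolding sum_distrib_right by (intro sum.cong) simp_all
    also have "(\<Sum>X\<in>{X \<in> MM. set_mset X - {..<k} = R}. w X) =
        (\<Sum>X\<in>multisets_of_size ({..<k} \<union> R) n. w X * (\<Prod>j\<in>R. of_bool (0 < count X j)))"
    proof -
      have pr: "(\<Prod>j\<in>R. of_bool (0 < count X j)) = (if R \<subseteq> set_mset X then 1 else 0 :: nat)" for X
      proof (cases "R \<subseteq> set_mset X")
        case True
        hence "(\<Prod>j\<in>R. of_bool (0 < count X j)) = (1 :: nat)" by (intro prod.neutral) auto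
        thus ?thesis using True by simp
      next
        case False
        then obtain j where "j \<in> R" "j \<notin># X" by blast
        hence "(\<Prod>j\<in>R. of_bool (0 < count X j) :: nat) = 0"
          by (intro prod_zero[OF R(2)]) (auto simp: not_in_iff)
        thus ?thesis using False by simp
      qed
      have fin: "finite (multisets_of_size ({..<k} \<union> R) n)" by (rule finite_multisets_of_size) (use R in simp)
      have "{X \<in> MM. set_mset X - {..<k} = R} = {X \<in> multisets_of_size ({..<k} \<union> R) n. R \<subseteq> set_mset X}"
      proof -
        have "{..<k} \<union> R \<subseteq> {..<q + k}" using R(1) by auto
        hence iff: "Y \<subseteq> {..<q + k} \<and> Y - {..<k} = R \<longleftrightarrow> Y \<subseteq> {..<k} \<union> R \<and> R \<subseteq> Y" for Y
          using disj by blast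
        show ?thesis
        proof (rule set_eqI)
          fix X
          show "X \<in> {X \<in> MM. set_mset X - {..<k} = R} \<longleftrightarrow>
              X \<in> {X \<in> multisets_of_size ({..<k} \<union> R) n. R \<subseteq> set_mset X}"
            unfolding MM_def multisets_of_size_def mem_Collect_eq using iff[of "set_mset X"] by metis
        qed
      qed
      hence "(\<Sum>X\<in>{X \<in> MM. set_mset X - {..<k} = R}. w X) =
          (\<Sum>X\<in>multisets_of_size ({..<k} \<union> R) n. if R \<subseteq> set_mset X then w X else 0)"
        by (simp only: sum.inter_filter[OF fin])
      thus ?thesis unfolding pr by (simp add: if_distrib cong: if_cong)
    qed
    also have "\<dots> = c (card R)"
      unfolding w_def c_def m_def by (rule sum_prod_binomial[OF n R(2) disj])
    finally show "(\<Sum>X\<in>{X \<in> MM. set_mset X - {..<k} = R}. w X * \<kappa> (card (set_mset X))) =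
        c (card R) * \<kappa> (k + card R)" .
  qed
  also have "\<dots> = (\<Sum>r\<in>{0..q}. \<Sum>R\<in>{R \<in> Pow {k..<q + k}. card R = r}. c (card R) * \<kappa> (k + card R))"
  proof (rule sum.group[symmetric])
    show "card ` Pow {k..<q + k} \<subseteq> {0..q}"
    proof (rule image_subsetI)
      fix R assume "R \<in> Pow {k..<q + k}"
      hence "card R \<le> card {k..<q + k}" by (intro card_mono) auto
      thus "card R \<in> {0..q}" by simp
    qed
  qed simp_all
  also have "\<dots> = (\<Sum>r=0..q. (q choose r) * (c r * \<kappa> (k + r)))"
  proof (rule sum.cong[OF refl])
    fix r
    have "card {R \<in> Pow {k..<q + k}. card R = r} = q choose r"
      using n_subsets[of "{k..<q + k}" r] by simp
    thus "(\<Sum>R\<in>{R \<in> Pow {k..<q + k}. card R = r}. c (card R) * \<kappa> (k + card R)) = (q choose r) * (c r * \<kappa> (k + r))"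
      by simp
  qed
  \<comment> \<open>Beyond \<open>q\<close> the binomial vanishes and beyond \<open>n - m\<close>
    the factor \<open>c r\<close> does. The bound must not depend on \<open>q\<close> if the sum is
    to be read as a polynomial in \<open>q\<close>.\<close>
  also have "\<dots> = (\<Sum>r\<in>{0..q} \<union> {0..n - m}. (q choose r) * (c r * \<kappa> (k + r)))"
    by (rule sum.mono_neutral_left) (auto simp: binomial_eq_0)
  also have "\<dots> = (\<Sum>r=0..n - m. (q choose r) * (c r * \<kappa> (k + r)))"
    by (rule sum.mono_neutral_right) (use mn in \<open>auto simp: c_def\<close>)
  also have "\<dots> = (\<Sum>r=0..n - m. (q choose r) * ((n + k - 1) choose (n - m - r)) * \<kappa> (k + r))"
    by (rule sum.cong) (use mn in \<open>auto simp: c_def\<close>)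
  finally show ?thesis by (simp add: MM_def w_def)
qed

section \<open>The generating function\<close>

lemma size_le_sum_mset: "0 \<notin># M \<Longrightarrow> size M \<le> \<Sum>\<^sub># (M :: nat multiset)"
  by (induction M) (auto simp: Suc_le_eq)

lemma finite_partitions_of: "finite (partitions_of n)"
proof (rule finite_subset)
  show "partitions_of n \<subseteq> (\<Union>s\<in>{0..n}. multisets_of_size {1..n} s)"
  proof
    fix lam assume lam: "lam \<in> partitions_of n"
    have "x \<in> {1..n}" if x: "x \<in># lam" for x
    proof -
      obtain M where "lam = add_mset x M" using multi_member_split[OF x] by blast
      hence "x \<le> n" using lam by (auto simp: partitions_of_def)
      moreover have "0 \<notin># lam" using lam by (simp add: partitions_of_def)
      hence "x \<noteq> 0" using x by metis
      ultimately show ?thesis by simp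
    qed
    moreover have "size lam \<le> n" using lam size_le_sum_mset[of lam] by (auto simp: partitions_of_def)
    ultimately show "lam \<in> (\<Union>s\<in>{0..n}. multisets_of_size {1..n} s)"
      by (auto simp: multisets_of_size_def)
  qed
qed (auto intro: finite_multisets_of_size)

lemma cycle_type_in_partitions_of:
  assumes p: "\<pi> permutes {1..n}"
  shows "cycle_type n \<pi> \<in> partitions_of n"
proof -
  have fin: "finite (cycles_on n \<pi>)" by (simp add: cycles_on_def)
  have "card C \<noteq> 0" if C: "C \<in> cycles_on n \<pi>" for C
  proof -
    obtain i where i: "i \<in> {1..n}" "C = orbit \<pi> i" using C unfolding cycles_on_def by blast
    hence "finite C" using permutes_orbit_subset[OF p i(1)] finite_subset by blast
    thus ?thesis using i(2) orbit_nonempty[of \<pi> i] by simp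
  qed
  hence "0 \<notin> card ` cycles_on n \<pi>" by (metis imageE)
  hence "0 \<notin># cycle_type n \<pi>" using fin by (simp add: cycle_type_def)
  moreover have "\<Sum>\<^sub># (cycle_type n \<pi>) = n"
  proof -
    have "\<Sum>\<^sub># (cycle_type n \<pi>) = (\<Sum>C\<in>cycles_on n \<pi>. card C)"
      unfolding cycle_type_def by (simp add: sum_unfold_sum_mset)
    also have "\<dots> = deg (\<lambda>i\<in>{1..n}. 0 :: nat) {1..n} 0"
      using deg_invariant_colouring[OF p finite_atLeastAtMost, of "\<lambda>_. 0 :: nat" 0] by (simp add: cycles_on_def)
    also have "\<dots> = card {1..n}" unfolding deg_def by (rule arg_cong[of _ _ card]) auto
    also have "\<dots> = n" by simp
    finally show ?thesis .
  qed
  ultimately show ?thesis by (simp add: partitions_of_def)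
qed

lemma finite_disjoint_tuples: "finite (disjoint_tuples n \<alpha>)"
proof (rule finite_subset)
  show "disjoint_tuples n \<alpha> \<subseteq> {A. set A \<subseteq> Pow {1..n} \<and> length A = length \<alpha>}"
  proof
    fix A assume A: "A \<in> disjoint_tuples n \<alpha>"
    have "B \<in> Pow {1..n}" if B: "B \<in> set A" for B
    proof -
      obtain i where "i < length A" "B = A ! i" using B by (metis in_set_conv_nth)
      thus ?thesis using A by (simp add: disjoint_tuples_def)
    qed
    thus "A \<in> {A. set A \<subseteq> Pow {1..n} \<and> length A = length \<alpha>}"
      using A by (auto simp: disjoint_tuples_def)
  qed
  show "finite {A. set A \<subseteq> Pow {1..n} \<and> length A = length \<alpha>}"
    by (rule finite_lists_length_eq) (rule finite_Pow_iff[THEN iffD2, OF finite_atLeastAtMost])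
qed

lemma finite_perms: "finite {\<pi>. \<pi> permutes {1..n :: nat}}"
  by (rule finite_permutations) simp

lemma separated_pairs_eq:
  "separated_pairs n lam \<alpha> = (SIGMA \<pi>:perms_of_type n lam.
     {A \<in> disjoint_tuples n \<alpha>. separated n A (\<pi> \<circ> long_cycle n)})"
  by (auto simp: separated_pairs_def)

lemma finite_perms_of_type: "finite (perms_of_type n lam)"
  by (rule finite_subset[OF _ finite_perms[of n]]) (auto simp: perms_of_type_def)

text \<open>The cycle types split the permutations of \<open>{1..n}\<close> into classes, so the sum
  over partitions and the sums over pairs merge into one sum over permutations, with the coefficient
  of the power sum as a number of colourings.\<close>

lemma mvps_coeff_sep_gf:
  "mvps_coeff (sep_gf n \<alpha> t) \<mu> = (\<Sum>\<pi> | \<pi> permutes {1..n}.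
     (\<Sum>A\<in>{A \<in> disjoint_tuples n \<alpha>. separated n A (\<pi> \<circ> long_cycle n)}. t ^ uc n \<pi> A) *
     of_nat (card {f \<in> colourings {1..n} (Poly_Mapping.lookup \<mu>). \<forall>i\<in>{1..n}. f (\<pi> i) = f i}))"
proof -
  define h where "h \<pi> = (\<Sum>A\<in>{A \<in> disjoint_tuples n \<alpha>. separated n A (\<pi> \<circ> long_cycle n)}. t ^ uc n \<pi> A)" for \<pi>
  define Fc where "Fc \<pi> = card {f \<in> colourings {1..n} (Poly_Mapping.lookup \<mu>). \<forall>i\<in>{1..n}. f (\<pi> i) = f i}" for \<pi>
  have "mvps_coeff (sep_gf n \<alpha> t) \<mu> = (\<Sum>lam\<in>partitions_of n.
      (\<Sum>(\<pi>, A)\<in>separated_pairs n lam \<alpha>. t ^ uc n \<pi> A) * mvps_coeff (power_sum lam) \<mu>)"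
    by (simp add: sep_gf_def mvps_coeff_sum)
  also have "\<dots> = (\<Sum>lam\<in>partitions_of n. \<Sum>\<pi>\<in>{\<pi> \<in> {\<pi>. \<pi> permutes {1..n}}. cycle_type n \<pi> = lam}. h \<pi> * of_nat (Fc \<pi>))"
  proof (rule sum.cong[OF refl])
    fix lam
    have pt: "perms_of_type n lam = {\<pi> \<in> {\<pi>. \<pi> permutes {1..n}}. cycle_type n \<pi> = lam}"
      by (auto simp: perms_of_type_def)
    have "(\<Sum>(\<pi>, A)\<in>separated_pairs n lam \<alpha>. t ^ uc n \<pi> A) = (\<Sum>\<pi>\<in>perms_of_type n lam. h \<pi>)"
      unfolding separated_pairs_eq h_def
      by (rule sum.Sigma[symmetric]) (simp_all add: finite_perms_of_type finite_disjoint_tuples)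
    moreover have "mvps_coeff (power_sum lam :: 'a mvps) \<mu> = of_nat (Fc \<pi>)" if "\<pi> \<in> perms_of_type n lam" for \<pi>
      using mvps_coeff_power_sum_cycle_type[of \<pi> n \<mu>, where ?'a = 'a] that
      by (simp add: perms_of_type_def Fc_def)
    ultimately show "(\<Sum>(\<pi>, A)\<in>separated_pairs n lam \<alpha>. t ^ uc n \<pi> A) * mvps_coeff (power_sum lam) \<mu> =
      (\<Sum>\<pi>\<in>{\<pi> \<in> {\<pi>. \<pi> permutes {1..n}}. cycle_type n \<pi> = lam}. h \<pi> * of_nat (Fc \<pi>))"
      by (simp add: sum_distrib_right pt)
  qed
  also have "\<dots> = (\<Sum>\<pi> | \<pi> permutes {1..n}. h \<pi> * of_nat (Fc \<pi>))"
    by (rule sum.group[OF finite_perms finite_partitions_of]) (use cycle_type_in_partitions_of in auto)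
  finally show ?thesis by (simp add: h_def Fc_def)
qed

lemma count_image_mset_eq_deg: "finite N \<Longrightarrow> count (image_mset g (mset_set N)) a = deg g N a"
  by (auto simp: count_image_mset' deg_def count_mset_set intro!: arg_cong[of _ _ card])

lemma sum_lookup_eq_card:
  assumes "finite N" "f \<in> colourings N \<gamma>"
  shows "sum \<gamma> {a. \<gamma> a > 0} = card N"
proof -
  have d: "deg f N a = \<gamma> a" for a using assms(2) by (simp add: colourings_def)
  have "card N = (\<Sum>a\<in>f ` N. card {i \<in> N. f i = a})"
    by (rule card_eq_sum_fibers) (use assms in auto)
  thus ?thesis using d by (simp add: deg_def colourings_image[OF assms(1) d, symmetric])
qed

text \<open>This is the coefficient of one monomial in the claimed identity for t = q. The power of
  \<open>q + k\<close> becomes a sum over colourings \<open>g\<close>; summed over \<open>A\<close>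
  it depends on the class sizes of \<open>g\<close> alone, and the triples with given class sizes
  are counted by \<open>card_factorisations\<close>, whose value depends only on the numbers of
  nonempty classes.\<close>

lemma sum_separated_eq:
  fixes \<alpha> :: "nat list" and n q :: nat and \<gamma> :: "nat \<Rightarrow> nat"
  assumes n: "1 \<le> n" and \<alpha>: "is_composition \<alpha> m" and m: "m \<le> n"
    and \<gamma>: "finite {a. \<gamma> a > 0}" "sum \<gamma> {a. \<gamma> a > 0} = n"
  defines "k \<equiv> length \<alpha>" and "p \<equiv> card {a. \<gamma> a > 0}"
  shows "(\<Sum>\<pi> | \<pi> permutes {1..n}.
      (\<Sum>A\<in>{A \<in> disjoint_tuples n \<alpha>. separated n A (\<pi> \<circ> long_cycle n)}. (q + k) ^ uc n \<pi> A) *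
      card {f \<in> colourings {1..n} \<gamma>. \<forall>i\<in>{1..n}. f (\<pi> i) = f i}) =
    (\<Sum>r=0..n - m. (q choose r) * ((n + k - 1) choose (n - m - r)) *
       (if p + (k + r) \<le> n + 1 then n * fact (n - p) * fact (n - (k + r)) div fact (n + 1 - p - (k + r)) else 0))"
proof -
  define N where "N = {1..n}"
  define c where "c = long_cycle n"
  define K where "K = q + k"
  define Fc where "Fc \<pi> = {f \<in> colourings N \<gamma>. \<forall>i\<in>N. f (\<pi> i) = f i}" for \<pi>
  define Gc where "Gc \<pi> X = {g \<in> colourings N (count X). \<forall>i\<in>N. g (\<pi> (c i)) = g i}" for \<pi> and X :: "nat multiset"
  define w where "w X = (\<Prod>j<k. count X j choose \<alpha> ! j)" for X
  define MM where "MM = multisets_of_size {..<K} n"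
  \<comment> \<open>The count of \<open>card_factorisations\<close> for \<open>p\<close> and
    \<open>s\<close> nonempty classes; there the quotient is an exact cardinality.\<close>
  define \<kappa> where "\<kappa> s = (if p + s \<le> n + 1 then n * fact (n - p) * fact (n - s) div fact (n + 1 - p - s) else 0)" for s :: nat
  have finN: "finite N" by (simp add: N_def)
  have finMM: "finite MM" unfolding MM_def by (rule finite_multisets_of_size) simp
  have cp: "c permutes N" unfolding c_def N_def by (rule long_cycle_permutes)
  have inner: "(\<Sum>A\<in>{A \<in> disjoint_tuples n \<alpha>. separated n A (\<pi> \<circ> c)}. K ^ uc n \<pi> A) = (\<Sum>X\<in>MM. w X * card (Gc \<pi> X))"
    if \<pi>: "\<pi> permutes N" for \<pi>
  proof -
    define G where "G = {g \<in> N \<rightarrow>\<^sub>E {..<K}. \<forall>i\<in>N. g (\<pi> (c i)) = g i}"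
    have finG: "finite G"
      unfolding G_def by (rule finite_subset[OF _ finite_PiE[of N "\<lambda>_. {..<K}"]]) (use finN in auto)
    have \<sigma>: "\<pi> \<circ> c permutes {1..n}" using permutes_compose[OF cp \<pi>] by (simp add: N_def)
    have "(\<Sum>A\<in>{A \<in> disjoint_tuples n \<alpha>. separated n A (\<pi> \<circ> c)}. K ^ uc n \<pi> A) =
        (\<Sum>A\<in>disjoint_tuples n \<alpha>. if separated n A (\<pi> \<circ> c) then K ^ uc n \<pi> A else 0)"
      by (rule sum.inter_filter[OF finite_disjoint_tuples])
    also have "\<dots> = (\<Sum>A\<in>disjoint_tuples n \<alpha>. card {g \<in> G. \<forall>j<length A. \<forall>x\<in>A ! j. g x = j})"
    proof (rule sum.cong[OF refl])
      fix A assume A: "A \<in> disjoint_tuples n \<alpha>"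
      have "A ! j \<subseteq> {1..n}" if "j < length A" for j using A that by (simp add: disjoint_tuples_def)
      moreover have "length A \<le> K" using A by (simp add: disjoint_tuples_def K_def k_def)
      ultimately have "card {g \<in> {1..n} \<rightarrow>\<^sub>E {..<K}. (\<forall>i\<in>{1..n}. g ((\<pi> \<circ> c) i) = g i) \<and> (\<forall>j<length A. \<forall>x\<in>A ! j. g x = j)} =
          (if separated n A (\<pi> \<circ> c) then K ^ card {C \<in> cycles_on n (\<pi> \<circ> c). C \<inter> \<Union>(set A) = {}} else 0)"
        by (rule card_separating_colourings[OF \<sigma>])
      thus "(if separated n A (\<pi> \<circ> c) then K ^ uc n \<pi> A else 0) =
          card {g \<in> G. \<forall>j<length A. \<forall>x\<in>A ! j. g x = j}"
        unfolding uc_def c_def[symmetric] G_def N_def by (simp add: conj_assoc)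
    qed
    also have "\<dots> = (\<Sum>g\<in>G. card {A \<in> disjoint_tuples n \<alpha>. \<forall>j<length A. \<forall>x\<in>A ! j. g x = j})"
      by (rule sum_multicount_gen[OF finite_disjoint_tuples finG]) simp
    also have "\<dots> = (\<Sum>g\<in>G. w (image_mset g (mset_set N)))"
      unfolding card_disjoint_tuples_below w_def count_image_mset_eq_deg[OF finN] by (simp add: N_def k_def)
    \<comment> \<open>The multiset \<open>X\<close> of the colours taken by \<open>g\<close> records
      its class sizes as multiplicities.\<close>
    also have "\<dots> = (\<Sum>X\<in>MM. \<Sum>g\<in>{g \<in> G. image_mset g (mset_set N) = X}. w (image_mset g (mset_set N)))"
    proof (rule sum.group[OF finG finMM, symmetric], rule image_subsetI)
      fix g assume "g \<in> G"
      thus "image_mset g (mset_set N) \<in> MM"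
        unfolding MM_def multisets_of_size_def G_def using finN by (auto simp: N_def)
    qed
    also have "\<dots> = (\<Sum>X\<in>MM. w X * card (Gc \<pi> X))"
    proof (rule sum.cong[OF refl])
      fix X assume X: "X \<in> MM"
      have "{g \<in> G. image_mset g (mset_set N) = X} = Gc \<pi> X"
      proof (intro set_eqI iffI)
        fix g assume "g \<in> {g \<in> G. image_mset g (mset_set N) = X}"
        thus "g \<in> Gc \<pi> X"
          using count_image_mset_eq_deg[OF finN, of g] by (auto simp: G_def Gc_def colourings_def PiE_def)
      next
        fix g assume g: "g \<in> Gc \<pi> X"
        have im: "image_mset g (mset_set N) = X"
          using g count_image_mset_eq_deg[OF finN, of g] by (auto simp: Gc_def colourings_def multiset_eq_iff)
        have "g i < K" if "i \<in> N" for i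
        proof -
          have "g i \<in># X" unfolding im[symmetric] using that finN by simp
          thus ?thesis using X by (auto simp: MM_def multisets_of_size_def)
        qed
        thus "g \<in> {g \<in> G. image_mset g (mset_set N) = X}"
          using im g by (auto simp: G_def Gc_def colourings_def PiE_def)
      qed
      moreover have "(\<Sum>g\<in>{g \<in> G. image_mset g (mset_set N) = X}. w (image_mset g (mset_set N))) =
          (\<Sum>g\<in>{g \<in> G. image_mset g (mset_set N) = X}. w X)" by (rule sum.cong) auto
      ultimately show "(\<Sum>g\<in>{g \<in> G. image_mset g (mset_set N) = X}. w (image_mset g (mset_set N))) = w X * card (Gc \<pi> X)"
        by (simp add: mult.commute)
    qed
    finally show ?thesis .
  qed
  have finFc: "finite (Fc \<pi>)" for \<pi> unfolding Fc_def using finite_colourings[OF finN \<gamma>(1)] by simp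
  have finGc: "finite (Gc \<pi> X)" for \<pi> X
    unfolding Gc_def using finite_colourings[OF finN, of "count X"] by simp
  have facts: "(\<Sum>\<pi> | \<pi> permutes N. card (Fc \<pi>) * card (Gc \<pi> X)) = card (factorisations n \<gamma> (count X))" for X
  proof -
    have "factorisations n \<gamma> (count X) = (SIGMA \<pi>:{\<pi>. \<pi> permutes N}. Fc \<pi> \<times> Gc \<pi> X)"
      by (auto simp: factorisations_def Fc_def Gc_def N_def c_def)
    thus ?thesis using finFc finGc finite_permutations[OF finN]
      by (simp add: card_SigmaI card_cartesian_product)
  qed
  have "card (factorisations n \<gamma> (count X)) = \<kappa> (card (set_mset X))" if X: "X \<in> MM" for X
  proof -
    have s: "{b. count X b > 0} = set_mset X" by auto
    have sz: "sum (count X) (set_mset X) = n" using X by (simp add: MM_def multisets_of_size_def size_multiset_overloaded_eq)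
    show ?thesis
    proof (cases "p + card (set_mset X) \<le> n + 1")
      case True
      have "card (factorisations n \<gamma> (count X)) * fact (n + 1 - p - card (set_mset X)) =
          n * fact (n - p) * fact (n - card (set_mset X))"
        using card_factorisations(1)[OF n \<gamma>, of "count X", unfolded s p_def[symmetric]] sz True by simp
      hence "n * fact (n - p) * fact (n - card (set_mset X)) div fact (n + 1 - p - card (set_mset X)) =
         card (factorisations n \<gamma> (count X))"
        by (metis fact_nonzero nonzero_mult_div_cancel_right)
      thus ?thesis using True by (simp add: \<kappa>_def)
    next
      case False
      thus ?thesis
        using card_factorisations(2)[OF n \<gamma>, of "count X", unfolded s p_def[symmetric]] sz by (simp add: \<kappa>_def)
    qed
  qed note cf = this
  have mk: "m = (\<Sum>j<k. \<alpha> ! j)"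
    using \<alpha> by (simp add: is_composition_def k_def sum_list_sum_nth atLeast0LessThan)
  have "(\<Sum>\<pi> | \<pi> permutes N.
      (\<Sum>A\<in>{A \<in> disjoint_tuples n \<alpha>. separated n A (\<pi> \<circ> c)}. K ^ uc n \<pi> A) * card (Fc \<pi>)) =
      (\<Sum>\<pi> | \<pi> permutes N. \<Sum>X\<in>MM. w X * (card (Fc \<pi>) * card (Gc \<pi> X)))"
    by (rule sum.cong[OF refl]) (simp add: inner sum_distrib_left mult_ac)
  also have "\<dots> = (\<Sum>X\<in>MM. w X * (\<Sum>\<pi> | \<pi> permutes N. card (Fc \<pi>) * card (Gc \<pi> X)))"
    unfolding sum_distrib_left by (rule sum.swap)
  also have "\<dots> = (\<Sum>X\<in>MM. w X * \<kappa> (card (set_mset X)))"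
    by (rule sum.cong[OF refl]) (simp add: facts cf)
  also have "\<dots> = (\<Sum>r=0..n - m. (q choose r) * ((n + k - 1) choose (n - m - r)) * \<kappa> (k + r))"
    unfolding MM_def w_def K_def mk
  proof (rule sum_multisets_by_support[OF n])
    show "0 < \<alpha> ! j" if "j < k" for j using \<alpha> that by (auto simp: is_composition_def k_def)
    show "(\<Sum>j<k. \<alpha> ! j) \<le> n" using m mk by simp
  qed
  finally show ?thesis unfolding N_def c_def K_def Fc_def \<kappa>_def .
qed

section \<open>From natural numbers to arbitrary values of t\<close>

lemma poly_eq_if_eq_on_nat:
  fixes P Q :: "'a::field_char_0 poly"
  assumes "\<And>q :: nat. poly P (of_nat q) = poly Q (of_nat q)"
  shows "P = Q"
proof (rule ccontr)
  assume "P \<noteq> Q"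
  hence "finite {x. poly (P - Q) x = 0}" by (intro poly_roots_finite) simp
  moreover have "range (of_nat :: nat \<Rightarrow> 'a) \<subseteq> {x. poly (P - Q) x = 0}" using assms by auto
  ultimately have "finite (range (of_nat :: nat \<Rightarrow> 'a))" by (rule rev_finite_subset)
  thus False using finite_imageD[of "of_nat :: nat \<Rightarrow> 'a" UNIV] inj_of_nat infinite_UNIV_nat by blast
qed

lemma gchoose_eq_poly:
  "\<exists>P. \<forall>t :: 'a::field_char_0. poly P t = t gchoose r"
proof
  show "\<forall>t :: 'a. poly (smult (1 / fact r) (\<Prod>i=0..<r. [:- of_nat i, 1:])) t = t gchoose r"
    by (simp add: poly_prod gbinomial_prod_rev)
qed

lemma image_mset_lookup_in_partitions_of:
  "image_mset (Poly_Mapping.lookup \<mu>) (mset_set (Poly_Mapping.keys \<mu>)) \<in> partitions_of n \<longleftrightarrow>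
     sum (Poly_Mapping.lookup \<mu>) (Poly_Mapping.keys \<mu>) = n"
  by (auto simp: partitions_of_def sum_unfold_sum_mset in_keys_iff)

text \<open>The identity is compared at each exponent \<open>\<mu>\<close>. If the total degree
  differs from \<open>n\<close>, both coefficients vanish. Otherwise both are polynomials in
  \<open>t\<close> that agree at all natural numbers, and on the right only the \<open>m\<close> of
  the shape of \<open>\<mu>\<close> contributes, whose length is the number \<open>p\<close> of
  variables.\<close>

theorem sep_gf_eq:
  fixes t :: "'a::field_char_0"
  assumes n: "1 \<le> n" and \<alpha>: "is_composition \<alpha> m" and m: "m \<le> n" and k: "k = length \<alpha>"
  shows "sep_gf n \<alpha> (t + of_nat k) =
      (\<Sum>r=0..n - m. mvps_scale ((t gchoose r) * of_nat ((n + k - 1) choose (n - m - r)))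
        (\<Sum>lam | lam \<in> partitions_of n \<and> size lam \<le> n - k - r + 1.
          mvps_scale (of_nat n * fact (n - size lam) * fact (n - k - r) /
                      fact (n - k - r + 1 - size lam))
            (monomial_sym lam)))" (is "_ = ?R")
proof (rule mvps_eqI)
  fix \<mu> :: "nat \<Rightarrow>\<^sub>0 nat"
  define p where "p = card (Poly_Mapping.keys \<mu>)"
  define ty where "ty = image_mset (Poly_Mapping.lookup \<mu>) (mset_set (Poly_Mapping.keys \<mu>))"
  define Fc where "Fc \<pi> = card {f \<in> colourings {1..n} (Poly_Mapping.lookup \<mu>). \<forall>i\<in>{1..n}. f (\<pi> i) = f i}" for \<pi>
  define coef where "coef r = (of_nat n * fact (n - p) * fact (n - k - r) / fact (n - k - r + 1 - p) :: 'a)" for r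
  have keys: "{a. Poly_Mapping.lookup \<mu> a > 0} = Poly_Mapping.keys \<mu>" by (auto simp: in_keys_iff)
  have sz: "size ty = p" by (simp add: ty_def p_def)
  \<comment> \<open>Positive parts give \<open>k \<le> m\<close>, so \<open>n - k - r\<close> is a
    genuine difference in every term of the sum.\<close>
  have kn: "k + r \<le> n" if "r \<le> n - m" for r
  proof -
    have "length xs \<le> sum_list xs" if "\<forall>a\<in>set xs. 0 < a" for xs :: "nat list"
      using that by (induction xs) auto
    from this[of \<alpha>] have "k \<le> m" using \<alpha> k by (simp add: is_composition_def)
    thus ?thesis using that m by linarith
  qed
  have rhs: "mvps_coeff ?R \<mu> =
      (\<Sum>r=0..n - m. (t gchoose r) * of_nat ((n + k - 1) choose (n - m - r)) *
         (if ty \<in> partitions_of n \<and> p \<le> n - k - r + 1 then coef r else 0))"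
  proof -
    have "(\<Sum>lam | lam \<in> partitions_of n \<and> size lam \<le> n - k - r + 1.
          of_nat n * fact (n - size lam) * fact (n - k - r) / fact (n - k - r + 1 - size lam) *
          mvps_coeff (monomial_sym lam :: 'a mvps) \<mu>) =
        (if ty \<in> partitions_of n \<and> p \<le> n - k - r + 1 then coef r else 0)" for r
    proof -
      define L where "L = {lam \<in> partitions_of n. size lam \<le> n - k - r + 1}"
      have "finite L" unfolding L_def using finite_partitions_of by simp
      hence "(\<Sum>lam\<in>L. if ty = lam then of_nat n * fact (n - size lam) * fact (n - k - r) / fact (n - k - r + 1 - size lam) else 0) =
          (if ty \<in> L then coef r else 0)"
        by (simp add: sum.delta coef_def sz)
      moreover have "of_nat n * fact (n - size lam) * fact (n - k - r) / fact (n - k - r + 1 - size lam) *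
          mvps_coeff (monomial_sym lam :: 'a mvps) \<mu> =
          (if ty = lam then of_nat n * fact (n - size lam) * fact (n - k - r) / fact (n - k - r + 1 - size lam) else 0)" for lam
        by (simp add: mvps_coeff_monomial_sym ty_def)
      ultimately show ?thesis by (simp add: L_def sz)
    qed
    thus ?thesis by (simp add: mvps_coeff_sum)
  qed
  show "mvps_coeff (sep_gf n \<alpha> (t + of_nat k)) \<mu> =
     mvps_coeff ?R \<mu>"
  proof (cases "sum (Poly_Mapping.lookup \<mu>) (Poly_Mapping.keys \<mu>) = n")
    case False
    have "colourings {1..n} (Poly_Mapping.lookup \<mu>) = {}"
      using sum_lookup_eq_card[of "{1..n}" _ "Poly_Mapping.lookup \<mu>"] False by (auto simp: keys)
    hence "mvps_coeff (sep_gf n \<alpha> (t + of_nat k)) \<mu> = 0" by (simp add: mvps_coeff_sep_gf)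
    moreover have "ty \<notin> partitions_of n" unfolding ty_def image_mset_lookup_in_partitions_of by (rule False)
    ultimately show ?thesis unfolding rhs by simp
  next
    case True
    have ty: "ty \<in> partitions_of n" unfolding ty_def image_mset_lookup_in_partitions_of by (rule True)
    obtain B where B: "\<And>r (s :: 'a). poly (B r) s = s gchoose r" using gchoose_eq_poly by metis
    \<comment> \<open>Polynomials in \<open>s\<close> for the two coefficients at
      \<open>s + k\<close>; the linear polynomial with coefficients \<open>k\<close> and 1 stands
      for \<open>s + k\<close>.\<close>
    define PL where "PL = (\<Sum>\<pi> | \<pi> permutes {1..n}. smult (of_nat (Fc \<pi>))
      (\<Sum>A\<in>{A \<in> disjoint_tuples n \<alpha>. separated n A (\<pi> \<circ> long_cycle n)}. [:of_nat k, 1 :: 'a:] ^ uc n \<pi> A))"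
    define PR where "PR = (\<Sum>r=0..n - m. smult (of_nat ((n + k - 1) choose (n - m - r)) *
         (if p \<le> n - k - r + 1 then coef r else 0)) (B r))"
    have PL: "poly PL s = mvps_coeff (sep_gf n \<alpha> (s + of_nat k)) \<mu>" for s
      by (simp add: PL_def mvps_coeff_sep_gf poly_sum poly_power Fc_def mult.commute add.commute)
    have PR: "poly PR s = (\<Sum>r=0..n - m. (s gchoose r) * of_nat ((n + k - 1) choose (n - m - r)) *
         (if p \<le> n - k - r + 1 then coef r else 0))" for s
      unfolding PR_def by (simp add: poly_sum B mult_ac)
    have "PL = PR"
    proof (rule poly_eq_if_eq_on_nat)
      fix q :: nat
      define \<kappa> where "\<kappa> s = (if p + s \<le> n + 1 then n * fact (n - p) * fact (n - s) div fact (n + 1 - p - s) else 0)" for s :: nat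
      have "mvps_coeff (sep_gf n \<alpha> (of_nat q + of_nat k :: 'a)) \<mu> = of_nat (\<Sum>\<pi> | \<pi> permutes {1..n}.
        (\<Sum>A\<in>{A \<in> disjoint_tuples n \<alpha>. separated n A (\<pi> \<circ> long_cycle n)}. (q + k) ^ uc n \<pi> A) * Fc \<pi>)"
        by (simp add: mvps_coeff_sep_gf Fc_def)
      also have "\<dots> = of_nat (\<Sum>r=0..n - m. (q choose r) * ((n + k - 1) choose (n - m - r)) * \<kappa> (k + r))"
        unfolding Fc_def \<kappa>_def k p_def
          sum_separated_eq[OF n \<alpha> m, of "Poly_Mapping.lookup \<mu>" q, unfolded keys, OF finite_keys True] ..
      also have "\<dots> = (\<Sum>r=0..n - m. (of_nat q gchoose r) * of_nat ((n + k - 1) choose (n - m - r)) *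
         (if p \<le> n - k - r + 1 then coef r else 0))"
        unfolding of_nat_sum
      proof (rule sum.cong[OF refl])
        fix r assume "r \<in> {0..n - m}"
        hence r: "k + r \<le> n" using kn by simp
        \<comment> \<open>A positive degree involves at least one variable. This makes
          \<open>n + 1 - p - (k + r)\<close> at most \<open>n - (k + r)\<close>, so that the
          natural-number division is exact and agrees with the division in the field.\<close>
        have p0: "p \<noteq> 0"
        proof
          assume "p = 0"
          hence "Poly_Mapping.keys \<mu> = {}" by (simp add: p_def)
          thus False using True n by simp
        qed
        have "of_nat (\<kappa> (k + r)) = (if p \<le> n - k - r + 1 then coef r else 0)"
        proof (cases "p \<le> n - k - r + 1")
          case True
          have e: "n + 1 - p - (k + r) = n - k - r + 1 - p" "n - (k + r) = n - k - r" using True r by linarith+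
          have le: "n + 1 - p - (k + r) \<le> n - (k + r)" using p0 by linarith
          have "of_nat (\<kappa> (k + r)) = (of_nat (n * fact (n - p) * fact (n - (k + r)) div fact (n + 1 - p - (k + r))) :: 'a)"
            using True r by (simp add: \<kappa>_def)
          also have "\<dots> = of_nat (n * fact (n - p) * fact (n - (k + r))) / of_nat (fact (n + 1 - p - (k + r)))"
            by (rule of_nat_of_nat_div) (rule dvd_mult[OF fact_dvd[OF le]])
          finally show ?thesis unfolding e if_P[OF True] coef_def by (simp only: of_nat_mult of_nat_fact)
        next
          case False
          thus ?thesis using r by (simp add: \<kappa>_def)
        qed
        thus "of_nat ((q choose r) * ((n + k - 1) choose (n - m - r)) * \<kappa> (k + r)) =
          (of_nat q gchoose r) * of_nat ((n + k - 1) choose (n - m - r)) * (if p \<le> n - k - r + 1 then coef r else 0)"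
          by (simp add: binomial_gbinomial)
      qed
      finally show "poly PL (of_nat q) = poly PR (of_nat q)" unfolding PL PR .
    qed
    thus ?thesis unfolding rhs using PL[of t] PR[of t] ty by simp
  qed
qed

section \<open>Linear independence of the power sums\<close>

text \<open>A representative of the monomials of shape \<open>lam\<close>: the parts become the
  exponents of the first \<open>size lam\<close> variables, and sorting merely fixes their
  order.\<close>

definition parts_exponent :: "nat multiset \<Rightarrow> nat \<Rightarrow>\<^sub>0 nat" where
  "parts_exponent lam = (let xs = sorted_list_of_multiset lam in
     \<Sum>i<length xs. Poly_Mapping.single i (xs ! i))"

text \<open>Equal parts need different names before variables can be assigned to them, so the
  multiset is indexed by the numbers below its size.\<close>

lemma power_sum_eq_prod:
  assumes "0 \<notin># lam"
  obtains d where "power_sum lam = (\<Prod>i<size lam. power_sum_var (d i) :: 'a::comm_ring_1 mvps)"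
    "\<And>i. i < size lam \<Longrightarrow> d i > 0" "image_mset d (mset_set {..<size lam}) = lam"
    "parts_exponent lam = (\<Sum>i<size lam. Poly_Mapping.single i (d i))"
proof -
  define xs where "xs = sorted_list_of_multiset lam"
  have xs: "mset xs = lam" by (simp add: xs_def)
  have len: "length xs = size lam" using xs by (metis size_mset)
  have im: "image_mset ((!) xs) (mset_set {..<size lam}) = lam"
  proof -
    have "image_mset ((!) xs) (mset_set {..<size lam}) = mset (map ((!) xs) [0..<length xs])"
      by (simp add: len lessThan_atLeast0)
    thus ?thesis using xs by (simp add: map_nth)
  qed
  have "power_sum lam = (\<Prod>i<size lam. power_sum_var (xs ! i) :: 'a mvps)"
    unfolding power_sum_def by (subst im[symmetric]) (simp add: prod_unfold_prod_mset multiset.map_comp o_def)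
  moreover have "xs ! i > 0" if "i < size lam" for i
  proof -
    have "xs ! i \<in># lam" using that xs len nth_mem_mset[of i xs] by simp
    thus ?thesis using assms by (metis gr0I)
  qed
  moreover have "parts_exponent lam = (\<Sum>i<size lam. Poly_Mapping.single i (xs ! i))"
    by (simp add: parts_exponent_def Let_def xs_def[symmetric] len)
  ultimately show ?thesis using im that by blast
qed

lemma lookup_sum_single:
  "Poly_Mapping.lookup (\<Sum>i\<in>I. Poly_Mapping.single (F i) (d i)) j = (\<Sum>i\<in>I. if F i = j then d i else (0::nat))"
  by (simp add: lookup_sum lookup_single when_def)

text \<open>Assigning the \<open>i\<close>-th variable to the \<open>i\<close>-th factor is one of
  the assignments counted by the coefficient, and a positive count stays nonzero in characteristic
  0.\<close>

lemma mvps_coeff_parts_exponent_self: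
  assumes "0 \<notin># lam"
  shows "mvps_coeff (power_sum lam :: 'a::field_char_0 mvps) (parts_exponent lam) \<noteq> 0"
proof -
  obtain d where d: "power_sum lam = (\<Prod>i<size lam. power_sum_var (d i) :: 'a mvps)"
    "\<And>i. i < size lam \<Longrightarrow> d i > 0"
    "parts_exponent lam = (\<Sum>i<size lam. Poly_Mapping.single i (d i))"
    using power_sum_eq_prod[OF assms] by metis
  define I where "I = {..<size lam}"
  define \<mu> where "\<mu> = parts_exponent lam"
  define S where "S = {F \<in> I \<rightarrow>\<^sub>E Poly_Mapping.keys \<mu>. (\<Sum>i\<in>I. Poly_Mapping.single (F i) (d i)) = \<mu>}"
  have "Poly_Mapping.lookup \<mu> i = d i" if "i \<in> I" for i
    unfolding \<mu>_def d(3) lookup_sum_single using that by (simp add: I_def)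
  hence "i \<in> Poly_Mapping.keys \<mu>" if "i \<in> I" for i
    using d(2)[of i] that by (auto simp: in_keys_iff I_def)
  hence "restrict (\<lambda>i. i) I \<in> S" by (auto simp: S_def \<mu>_def d(3) I_def)
  moreover have "finite S" unfolding S_def
    by (rule finite_subset[OF _ finite_PiE[of I "\<lambda>_. Poly_Mapping.keys \<mu>"]]) (auto simp: I_def)
  ultimately have "card S \<noteq> 0" by auto
  moreover have "mvps_coeff (power_sum lam :: 'a mvps) \<mu> = of_nat (card S)"
    unfolding d(1) S_def I_def by (rule mvps_coeff_prod_power_sum_var) (use d(2) in auto)
  ultimately show ?thesis by (simp add: \<mu>_def)
qed

text \<open>Triangularity: the monomial of shape \<open>lam\<close> occurs in \<open>p\<^sub>\<nu>\<close> only if \<open>\<nu>\<close> refines \<open>lam\<close>.\<close>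

lemma mvps_coeff_parts_exponent_other:
  assumes lam: "0 \<notin># lam" and nu: "0 \<notin># nu"
    and ne: "mvps_coeff (power_sum nu :: 'a::field_char_0 mvps) (parts_exponent lam) \<noteq> 0"
  shows "size nu > size lam \<or> nu = lam"
proof -
  obtain d where d: "\<And>i. i < size lam \<Longrightarrow> d i > 0"
    "image_mset d (mset_set {..<size lam}) = lam"
    "parts_exponent lam = (\<Sum>i<size lam. Poly_Mapping.single i (d i))"
    using power_sum_eq_prod[OF lam, where ?'a = 'a] by metis
  obtain d' where d': "power_sum nu = (\<Prod>i<size nu. power_sum_var (d' i) :: 'a mvps)"
    "\<And>i. i < size nu \<Longrightarrow> d' i > 0" "image_mset d' (mset_set {..<size nu}) = nu"
    using power_sum_eq_prod[OF nu, where ?'a = 'a] by metis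
  define I where "I = {..<size lam}"
  define J where "J = {..<size nu}"
  define \<mu> where "\<mu> = parts_exponent lam"
  have look: "Poly_Mapping.lookup \<mu> j = (if j \<in> I then d j else 0)" for j
    unfolding \<mu>_def d(3) lookup_sum_single by (auto simp: I_def)
  have "mvps_coeff (power_sum nu :: 'a mvps) \<mu> =
      of_nat (card {F \<in> J \<rightarrow>\<^sub>E Poly_Mapping.keys \<mu>. (\<Sum>i\<in>J. Poly_Mapping.single (F i) (d' i)) = \<mu>})"
    unfolding d'(1) J_def by (rule mvps_coeff_prod_power_sum_var) (use d'(2) in auto)
  hence "{F \<in> J \<rightarrow>\<^sub>E Poly_Mapping.keys \<mu>. (\<Sum>i\<in>J. Poly_Mapping.single (F i) (d' i)) = \<mu>} \<noteq> {}"
    using ne by (metis \<mu>_def card.empty of_nat_0)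
  then obtain F where F: "(\<Sum>i\<in>J. Poly_Mapping.single (F i) (d' i)) = \<mu>" by blast
  have lookF: "Poly_Mapping.lookup \<mu> j = (\<Sum>i\<in>J. if F i = j then d' i else 0)" for j
    unfolding F[symmetric] by (rule lookup_sum_single)
  \<comment> \<open>Every variable of the monomial must receive some part of \<open>nu\<close>, so
    \<open>nu\<close> has at least as many parts as \<open>lam\<close>. With equally many, each
    variable receives exactly one part, which is then its exponent.\<close>
  have sub: "I \<subseteq> F ` J"
  proof
    fix j assume j: "j \<in> I"
    show "j \<in> F ` J"
    proof (rule ccontr)
      assume "j \<notin> F ` J"
      hence "Poly_Mapping.lookup \<mu> j = 0" unfolding lookF by (intro sum.neutral) auto
      thus False using look[of j] j d(1)[of j] by (simp add: I_def)
    qed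
  qed
  have finJ: "finite J" and cIJ: "card I = size lam" "card J = size nu" by (simp_all add: J_def I_def)
  have le: "card I \<le> card (F ` J)" "card (F ` J) \<le> card J"
    using sub finJ by (auto intro: card_mono card_image_le)
  show ?thesis
  proof (cases "size nu > size lam")
    case False
    hence eq: "card (F ` J) = card J" "card (F ` J) = card I" using le cIJ by linarith+
    have inj: "inj_on F J" using eq_card_imp_inj_on[OF finJ eq(1)] .
    have im: "F ` J = I" using card_subset_eq[OF finite_imageI[OF finJ] sub] eq(2) by simp
    have "d' i = d (F i)" if i: "i \<in> J" for i
    proof -
      have "Poly_Mapping.lookup \<mu> (F i) = (\<Sum>l\<in>J. if l = i then d' l else 0)"
        unfolding lookF by (rule sum.cong) (use inj i in \<open>auto simp: inj_on_def\<close>)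
      also have "\<dots> = d' i" using i finJ by simp
      finally show ?thesis using look[of "F i"] im i by auto
    qed
    hence "image_mset d' (mset_set J) = image_mset (\<lambda>i. d (F i)) (mset_set J)"
      by (intro image_mset_cong) (use finJ in simp)
    also have "\<dots> = image_mset d (image_mset F (mset_set J))" by (simp add: multiset.map_comp o_def)
    also have "image_mset F (mset_set J) = mset_set I"
      using image_mset_mset_set[OF inj] im by simp
    finally show ?thesis using d(2) d'(3) by (simp add: I_def J_def)
  qed simp
qed

text \<open>\<open>representation\<close> works with a set of vectors and not with a family, so
  different partitions have to be known to give different power sums.\<close>

lemma power_sum_inj: "inj_on (power_sum :: nat multiset \<Rightarrow> 'a::field_char_0 mvps) {mu. 0 \<notin># mu}"
proof (rule inj_onI)
  fix x y assume x: "x \<in> {mu. 0 \<notin># mu}" and y: "y \<in> {mu. 0 \<notin># mu}"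
    and eq: "power_sum x = (power_sum y :: 'a mvps)"
  have x0: "0 \<notin># x" and y0: "0 \<notin># y" using x y by auto
  have "size y > size x \<or> y = x"
    using mvps_coeff_parts_exponent_other[OF x0 y0, where ?'a = 'a] mvps_coeff_parts_exponent_self[OF x0, where ?'a = 'a] eq by simp
  moreover have "size x > size y \<or> x = y"
    using mvps_coeff_parts_exponent_other[OF y0 x0, where ?'a = 'a] mvps_coeff_parts_exponent_self[OF y0, where ?'a = 'a] eq by simp
  ultimately show "x = y" by auto
qed

text \<open>In a vanishing combination take \<open>lam\<close> of greatest size among the partitions
  with nonzero coefficient. The monomial \<open>parts_exponent lam\<close> could occur in another of
  these power sums only if that one had more parts, so its coefficient isolates the term of
  \<open>lam\<close>.\<close>

lemma power_sum_independent:
  "mvps.independent (power_sum ` {mu. 0 \<notin># mu} :: 'a::field_char_0 mvps set)"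
  unfolding mvps.independent_explicit_finite_subsets
proof (intro allI impI ballI)
  fix S :: "'a mvps set" and u v
  assume S: "S \<subseteq> power_sum ` {mu. 0 \<notin># mu}" "finite S"
    and sum0: "(\<Sum>v\<in>S. mvps_scale (u v) v) = 0" and v: "v \<in> S"
  show "u v = 0"
  proof (rule ccontr)
    assume uv: "u v \<noteq> 0"
    obtain T where T: "T \<subseteq> {mu. 0 \<notin># mu}" "finite T" "S = power_sum ` T"
      using finite_subset_image[OF S(2,1)] by blast
    define T' where "T' = {mu \<in> T. u (power_sum mu) \<noteq> 0}"
    have "finite T'" "T' \<noteq> {}" using T v uv by (auto simp: T'_def)
    then obtain lam where lam: "lam \<in> T'" "\<And>mu. mu \<in> T' \<Longrightarrow> size mu \<le> size lam"
      using Max_in[of "size ` T'"] Max_ge[of "size ` T'"] by (metis (no_types, lifting) finite_imageI image_iff image_is_empty)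
    have l0: "0 \<notin># lam" using lam(1) T(1) by (auto simp: T'_def)
    have injT: "inj_on (power_sum :: nat multiset \<Rightarrow> 'a mvps) T" by (rule inj_on_subset[OF power_sum_inj T(1)])
    have "0 = mvps_coeff (\<Sum>v\<in>S. mvps_scale (u v) v) (parts_exponent lam)" by (simp add: sum0)
    also have "\<dots> = (\<Sum>mu\<in>T. u (power_sum mu) * mvps_coeff (power_sum mu) (parts_exponent lam))"
      unfolding T(3) by (simp add: sum.reindex[OF injT] mvps_coeff_sum)
    also have "\<dots> = (\<Sum>mu\<in>{lam}. u (power_sum mu) * mvps_coeff (power_sum mu) (parts_exponent lam))"
    proof (rule sum.mono_neutral_right[OF T(2)])
      show "{lam} \<subseteq> T" using lam(1) by (simp add: T'_def)
      show "\<forall>mu\<in>T - {lam}. u (power_sum mu) * mvps_coeff (power_sum mu) (parts_exponent lam) = 0"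
      proof
        fix mu assume mu: "mu \<in> T - {lam}"
        show "u (power_sum mu) * mvps_coeff (power_sum mu) (parts_exponent lam) = 0"
        proof (cases "mu \<in> T'")
          case True
          have "0 \<notin># mu" using mu T(1) by auto
          hence "mvps_coeff (power_sum mu :: 'a mvps) (parts_exponent lam) = 0"
            using mvps_coeff_parts_exponent_other[OF l0, of mu, where ?'a = 'a] lam(2)[OF True] mu by fastforce
          thus ?thesis by simp
        next
          case False
          thus ?thesis using mu by (simp add: T'_def)
        qed
      qed
    qed
    finally have "u (power_sum lam) * mvps_coeff (power_sum lam) (parts_exponent lam) = 0" by simp
    thus False using lam(1) mvps_coeff_parts_exponent_self[OF l0, where ?'a = 'a] by (simp add: T'_def)
  qed
qed

lemma power_sum_coeff_sum:
  fixes c :: "nat multiset \<Rightarrow> 'a::field_char_0"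
  assumes P: "finite P" "P \<subseteq> {mu. 0 \<notin># mu}" "lam \<in> P"
  shows "power_sum_coeff lam (\<Sum>mu\<in>P. mvps_scale (c mu) (power_sum mu)) = c lam"
proof -
  define B where "B = (power_sum ` {mu. 0 \<notin># mu} :: 'a mvps set)"
  have ind: "mvps.independent B" unfolding B_def by (rule power_sum_independent)
  have inB: "power_sum mu \<in> B" if "mu \<in> P" for mu using P(2) that by (auto simp: B_def)
  have span: "power_sum mu \<in> mvps.span B" if "mu \<in> P" for mu by (rule mvps.span_base[OF inB[OF that]])
  have "power_sum_coeff lam (\<Sum>mu\<in>P. mvps_scale (c mu) (power_sum mu)) =
      (\<Sum>mu\<in>P. mvps.representation B (mvps_scale (c mu) (power_sum mu)) (power_sum lam))"
    unfolding power_sum_coeff_def B_def[symmetric]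
    by (subst mvps.representation_sum[OF ind]) (auto intro: mvps.span_scale span)
  also have "\<dots> = (\<Sum>mu\<in>P. if mu = lam then c mu else 0)"
  proof (rule sum.cong[OF refl])
    fix mu assume mu: "mu \<in> P"
    have "(power_sum lam = (power_sum mu :: 'a mvps)) \<longleftrightarrow> mu = lam"
      using inj_onD[OF power_sum_inj, where ?'a1 = 'a] P mu by blast
    thus "mvps.representation B (mvps_scale (c mu) (power_sum mu)) (power_sum lam) = (if mu = lam then c mu else 0)"
      by (simp add: mvps.representation_scale[OF ind span[OF mu]] mvps.representation_basis[OF ind inB[OF mu]])
  qed
  also have "\<dots> = c lam" using P by simp
  finally show ?thesis .
qed

text \<open>For t = 1 every pair has weight 1, so the defining sum of \<open>sep_gf\<close> is
  already the expansion in power sums, with the cardinalities as coefficients.\<close>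

theorem card_separated_pairs_eq_power_sum_coeff:
  assumes "lam \<in> partitions_of n"
  shows "of_nat (card (separated_pairs n lam \<alpha>)) = power_sum_coeff lam (sep_gf n \<alpha> (1 :: 'a::field_char_0))"
proof -
  have "sep_gf n \<alpha> (1 :: 'a) = (\<Sum>mu\<in>partitions_of n. mvps_scale (of_nat (card (separated_pairs n mu \<alpha>))) (power_sum mu))"
    by (simp add: sep_gf_def case_prod_unfold)
  thus ?thesis using power_sum_coeff_sum[OF finite_partitions_of _ assms, where ?'a = 'a]
    by (simp add: partitions_of_def subset_iff)
qed

section \<open>The separation probability\<close>

lemma funpow_cycle_of_list:
  assumes "distinct cs" "j < length cs"
  shows "(cycle_of_list cs ^^ i) (cs ! j) = cs ! ((j + i) mod length cs)"
proof -
  have "map (cycle_of_list cs ^^ i) cs ! j = rotate i cs ! j"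
    by (simp only: cyclic_rotation[OF assms(1)])
  thus ?thesis using assms(2) by (simp add: nth_rotate add.commute)
qed

lemma orbit_cycle_of_list:
  assumes "distinct cs" "x \<in> set cs"
  shows "orbit (cycle_of_list cs) x = set cs"
proof
  show "orbit (cycle_of_list cs) x \<subseteq> set cs"
    by (rule permutes_orbit_subset[OF cycle_permutes assms(2)])
  obtain j where j: "j < length cs" "x = cs ! j" using assms(2) by (metis in_set_conv_nth)
  show "set cs \<subseteq> orbit (cycle_of_list cs) x"
  proof
    fix y assume "y \<in> set cs"
    then obtain l where l: "l < length cs" "y = cs ! l" by (metis in_set_conv_nth)
    have "(cycle_of_list cs ^^ (length cs - j + l)) x = y"
      unfolding j(2) l(2) funpow_cycle_of_list[OF assms(1) j(1)] using j(1) l(1) by simp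
    moreover have "0 < length cs - j + l" using j(1) by simp
    ultimately show "y \<in> orbit (cycle_of_list cs) x" unfolding orbit_altdef by blast
  qed
qed

lemma long_cycle_in_perms_of_type:
  assumes "1 \<le> n"
  shows "long_cycle n \<in> perms_of_type n {#n#}"
proof -
  have s: "set [1..<Suc n] = {1..n}" by auto
  have "orbit (long_cycle n) i = {1..n}" if "i \<in> {1..n}" for i
    unfolding long_cycle_def s[symmetric] by (rule orbit_cycle_of_list) (use that s in simp_all)
  hence "cycles_on n (long_cycle n) = (\<lambda>_. {1..n}) ` {1..n}" unfolding cycles_on_def by (rule image_cong[OF refl])
  also have "\<dots> = {{1..n}}" using assms by (simp add: image_constant_conv)
  finally show ?thesis using long_cycle_permutes[of n] by (simp add: perms_of_type_def cycle_type_def)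
qed

text \<open>Each further part \<open>d\<close> adds a cycle on a fresh interval of \<open>d\<close>
  points. The existence is needed because a uniform distribution requires a nonempty set.\<close>

lemma exists_perm_of_cycle_type:
  assumes "0 \<notin># lam"
  shows "\<exists>\<pi>. \<pi> permutes {1..\<Sum>\<^sub># lam} \<and> cycle_type (\<Sum>\<^sub># lam) \<pi> = lam"
  using assms
proof (induction lam)
  case empty
  have "id permutes {1..0 :: nat}" by (rule permutes_id)
  moreover have "cycle_type 0 id = {#}" by (simp add: cycle_type_def cycles_on_def)
  ultimately show ?case by auto
next
  case (add d lam)
  define s where "s = \<Sum>\<^sub># lam"
  define n where "n = s + d"
  define D where "D = {s + 1..n}"
  have d: "d > 0" "0 \<notin># lam" using add.prems by auto
  obtain \<pi> where \<pi>: "\<pi> permutes {1..s}" "cycle_type s \<pi> = lam" using add.IH d(2) by (auto simp: s_def)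
  define \<rho> where "\<rho> = cycle_of_list [s + 1..<Suc n]"
  have sD: "set [s + 1..<Suc n] = D" by (auto simp: D_def)
  have \<rho>: "\<rho> permutes D" using cycle_permutes[of "[s + 1..<Suc n]"] by (simp only: \<rho>_def sD)
  have un: "{1..n} = {1..s} \<union> D" "{1..s} \<inter> D = {}" by (auto simp: n_def D_def)
  have "\<pi> permutes {1..n}" by (rule permutes_subset[OF \<pi>(1)]) (use un in blast)
  moreover have "\<rho> permutes {1..n}" by (rule permutes_subset[OF \<rho>]) (use un in blast)
  ultimately have perm: "\<pi> \<circ> \<rho> permutes {1..n}" by (intro permutes_compose)
  have "orbit (\<pi> \<circ> \<rho>) x = orbit \<pi> x" if x: "x \<in> {1..s}" for x
  proof (rule orbit_cong[OF self_in_orbit[OF \<pi>(1)]])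
    fix y assume "y \<in> orbit \<pi> x"
    hence "y \<in> {1..s}" using permutes_orbit_subset[OF \<pi>(1) x] by blast
    hence "\<rho> y = y" using \<rho> un(2) by (auto simp: permutes_def)
    thus "(\<pi> \<circ> \<rho>) y = \<pi> y" by simp
  qed simp
  moreover have "orbit (\<pi> \<circ> \<rho>) x = D" if x: "x \<in> D" for x
  proof -
    have "orbit (\<pi> \<circ> \<rho>) x = orbit \<rho> x"
    proof (rule orbit_cong[OF self_in_orbit[OF \<rho>]])
      fix y assume "y \<in> orbit \<rho> x"
      hence "\<rho> y \<in> D" using permutes_orbit_subset[OF \<rho> x] permutes_in_image[OF \<rho>] by blast
      hence "\<rho> y \<notin> {1..s}" using un(2) by blast
      thus "(\<pi> \<circ> \<rho>) y = \<rho> y" using \<pi>(1) by (simp add: permutes_def)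
    qed (simp add: D_def)
    also have "\<dots> = D" unfolding \<rho>_def sD[symmetric] by (rule orbit_cycle_of_list) (use x sD in simp_all)
    finally show ?thesis .
  qed
  ultimately have "cycles_on n (\<pi> \<circ> \<rho>) = cycles_on s \<pi> \<union> (\<lambda>_. D) ` D"
    unfolding cycles_on_def un(1) image_Un by (metis (no_types, lifting) image_cong)
  moreover have Dne: "D \<noteq> {}" using d(1) by (simp add: D_def n_def)
  ultimately have cyc: "cycles_on n (\<pi> \<circ> \<rho>) = insert D (cycles_on s \<pi>)" by (simp add: image_constant_conv)
  have "D \<notin> cycles_on s \<pi>"
  proof
    assume "D \<in> cycles_on s \<pi>"
    then obtain x where "x \<in> {1..s}" "D = orbit \<pi> x" unfolding cycles_on_def by blast
    hence "D \<subseteq> {1..s}" using permutes_orbit_subset[OF \<pi>(1)] by blast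
    thus False using un(2) Dne by blast
  qed
  moreover have "finite (cycles_on s \<pi>)" by (simp add: cycles_on_def)
  ultimately have "cycle_type n (\<pi> \<circ> \<rho>) = add_mset (card D) (cycle_type s \<pi>)"
    unfolding cycle_type_def cyc by simp
  moreover have "card D = d" by (simp add: D_def n_def)
  moreover have "\<Sum>\<^sub># (add_mset d lam) = n" by (simp add: n_def s_def)
  ultimately show ?case using perm \<pi>(2) by auto
qed

lemma perms_of_type_nonempty:
  assumes "lam \<in> partitions_of n"
  shows "perms_of_type n lam \<noteq> {}"
  using exists_perm_of_cycle_type[of lam] assms by (auto simp: partitions_of_def perms_of_type_def)

section \<open>Conjugation of permutations\<close>

definition conj_perm :: "('a \<Rightarrow> 'a) \<Rightarrow> ('a \<Rightarrow> 'a) \<Rightarrow> 'a \<Rightarrow> 'a" where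
  "conj_perm \<tau> \<pi> = \<tau> \<circ> \<pi> \<circ> inv \<tau>"

context
  fixes \<tau> :: "nat \<Rightarrow> nat" and n :: nat
  assumes \<tau>: "\<tau> permutes {1..n}"
begin

lemma conj_perm_apply: "conj_perm \<tau> \<pi> (\<tau> x) = \<tau> (\<pi> x)"
  by (simp add: conj_perm_def permutes_inverses(2)[OF \<tau>])

lemma conj_perm_comp: "conj_perm \<tau> (\<pi> \<circ> \<rho>) = conj_perm \<tau> \<pi> \<circ> conj_perm \<tau> \<rho>"
  by (simp add: conj_perm_def fun_eq_iff permutes_inverses(2)[OF \<tau>])

lemma conj_perm_inject: "conj_perm \<tau> \<pi> = conj_perm \<tau> \<rho> \<Longrightarrow> \<pi> = \<rho>"
proof
  fix x assume "conj_perm \<tau> \<pi> = conj_perm \<tau> \<rho>"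
  hence "\<tau> (\<pi> x) = \<tau> (\<rho> x)" by (metis conj_perm_apply)
  thus "\<pi> x = \<rho> x" using permutes_inj[OF \<tau>] by (simp add: inj_eq)
qed

lemma conj_perm_permutes: "\<pi> permutes {1..n} \<Longrightarrow> conj_perm \<tau> \<pi> permutes {1..n}"
  unfolding conj_perm_def by (intro permutes_compose permutes_inv \<tau>)

lemma orbit_conj_perm:
  assumes "\<pi> permutes {1..n}"
  shows "orbit (conj_perm \<tau> \<pi>) (\<tau> x) = \<tau> ` orbit \<pi> x"
  by (rule orbit_inverse[symmetric, OF self_in_orbit[OF assms]]) (simp_all add: conj_perm_apply)

lemma cycles_on_conj_perm:
  assumes "\<pi> permutes {1..n}"
  shows "cycles_on n (conj_perm \<tau> \<pi>) = (`) \<tau> ` cycles_on n \<pi>"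
proof -
  have "cycles_on n (conj_perm \<tau> \<pi>) = orbit (conj_perm \<tau> \<pi>) ` (\<tau> ` {1..n})"
    by (simp only: cycles_on_def permutes_image[OF \<tau>])
  also have "\<dots> = (`) \<tau> ` cycles_on n \<pi>"
    by (simp only: cycles_on_def image_image orbit_conj_perm[OF assms])
  finally show ?thesis .
qed

lemma cycle_type_conj_perm:
  assumes "\<pi> permutes {1..n}"
  shows "cycle_type n (conj_perm \<tau> \<pi>) = cycle_type n \<pi>"
proof -
  have inj: "inj ((`) \<tau>)" using permutes_inj[OF \<tau>] by (simp add: inj_image_eq_iff inj_def)
  have "mset_set ((`) \<tau> ` cycles_on n \<pi>) = image_mset ((`) \<tau>) (mset_set (cycles_on n \<pi>))"
    by (rule image_mset_mset_set[symmetric]) (rule inj_on_subset[OF inj subset_UNIV])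
  moreover have "card (\<tau> ` C) = card C" for C
    by (rule card_image) (rule permutes_inj_on[OF \<tau>])
  ultimately show ?thesis
    unfolding cycle_type_def cycles_on_conj_perm[OF assms] by (simp add: multiset.map_comp o_def)
qed

lemma conj_perm_in_perms_of_type:
  "\<pi> \<in> perms_of_type n lam \<Longrightarrow> conj_perm \<tau> \<pi> \<in> perms_of_type n lam"
  unfolding perms_of_type_def mem_Collect_eq using conj_perm_permutes cycle_type_conj_perm by metis

lemma separated_conj_perm:
  assumes "\<pi> permutes {1..n}"
  shows "separated n (map ((`) \<tau>) A) (conj_perm \<tau> \<pi>) \<longleftrightarrow> separated n A \<pi>"
proof -
  have "\<tau> ` C \<inter> \<tau> ` B = {} \<longleftrightarrow> C \<inter> B = {}" for C B
    unfolding image_Int[OF permutes_inj[OF \<tau>], symmetric] by simp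
  thus ?thesis unfolding separated_def cycles_on_conj_perm[OF assms] by simp
qed

lemma map_image_in_disjoint_tuples:
  assumes "A \<in> disjoint_tuples n \<alpha>"
  shows "map ((`) \<tau>) A \<in> disjoint_tuples n \<alpha>"
proof -
  have "card (\<tau> ` C) = card C" for C by (rule card_image) (rule permutes_inj_on[OF \<tau>])
  moreover have "\<tau> ` C \<subseteq> {1..n}" if "C \<subseteq> {1..n}" for C
    using image_mono[OF that, of \<tau>] by (simp only: permutes_image[OF \<tau>])
  moreover have "\<tau> ` C \<inter> \<tau> ` B = {}" if "C \<inter> B = {}" for C B
    unfolding image_Int[OF permutes_inj[OF \<tau>], symmetric] that by simp
  ultimately show ?thesis using assms by (simp add: disjoint_tuples_def)
qed

end

text \<open>The relabelling \<open>\<tau>\<close> lists the single cycle of \<open>\<zeta>\<close>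
  in its cyclic order from 1 on, so that moving one place in the list is an application of
  \<open>\<zeta>\<close>.\<close>

lemma n_cycles_conjugate:
  assumes n: "1 \<le> n" and \<zeta>: "\<zeta> \<in> perms_of_type n {#n#}"
  obtains \<tau> where "\<tau> permutes {1..n}" "\<zeta> = conj_perm \<tau> (long_cycle n)"
proof -
  define N where "N = {1..n}"
  have p: "\<zeta> permutes N" and ct: "cycle_type n \<zeta> = {#n#}"
    using \<zeta> by (simp_all add: perms_of_type_def N_def)
  have finN: "finite N" by (simp add: N_def)
  have "orbit \<zeta> 1 = N"
  proof -
    have "orbit \<zeta> 1 \<in> cycles_on n \<zeta>" using n by (simp add: cycles_on_def)
    hence "card (orbit \<zeta> 1) \<in># cycle_type n \<zeta>" by (simp add: cycle_type_def cycles_on_def)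
    hence "card (orbit \<zeta> 1) = n" unfolding ct by simp
    moreover have "orbit \<zeta> 1 \<subseteq> N" by (rule permutes_orbit_subset[OF p]) (use n in \<open>simp add: N_def\<close>)
    ultimately show ?thesis using card_subset_eq[OF finN] by (simp add: N_def)
  qed note orb = this
  have self: "1 \<in> orbit \<zeta> 1" by (rule self_in_orbit[OF p finN])
  define L where "L = funpow_dist1 \<zeta> 1 1"
  have im: "N = (\<lambda>i. (\<zeta> ^^ i) 1) ` {0..<L}"
    using orbit_conv_funpow_dist1[OF self] unfolding L_def orb .
  have inj: "inj_on (\<lambda>i. (\<zeta> ^^ i) 1) {0..<L}" unfolding L_def by (rule inj_on_funpow_dist1[OF self])
  have "card N = card {0..<L}" unfolding im by (rule card_image[OF inj])
  hence Ln: "L = n" by (simp add: N_def)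
  have per: "(\<zeta> ^^ n) 1 = 1" using funpow_dist1_prop[OF self] unfolding L_def[symmetric] Ln .
  define \<tau> where "\<tau> = (\<lambda>i. if i \<in> N then (\<zeta> ^^ (i - 1)) 1 else i)"
  have "\<tau> permutes N"
  proof (rule bij_imp_permutes)
    have "bij_betw (\<lambda>i. i - 1) N {0..<n}"
      by (rule bij_betw_byWitness[where f' = Suc]) (auto simp: N_def)
    moreover have "bij_betw (\<lambda>i. (\<zeta> ^^ i) 1) {0..<n} N" using im inj by (simp add: bij_betw_def Ln)
    ultimately have b: "bij_betw ((\<lambda>i. (\<zeta> ^^ i) 1) \<circ> (\<lambda>i. i - 1)) N N" by (rule bij_betw_trans)
    show "bij_betw \<tau> N N"
      by (rule bij_betw_cong[THEN iffD2, OF _ b]) (simp add: \<tau>_def)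
  qed (simp add: \<tau>_def)
  hence \<tau>: "\<tau> permutes {1..n}" by (simp add: N_def)
  have step: "\<tau> (long_cycle n i) = \<zeta> (\<tau> i)" for i
  proof (cases "i \<in> N")
    case True
    then obtain j where j: "i = Suc j" "j < n" by (cases i) (auto simp: N_def)
    show ?thesis
    proof (cases "Suc j < n")
      case True
      thus ?thesis using j long_cycle_nth[OF j(2)] by (simp add: \<tau>_def N_def)
    next
      case False
      hence "Suc j = n" using j by simp
      thus ?thesis using j long_cycle_nth[OF j(2)] per n by (auto simp: \<tau>_def N_def)
    qed
  next
    case False
    hence "long_cycle n i = i" using long_cycle_permutes[of n] by (simp add: permutes_def N_def)
    moreover have "\<zeta> i = i" using p False by (simp add: permutes_def)
    ultimately show ?thesis using False by (simp add: \<tau>_def)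
  qed
  have "\<zeta> = conj_perm \<tau> (long_cycle n)"
    by (simp add: conj_perm_def fun_eq_iff step permutes_inverses(1)[OF \<tau>])
  thus ?thesis using \<tau> that by blast
qed

section \<open>Tuples of disjoint sets as colourings\<close>

text \<open>Elements outside all sets of the tuple get the additional colour \<open>length A\<close>.\<close>

definition tuple_colour :: "'i set list \<Rightarrow> 'i \<Rightarrow> nat" where
  "tuple_colour A i = (if \<exists>j<length A. i \<in> A ! j then SOME j. j < length A \<and> i \<in> A ! j else length A)"

lemma tuple_colour_eq_iff:
  assumes A: "A \<in> disjoint_tuples n \<alpha>" and j: "j < length \<alpha>"
  shows "tuple_colour A i = j \<longleftrightarrow> i \<in> A ! j"
proof -
  have len: "length A = length \<alpha>" using A by (simp add: disjoint_tuples_def)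
  have disj: "j' = j" if "j' < length A" "i \<in> A ! j'" "i \<in> A ! j" for j'
  proof (rule ccontr)
    assume "j' \<noteq> j"
    hence "A ! j' \<inter> A ! j = {}" using A that(1) j len by (simp add: disjoint_tuples_def)
    thus False using that by blast
  qed
  show ?thesis
  proof (cases "\<exists>j<length A. i \<in> A ! j")
    case True
    have "(SOME j. j < length A \<and> i \<in> A ! j) < length A \<and> i \<in> A ! (SOME j. j < length A \<and> i \<in> A ! j)"
      by (rule someI_ex) (use True in blast)
    hence "tuple_colour A i < length A \<and> i \<in> A ! tuple_colour A i"
      using True by (simp add: tuple_colour_def)
    thus ?thesis using disj by blast
  next
    case False
    thus ?thesis using j len by (auto simp: tuple_colour_def)
  qed
qed

lemma tuple_colour_le: "tuple_colour A i \<le> length A"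
proof (cases "\<exists>j<length A. i \<in> A ! j")
  case True
  have "(SOME j. j < length A \<and> i \<in> A ! j) < length A \<and> i \<in> A ! (SOME j. j < length A \<and> i \<in> A ! j)"
    by (rule someI_ex) (use True in blast)
  thus ?thesis using True by (simp add: tuple_colour_def)
next
  case False
  thus ?thesis unfolding tuple_colour_def if_not_P[OF False] by simp
qed

definition tuple_sizes :: "nat \<Rightarrow> nat list \<Rightarrow> nat \<Rightarrow> nat" where
  "tuple_sizes n \<alpha> j = (if j < length \<alpha> then \<alpha> ! j else if j = length \<alpha> then n - sum_list \<alpha> else 0)"

lemma deg_tuple_colour:
  assumes A: "A \<in> disjoint_tuples n \<alpha>"
  shows "deg (tuple_colour A) {1..n} j = tuple_sizes n \<alpha> j"
proof -
  define N where "N = {1..n}"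
  define k where "k = length \<alpha>"
  have len: "length A = k" using A by (simp add: disjoint_tuples_def k_def)
  have lt: "deg (tuple_colour A) N j = \<alpha> ! j" if j: "j < k" for j
  proof -
    have "A ! j \<subseteq> N" using A j by (simp add: disjoint_tuples_def k_def N_def)
    hence "{i \<in> N. tuple_colour A i = j} = A ! j"
      using tuple_colour_eq_iff[OF A, of j] j by (auto simp: k_def)
    thus ?thesis using A j by (simp add: deg_def disjoint_tuples_def k_def)
  qed
  have "card N = (\<Sum>j\<in>{..k}. card {i \<in> N. tuple_colour A i = j})"
    by (rule card_eq_sum_fibers) (use tuple_colour_le[of A] len in \<open>auto simp: N_def\<close>)
  also have "\<dots> = (\<Sum>j<k. \<alpha> ! j) + deg (tuple_colour A) N k"
    using lt by (simp add: lessThan_Suc_atMost[symmetric] deg_def)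
  also have "(\<Sum>j<k. \<alpha> ! j) = sum_list \<alpha>" by (simp add: k_def sum_list_sum_nth atLeast0LessThan)
  finally have eq: "deg (tuple_colour A) N k = n - sum_list \<alpha>" by (simp add: N_def)
  have gt: "deg (tuple_colour A) N j = 0" if "j > k" for j
  proof -
    have "tuple_colour A i \<noteq> j" for i using tuple_colour_le[of A i] that len by linarith
    thus ?thesis by (simp add: deg_def)
  qed
  show ?thesis using lt[of j] eq gt[of j] by (auto simp: tuple_sizes_def k_def N_def)
qed

text \<open>The colourings of two tuples have the same class sizes, so the permutations that carry
  one colouring to the other are counted by a product of factorials, which is positive.\<close>

lemma tuples_transitive:
  assumes A: "A \<in> disjoint_tuples n \<alpha>" and B: "B \<in> disjoint_tuples n \<alpha>"
  obtains \<tau> where "\<tau> permutes {1..n}" "map ((`) \<tau>) A = B"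
proof -
  define N where "N = {1..n}"
  have finN: "finite N" by (simp add: N_def)
  have "card {\<theta>. \<theta> permutes N \<and> (\<forall>i\<in>N. tuple_colour B (\<theta> i) = tuple_colour A i)} =
      (\<Prod>a\<in>tuple_colour A ` N. fact (deg (tuple_colour A) N a))"
    by (rule card_permutes_labellings[OF finN]) (use deg_tuple_colour[OF A] deg_tuple_colour[OF B] finN in \<open>simp_all add: N_def\<close>)
  also have "\<dots> > 0" by (simp add: prod_pos)
  finally have "{\<theta>. \<theta> permutes N \<and> (\<forall>i\<in>N. tuple_colour B (\<theta> i) = tuple_colour A i)} \<noteq> {}"
    by (metis card.empty less_irrefl)
  then obtain \<tau> where \<tau>: "\<tau> permutes N" "\<And>i. i \<in> N \<Longrightarrow> tuple_colour B (\<tau> i) = tuple_colour A i" by blast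
  have "map ((`) \<tau>) A = B"
  proof (rule nth_equalityI)
    show "length (map ((`) \<tau>) A) = length B" using A B by (simp add: disjoint_tuples_def)
    fix j assume "j < length (map ((`) \<tau>) A)"
    hence j: "j < length \<alpha>" "j < length A" using A by (simp_all add: disjoint_tuples_def)
    have "\<tau> ` (A ! j) \<subseteq> B ! j"
    proof (rule image_subsetI)
      fix i assume i: "i \<in> A ! j"
      have "A ! j \<subseteq> N" using A j(1) by (simp add: disjoint_tuples_def N_def)
      hence "i \<in> N" using i by blast
      thus "\<tau> i \<in> B ! j"
        using \<tau>(2)[of i] i tuple_colour_eq_iff[OF A j(1)] tuple_colour_eq_iff[OF B j(1)] by metis
    qed
    moreover have "card (\<tau> ` (A ! j)) = card (B ! j)"
      using A B j(1) by (simp add: card_image permutes_inj_on[OF \<tau>(1)] disjoint_tuples_def)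
    moreover have "finite (B ! j)"
      using B j(1) by (auto simp: disjoint_tuples_def intro: finite_subset)
    ultimately show "map ((`) \<tau>) A ! j = B ! j" using j(2) card_subset_eq by (metis nth_map)
  qed
  thus ?thesis using \<tau>(1) that by (simp add: N_def)
qed

text \<open>Composing one colouring \<open>ob\<close> with all permutations of \<open>N\<close>
  reaches each colouring equally often, namely once for every way to arrange the points within the
  classes.\<close>

lemma card_colourings:
  assumes finN: "finite N" and P: "finite P" "\<And>a. a \<notin> P \<Longrightarrow> \<gamma> a = 0" "sum \<gamma> P = card N"
  shows "card (colourings N \<gamma>) * (\<Prod>a\<in>P. fact (\<gamma> a)) = fact (card N)"
proof -
  obtain ob where ob: "\<And>a. deg ob N a = \<gamma> a" using exists_colouring[OF P(1) finN P(3,2)] by blast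
  have fin: "finite (colourings N \<gamma>)"
    by (rule finite_colourings[OF finN], rule finite_subset[OF _ P(1)]) (use P(2) in fastforce)
  have "card {\<theta>. \<theta> permutes N} = (\<Sum>f\<in>colourings N \<gamma>. card {\<theta> \<in> {\<theta>. \<theta> permutes N}. restrict (ob \<circ> \<theta>) N = f})"
    by (rule card_eq_sum_fibers[OF finite_permutations[OF finN] fin])
      (use colourings_comp_permutes[of ob N \<gamma>] ob in auto)
  also have "\<dots> = (\<Sum>f\<in>colourings N \<gamma>. \<Prod>a\<in>P. fact (\<gamma> a))"
  proof (rule sum.cong[OF refl])
    fix f assume f: "f \<in> colourings N \<gamma>"
    have d: "deg f N a = \<gamma> a" for a using f by (simp add: colourings_def)
    have "restrict (ob \<circ> \<theta>) N = f \<longleftrightarrow> (\<forall>i\<in>N. ob (\<theta> i) = f i)" for \<theta>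
      using f by (auto simp: fun_eq_iff restrict_def extensional_def colourings_def)
    moreover have "f ` N \<subseteq> P"
      unfolding colourings_image[OF finN d] using P(2) by fastforce
    ultimately show "card {\<theta> \<in> {\<theta>. \<theta> permutes N}. restrict (ob \<circ> \<theta>) N = f} = (\<Prod>a\<in>P. fact (\<gamma> a))"
      using card_permutes_labellings[OF finN P(1), of f ob] d ob by simp
  qed
  finally show ?thesis by (simp add: card_permutations[OF refl finN])
qed

text \<open>A tuple amounts to a colouring by \<open>0..k\<close> in which the last colour marks the
  points outside all sets. Its class sizes are the parts of \<open>\<alpha>\<close> and the
  remainder, which gives the multinomial coefficient.\<close>

lemma card_disjoint_tuples:
  assumes m: "sum_list \<alpha> \<le> n"
  shows "real (card (disjoint_tuples n \<alpha>)) = multinomial_coeff (\<alpha> @ [n - sum_list \<alpha>])"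
proof -
  define N where "N = {1..n}"
  define k where "k = length \<alpha>"
  define \<gamma> where "\<gamma> = tuple_sizes n \<alpha>"
  have finN: "finite N" by (simp add: N_def)
  have "bij_betw (\<lambda>A. restrict (tuple_colour A) N) (disjoint_tuples n \<alpha>) (colourings N \<gamma>)"
  proof (rule bij_betw_byWitness[where f' = "\<lambda>f. map (\<lambda>j. {i \<in> N. f i = j}) [0..<k]"])
    show "\<forall>A\<in>disjoint_tuples n \<alpha>. map (\<lambda>j. {i \<in> N. restrict (tuple_colour A) N i = j}) [0..<k] = A"
    proof
      fix A assume A: "A \<in> disjoint_tuples n \<alpha>"
      show "map (\<lambda>j. {i \<in> N. restrict (tuple_colour A) N i = j}) [0..<k] = A"
      proof (rule nth_equalityI)
        show len: "length (map (\<lambda>j. {i \<in> N. restrict (tuple_colour A) N i = j}) [0..<k]) = length A"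
          using A by (simp add: disjoint_tuples_def k_def)
        fix j assume "j < length (map (\<lambda>j. {i \<in> N. restrict (tuple_colour A) N i = j}) [0..<k])"
        hence j: "j < k" by simp
        have "A ! j \<subseteq> N" using A j by (simp add: disjoint_tuples_def k_def N_def)
        hence "{i \<in> N. restrict (tuple_colour A) N i = j} = A ! j"
          using tuple_colour_eq_iff[OF A, of j] j by (auto simp: k_def)
        thus "map (\<lambda>j. {i \<in> N. restrict (tuple_colour A) N i = j}) [0..<k] ! j = A ! j" using j by simp
      qed
    qed
    have levels: "map (\<lambda>j. {i \<in> N. f i = j}) [0..<k] \<in> disjoint_tuples n \<alpha>" if f: "f \<in> colourings N \<gamma>" for f
    proof -
      have "card {i \<in> N. f i = j} = \<alpha> ! j" if "j < k" for j
        using f that by (simp add: colourings_def deg_def \<gamma>_def tuple_sizes_def k_def)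
      thus ?thesis by (auto simp: disjoint_tuples_def k_def N_def)
    qed
    show "(\<lambda>f. map (\<lambda>j. {i \<in> N. f i = j}) [0..<k]) ` colourings N \<gamma> \<subseteq> disjoint_tuples n \<alpha>"
      using levels by blast
    show "(\<lambda>A. restrict (tuple_colour A) N) ` disjoint_tuples n \<alpha> \<subseteq> colourings N \<gamma>"
    proof (rule image_subsetI)
      fix A assume A: "A \<in> disjoint_tuples n \<alpha>"
      have "restrict (tuple_colour A \<circ> id) N \<in> colourings N \<gamma>"
        by (rule colourings_comp_permutes[OF _ permutes_id])
          (simp only: \<gamma>_def N_def deg_tuple_colour[OF A])
      thus "restrict (tuple_colour A) N \<in> colourings N \<gamma>" by simp
    qed
    show "\<forall>f\<in>colourings N \<gamma>. restrict (tuple_colour (map (\<lambda>j. {i \<in> N. f i = j}) [0..<k])) N = f"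
    proof
      fix f assume f: "f \<in> colourings N \<gamma>"
      have "tuple_colour (map (\<lambda>j. {i \<in> N. f i = j}) [0..<k]) i = f i" if i: "i \<in> N" for i
      proof -
        have "deg f N (f i) > 0" using i finN by (simp add: deg_pos_iff)
        hence "tuple_sizes n \<alpha> (f i) > 0" using f by (simp add: colourings_def \<gamma>_def)
        hence "f i \<le> k" by (auto simp: tuple_sizes_def k_def split: if_splits)
        show ?thesis
        proof (cases "f i < k")
          case True
          thus ?thesis using tuple_colour_eq_iff[OF levels[OF f], of "f i" i] i by (simp add: k_def)
        next
          case False
          hence "f i = k" using \<open>f i \<le> k\<close> by simp
          hence "\<not> (\<exists>j<length (map (\<lambda>j. {i \<in> N. f i = j}) [0..<k]). i \<in> map (\<lambda>j. {i \<in> N. f i = j}) [0..<k] ! j)"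
            by auto
          thus ?thesis using \<open>f i = k\<close> unfolding tuple_colour_def by (simp only: if_False length_map length_upt diff_zero)
        qed
      qed
      thus "restrict (tuple_colour (map (\<lambda>j. {i \<in> N. f i = j}) [0..<k])) N = f"
        using f by (auto simp: fun_eq_iff colourings_def extensional_def restrict_def)
    qed
  qed
  hence c: "card (disjoint_tuples n \<alpha>) = card (colourings N \<gamma>)" by (rule bij_betw_same_card)
  have sk: "sum_list \<alpha> = (\<Sum>j<k. \<alpha> ! j)" by (simp add: k_def sum_list_sum_nth atLeast0LessThan)
  have "sum \<gamma> {..k} = (\<Sum>j<k. \<alpha> ! j) + (n - sum_list \<alpha>)"
    by (simp add: lessThan_Suc_atMost[symmetric] \<gamma>_def tuple_sizes_def k_def)
  hence sum: "sum \<gamma> {..k} = card N" using m sk by (simp add: N_def)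
  have "card (colourings N \<gamma>) * (\<Prod>a\<in>{..k}. fact (\<gamma> a)) = fact (card N)"
    by (rule card_colourings[OF finN _ _ sum]) (auto simp: \<gamma>_def tuple_sizes_def k_def)
  moreover have "(\<Prod>a\<in>{..k}. fact (\<gamma> a)) = prod_list (map fact (\<alpha> @ [n - sum_list \<alpha>])) "
  proof -
    have "(\<Prod>a\<in>{..k}. fact (\<gamma> a)) = (\<Prod>j<k. fact (\<alpha> ! j)) * fact (n - sum_list \<alpha>)"
      by (simp add: lessThan_Suc_atMost[symmetric] \<gamma>_def tuple_sizes_def k_def)
    also have "(\<Prod>j<k. fact (\<alpha> ! j)) = prod_list (map fact \<alpha>)"
      by (simp add: prod.list_conv_set_nth k_def atLeast0LessThan)
    finally show ?thesis by simp
  qed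
  ultimately have "real (card (disjoint_tuples n \<alpha>)) * real (prod_list (map fact (\<alpha> @ [n - sum_list \<alpha>]))) = fact n"
    unfolding c by (metis N_def card_atLeastAtMost diff_Suc_1 of_nat_fact of_nat_mult)
  moreover have "real (prod_list (map fact xs)) = prod_list (map fact xs)" for xs
    by (induction xs) auto
  moreover have "prod_list (map fact xs) \<noteq> (0 :: real)" for xs by (induction xs) auto
  ultimately show ?thesis unfolding multinomial_coeff_def using m by (simp add: field_simps)
qed

section \<open>The probability by double counting\<close>

lemma pair_pmf_of_set:
  assumes "finite A" "A \<noteq> {}" "finite B" "B \<noteq> {}"
  shows "pair_pmf (pmf_of_set A) (pmf_of_set B) = pmf_of_set (A \<times> B)"
proof (rule pmf_eqI)
  fix x :: "'a \<times> 'b"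
  show "pmf (pair_pmf (pmf_of_set A) (pmf_of_set B)) x = pmf (pmf_of_set (A \<times> B)) x"
    using assms by (cases x) (auto simp: pmf_pair card_cartesian_product indicator_def)
qed

text \<open>The separated triples of a tuple, a permutation of type \<open>lam\<close> and an
  \<open>n\<close>-cycle are counted twice. The number for a fixed tuple does not depend on the
  tuple, and the number for a fixed \<open>n\<close>-cycle does not depend on the cycle, which may
  then be taken to be \<open>long_cycle n\<close>.\<close>

theorem sep_prob_eq:
  assumes n: "1 \<le> n" and \<alpha>: "is_composition \<alpha> m" and m: "m \<le> n"
    and lam: "lam \<in> partitions_of n" and A: "A \<in> disjoint_tuples n \<alpha>"
  shows "sep_prob n lam A = real (card (separated_pairs n lam \<alpha>)) /
    (multinomial_coeff (\<alpha> @ [n - m]) * real (card (perms_of_type n lam)))"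
proof -
  define C where "C = perms_of_type n lam"
  define Z where "Z = perms_of_type n {#n#}"
  define T where "T = disjoint_tuples n \<alpha>"
  define S where "S A = {(\<pi>, \<zeta>). \<pi> \<in> C \<and> \<zeta> \<in> Z \<and> separated n A (\<pi> \<circ> \<zeta>)}" for A
  define M where "M \<zeta> = {(\<pi>, A). \<pi> \<in> C \<and> A \<in> T \<and> separated n A (\<pi> \<circ> \<zeta>)}" for \<zeta>
  have fin: "finite C" "finite Z" "finite T"
    by (simp_all add: C_def Z_def T_def finite_perms_of_type finite_disjoint_tuples)
  have ne: "C \<noteq> {}" "Z \<noteq> {}"
    using perms_of_type_nonempty[OF lam] long_cycle_in_perms_of_type[OF n] by (auto simp: C_def Z_def)
  have finS: "finite (S A)" for A by (rule finite_subset[of _ "C \<times> Z"]) (use fin in \<open>auto simp: S_def\<close>)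
  have finM: "finite (M \<zeta>)" for \<zeta> by (rule finite_subset[of _ "C \<times> T"]) (use fin in \<open>auto simp: M_def\<close>)
  have perm: "\<pi> \<circ> \<zeta> permutes {1..n}" if "\<pi> \<in> C" "\<zeta> \<in> Z" for \<pi> \<zeta>
    using that by (auto simp: C_def Z_def perms_of_type_def intro: permutes_compose)
  \<comment> \<open>An inequality suffices, as the roles of the two tuples can be exchanged; the
    inequality for \<open>M\<close> below is likewise used in both directions.\<close>
  have S_le: "card (S A) \<le> card (S B)" if AB: "A \<in> T" "B \<in> T" for A B
  proof -
    obtain \<tau> where \<tau>: "\<tau> permutes {1..n}" "map ((`) \<tau>) A = B"
      using tuples_transitive AB unfolding T_def by metis
    show ?thesis
    proof (rule card_inj_on_le[where f = "map_prod (conj_perm \<tau>) (conj_perm \<tau>)"])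
      show "inj_on (map_prod (conj_perm \<tau>) (conj_perm \<tau>)) (S A)"
        by (auto intro!: inj_onI dest: conj_perm_inject[OF \<tau>(1)])
      show "map_prod (conj_perm \<tau>) (conj_perm \<tau>) ` S A \<subseteq> S B"
      proof (rule image_subsetI)
        fix x assume "x \<in> S A"
        then obtain \<pi> \<zeta> where x: "x = (\<pi>, \<zeta>)" "\<pi> \<in> C" "\<zeta> \<in> Z" "separated n A (\<pi> \<circ> \<zeta>)" by (auto simp: S_def)
        have "separated n B (conj_perm \<tau> \<pi> \<circ> conj_perm \<tau> \<zeta>)"
          unfolding conj_perm_comp[OF \<tau>(1), symmetric] \<tau>(2)[symmetric]
            separated_conj_perm[OF \<tau>(1) perm[OF x(2,3)]] by (rule x(4))
        thus "map_prod (conj_perm \<tau>) (conj_perm \<tau>) x \<in> S B"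
          using x conj_perm_in_perms_of_type[OF \<tau>(1)] by (simp add: S_def C_def Z_def)
      qed
    qed (rule finS)
  qed
  have S_eq: "card (S B) = card (S A)" if "B \<in> T" for B
    using S_le[of A B] S_le[of B A] that A by (simp add: T_def)
  have M_le: "card (M \<zeta>) \<le> card (M (conj_perm \<tau> \<zeta>))" if \<tau>: "\<tau> permutes {1..n}" and \<zeta>: "\<zeta> \<in> Z" for \<tau> \<zeta>
  proof (rule card_inj_on_le[where f = "map_prod (conj_perm \<tau>) (map ((`) \<tau>))"])
    have "inj (map ((`) \<tau>))"
      using permutes_inj[OF \<tau>] by (simp add: inj_image_eq_iff inj_def)
    moreover have "inj (conj_perm \<tau>)" by (rule injI) (rule conj_perm_inject[OF \<tau>])
    ultimately have "inj (map_prod (conj_perm \<tau>) (map ((`) \<tau>)))" by (intro prod.inj_map)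
    thus "inj_on (map_prod (conj_perm \<tau>) (map ((`) \<tau>))) (M \<zeta>)" by (rule inj_on_subset) simp
    show "map_prod (conj_perm \<tau>) (map ((`) \<tau>)) ` M \<zeta> \<subseteq> M (conj_perm \<tau> \<zeta>)"
    proof (rule image_subsetI)
      fix x assume "x \<in> M \<zeta>"
      then obtain \<pi> B where x: "x = (\<pi>, B)" "\<pi> \<in> C" "B \<in> T" "separated n B (\<pi> \<circ> \<zeta>)" by (auto simp: M_def)
      have "separated n (map ((`) \<tau>) B) (conj_perm \<tau> \<pi> \<circ> conj_perm \<tau> \<zeta>)"
        unfolding conj_perm_comp[OF \<tau>, symmetric] separated_conj_perm[OF \<tau> perm[OF x(2) \<zeta>]] by (rule x(4))
      thus "map_prod (conj_perm \<tau>) (map ((`) \<tau>)) x \<in> M (conj_perm \<tau> \<zeta>)"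
        using x conj_perm_in_perms_of_type[OF \<tau>] map_image_in_disjoint_tuples[OF \<tau>]
        by (simp add: M_def C_def T_def)
    qed
  qed (rule finM)
  have M_eq: "card (M \<zeta>) = card (separated_pairs n lam \<alpha>)" if \<zeta>: "\<zeta> \<in> Z" for \<zeta>
  proof -
    obtain \<tau> where \<tau>: "\<tau> permutes {1..n}" "\<zeta> = conj_perm \<tau> (long_cycle n)"
      using n_cycles_conjugate[OF n] \<zeta> unfolding Z_def by metis
    have inv\<tau>: "inv \<tau> permutes {1..n}" by (rule permutes_inv[OF \<tau>(1)])
    have "conj_perm (inv \<tau>) \<zeta> = long_cycle n"
      unfolding \<tau>(2) by (simp add: conj_perm_def fun_eq_iff permutes_inverses[OF \<tau>(1)] permutes_inv_inv[OF \<tau>(1)])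
    hence "card (M \<zeta>) \<le> card (M (long_cycle n))" using M_le[OF inv\<tau> \<zeta>] by simp
    moreover have "card (M (long_cycle n)) \<le> card (M \<zeta>)"
      using M_le[OF \<tau>(1)] long_cycle_in_perms_of_type[OF n] unfolding \<tau>(2) Z_def by simp
    moreover have "M (long_cycle n) = separated_pairs n lam \<alpha>"
      by (simp add: M_def separated_pairs_def C_def T_def)
    ultimately show ?thesis by simp
  qed
  have "card T * card (S A) = (\<Sum>B\<in>T. card (S B))" using S_eq by simp
  also have "\<dots> = card (SIGMA B:T. S B)" using fin(3) finS by (simp add: card_SigmaI)
  also have "\<dots> = card (SIGMA \<zeta>:Z. M \<zeta>)"
    by (rule bij_betw_same_card[where f = "\<lambda>(B, \<pi>, \<zeta>). (\<zeta>, \<pi>, B)"],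
        rule bij_betw_byWitness[where f' = "\<lambda>(\<zeta>, \<pi>, B). (B, \<pi>, \<zeta>)"]) (auto simp: S_def M_def)
  also have "\<dots> = card Z * card (separated_pairs n lam \<alpha>)" using fin(2) finM M_eq by (simp add: card_SigmaI)
  finally have key: "card T * card (S A) = card Z * card (separated_pairs n lam \<alpha>)" .
  have "sep_prob n lam A = card ((C \<times> Z) \<inter> {(\<pi>, \<zeta>). separated n A (\<pi> \<circ> \<zeta>)}) / card (C \<times> Z)"
    unfolding sep_prob_def C_def[symmetric] Z_def[symmetric] pair_pmf_of_set[OF fin(1) ne(1) fin(2) ne(2)]
    by (rule measure_pmf_of_set) (use fin ne in auto)
  also have "(C \<times> Z) \<inter> {(\<pi>, \<zeta>). separated n A (\<pi> \<circ> \<zeta>)} = S A" by (auto simp: S_def)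
  finally have prob: "sep_prob n lam A = real (card (S A)) / (real (card C) * real (card Z))"
    by (simp add: card_cartesian_product)
  have pos: "card Z \<noteq> 0" "card T \<noteq> 0" using fin ne A by (auto simp: T_def)
  have "sep_prob n lam A = (real (card T) * real (card (S A))) / (real (card T) * real (card C) * real (card Z))"
    unfolding prob using pos by simp
  also have "\<dots> = real (card (separated_pairs n lam \<alpha>)) / (real (card T) * real (card C))"
    unfolding of_nat_mult[symmetric] key unfolding of_nat_mult using pos by simp
  also have "real (card T) = multinomial_coeff (\<alpha> @ [n - m])"
    using card_disjoint_tuples[of \<alpha> n] \<alpha> m by (simp add: is_composition_def T_def)
  finally show ?thesis by (simp add: C_def)
qed

theorem theorem3p1:
  fixes n m k :: nat and \<alpha> :: "nat list" and t :: "'a::field_char_0"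
  assumes "1 \<le> n" and "is_composition \<alpha> m" and "m \<le> n" and "k = length \<alpha>"
  shows "sep_gf n \<alpha> (t + of_nat k) =
      (\<Sum>r=0..n - m. mvps_scale ((t gchoose r) * of_nat ((n + k - 1) choose (n - m - r)))
        (\<Sum>lam | lam \<in> partitions_of n \<and> size lam \<le> n - k - r + 1.
          mvps_scale (of_nat n * fact (n - size lam) * fact (n - k - r) /
                      fact (n - k - r + 1 - size lam))
            (monomial_sym lam)))
    \<and> (\<forall>lam\<in>partitions_of n.
        of_nat (card (separated_pairs n lam \<alpha>)) = power_sum_coeff lam (sep_gf n \<alpha> (1 :: 'a)) \<and>
        (\<forall>A\<in>disjoint_tuples n \<alpha>.
          sep_prob n lam A =
            real (card (separated_pairs n lam \<alpha>)) /
            (multinomial_coeff (\<alpha> @ [n - m]) * real (card (perms_of_type n lam)))))"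
  using sep_gf_eq[OF assms] card_separated_pairs_eq_power_sum_coeff sep_prob_eq[OF assms(1-3)] by blast

end
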